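(* There is an $O(1)$-round MPC algorithm with $\tilde{O}(n/\varepsilon)$ words of local memory per machine and $\tilde{O}(m+n/\varepsilon)$ words of total memory that finds a $(3+\varepsilon)$-approximate correlation clustering. The approximation guarantee holds in expectation and with high probability.
   Context: Correlation clustering: input is a simple undirected graph $G=(V,E^+)$ with $n$ nodes and $m$ edges (positive edges); distinct non-adjacent pairs are negative. The cost of a partition of $V$ into clusters is the number of positive edges between different clusters plus the number of negative pairs within a cluster; $\mathrm{OPT}$ is the minimum cost; a $(3+\varepsilon)$-approximate clustering has cost at most $(3+\varepsilon)\mathrm{OPT}$. MPC model: $M$ machines each with $S$ words of memory (a word is $O(\log n)$ bits), communicating in synchronous all-to-all rounds; the input graph is distributed among the machines, each node together with its incident edges on one machine; local memory is $S$ and total memory is $M\cdot S$. $\tilde{O}(\cdot)$ hides polylogarithmic factors in $n$. With high probability means with probability at least $1-n^{-c'}$ for a desirably large constant $c'$. *)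

theory Defs
  imports "HOL-Probability.Probability" "HOL-Probability.Product_PMF" "HOL-Library.Disjoint_Sets"
begin

subsection \<open>Correlation clustering\<close>

definition node_pairs :: "'a set \<Rightarrow> 'a set set" where
  "node_pairs V = {e. e \<subseteq> V \<and> card e = 2}"

definition simple_graph :: "'a set \<Rightarrow> 'a set set \<Rightarrow> bool" where
  "simple_graph V E \<longleftrightarrow> finite V \<and> E \<subseteq> node_pairs V"

definition neighbours :: "'a set set \<Rightarrow> 'a \<Rightarrow> 'a set" where
  "neighbours E v = {u. {u, v} \<in> E}"

definition within_cluster :: "'a set set \<Rightarrow> 'a set \<Rightarrow> bool" where
  "within_cluster P e \<longleftrightarrow> (\<exists>C\<in>P. e \<subseteq> C)"

definition cc_cost :: "'a set \<Rightarrow> 'a set set \<Rightarrow> 'a set set \<Rightarrow> nat" where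
  "cc_cost V E P =
     card {e \<in> E. \<not> within_cluster P e} + card {e \<in> node_pairs V - E. within_cluster P e}"

definition cc_opt :: "'a set \<Rightarrow> 'a set set \<Rightarrow> nat" where
  "cc_opt V E = Min (cc_cost V E ` {P. partition_on V P})"


subsection \<open>The MPC model\<close>

text \<open>
  Words are natural numbers. A local memory consists of a list of words and one message per
  machine. Before communication the message component is the outbox, indexed by the receiver;
  after communication it is the inbox, indexed by the sender.
\<close>

type_synonym mpc_memory = "nat list \<times> (nat \<Rightarrow> nat list)"
type_synonym mpc_config = "nat \<Rightarrow> mpc_memory"

text \<open>
  The machines are \<open>0, \<dots>, machines - 1\<close>. In round \<open>r\<close>, machine \<open>i\<close> turns its memory into retained
  words and an outbox by \<open>local_step r i\<close>; local computation is unrestricted and may use private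
  randomness. Random choices that are needed later have to be retained in memory. After the last
  round, \<open>local_output i\<close> lists pairs of a node and a cluster label.
\<close>

record mpc_algorithm =
  machines :: nat
  local_memory :: nat
  word_bits :: nat
  rounds :: nat
  local_step :: "nat \<Rightarrow> nat \<Rightarrow> mpc_memory \<Rightarrow> mpc_memory pmf"
  local_output :: "nat \<Rightarrow> mpc_memory \<Rightarrow> (nat \<times> nat) list"

definition deliver :: "(nat \<Rightarrow> mpc_memory) \<Rightarrow> mpc_config" where
  "deliver x = (\<lambda>i. (fst (x i), \<lambda>j. snd (x j) i))"

definition mpc_round :: "mpc_algorithm \<Rightarrow> nat \<Rightarrow> mpc_config \<Rightarrow> mpc_config pmf" where
  "mpc_round A r c =
     map_pmf deliver (Pi_pmf {..<machines A} ([], \<lambda>_. []) (\<lambda>i. local_step A r i (c i)))"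

primrec mpc_run :: "mpc_algorithm \<Rightarrow> mpc_config \<Rightarrow> nat \<Rightarrow> mpc_config pmf" where
  "mpc_run A c 0 = return_pmf c"
| "mpc_run A c (Suc r) = bind_pmf (mpc_run A c r) (mpc_round A r)"

definition words_used :: "mpc_algorithm \<Rightarrow> mpc_memory \<Rightarrow> nat" where
  "words_used A x = length (fst x) + (\<Sum>j<machines A. length (snd x j))"

definition is_word :: "mpc_algorithm \<Rightarrow> nat \<Rightarrow> bool" where
  "is_word A a \<longleftrightarrow> a < 2 ^ word_bits A"

definition memory_ok :: "mpc_algorithm \<Rightarrow> mpc_memory \<Rightarrow> bool" where
  "memory_ok A x \<longleftrightarrow> words_used A x \<le> local_memory A \<and>
     (\<forall>a \<in> set (fst x) \<union> (\<Union>j<machines A. set (snd x j)). is_word A a)"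

definition output_ok :: "mpc_algorithm \<Rightarrow> (nat \<times> nat) list \<Rightarrow> bool" where
  "output_ok A L \<longleftrightarrow> 2 * length L \<le> local_memory A \<and>
     (\<forall>(v, l) \<in> set L. is_word A v \<and> is_word A l)"

text \<open>
  The memory constraints hold for every outcome of the random choices: at the start of each round
  (retained words together with everything received), before communication (retained words together
  with everything to be sent), and for the output.
\<close>

definition respects_memory :: "mpc_algorithm \<Rightarrow> mpc_config \<Rightarrow> bool" where
  "respects_memory A c0 \<longleftrightarrow>
     (\<forall>r \<le> rounds A. \<forall>c \<in> set_pmf (mpc_run A c0 r). \<forall>i < machines A. memory_ok A (c i)) \<and>
     (\<forall>r < rounds A. \<forall>c \<in> set_pmf (mpc_run A c0 r). \<forall>i < machines A.
        \<forall>x \<in> set_pmf (local_step A r i (c i)). memory_ok A x) \<and>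
     (\<forall>c \<in> set_pmf (mpc_run A c0 (rounds A)). \<forall>i < machines A.
        output_ok A (local_output A i (c i)))"

text \<open>A placement maps each node to the machine that holds it together with its incident edges.\<close>

definition encode_node :: "nat set set \<Rightarrow> nat \<Rightarrow> nat list" where
  "encode_node E v = v # card (neighbours E v) # sorted_list_of_set (neighbours E v)"

definition input_config :: "nat set \<Rightarrow> nat set set \<Rightarrow> (nat \<Rightarrow> nat) \<Rightarrow> mpc_config" where
  "input_config V E f =
     (\<lambda>i. (concat (map (encode_node E) (sorted_list_of_set {v \<in> V. f v = i})), \<lambda>_. []))"

definition admissible_placement ::
    "mpc_algorithm \<Rightarrow> nat set \<Rightarrow> nat set set \<Rightarrow> (nat \<Rightarrow> nat) \<Rightarrow> bool" where
  "admissible_placement A V E f \<longleftrightarrow> (\<forall>v \<in> V. f v < machines A) \<and>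
     (\<forall>i < machines A. words_used A (input_config V E f i) \<le> local_memory A)"

definition output_clusters :: "mpc_algorithm \<Rightarrow> mpc_config \<Rightarrow> nat set set" where
  "output_clusters A c =
     (let L = (\<Union>i<machines A. set (local_output A i (c i)))
      in (\<lambda>l. {v. (v, l) \<in> L}) ` Range L)"

definition mpc_clustering :: "mpc_algorithm \<Rightarrow> mpc_config \<Rightarrow> nat set set pmf" where
  "mpc_clustering A c0 = map_pmf (output_clusters A) (mpc_run A c0 (rounds A))"

end

theory Submission
  imports Defs
begin

text \<open>
  Since local computation is unrestricted, the clustering can be improved by sampling. Suppose that a
  clustering \<open>g\<close> errs on a set of \<open>d\<close> node pairs. The cost of any other clustering is then known up to
  the number of these pairs on which it deviates from \<open>g\<close>, and \<open>O(n log n)\<close> samples determine this number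
  up to \<open>d / 20\<close> for all clusterings simultaneously, by Hoeffding's inequality and a union bound over
  \<open>n ^ n\<close> labellings. If \<open>d\<close> is at most ten times the optimum, minimising the estimated cost yields a
  3-approximation, whatever \<open>\<epsilon>\<close> is; and the result never costs more than \<open>3 * d\<close>.

  Such a \<open>g\<close> comes from a random pivot algorithm in which every node looks at its first two neighbours
  in the random order only, so that \<open>O(n)\<close> words determine the outcome. Its expected cost is at most five
  times the optimum, and the best of \<open>O(log n)\<close> independent runs is good with high probability.
\<close>

subsection \<open>Finitely supported distributions\<close>

text \<open>Machine 0 has room for about \<open>n log n\<close> words, possibly far fewer than
  \<open>m\<close>, so the graph cannot in general be collected in one place. Estimating costs from
  uniform samples of edges or node pairs would not help either: the error would scale with the
  number of edges or pairs, while the optimum can be much smaller, even 0. Sampling the difference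
  between the graph and a clustering \<open>g\<close> within a constant factor of the optimum makes
  the error scale with the optimum. Any constant factor would serve. Here it is 5: bad triangles
  account for 3, as in the ordinary pivot algorithm, and the potential that pays for the edges of
  truncated nodes adds 2. High probability and expectation are wanted at once. The latter also needs
  control over outcomes with a misleading sample, which is the purpose of the bound
  \<open>3 * d\<close>. Machine 0 never sees the errors of \<open>g\<close> themselves; their number
  at each node is enough to draw uniform indices into them, and the nodes resolve these
  indices.\<close>

lemma expectation_random_permutation:
  fixes f :: "'a list \<Rightarrow> real"
  assumes "finite U" "U \<noteq> {}"
  shows "measure_pmf.expectation (pmf_of_set (permutations_of_set U)) f
    = (\<Sum>x\<in>U. measure_pmf.expectation (pmf_of_set (permutations_of_set (U - {x}))) (\<lambda>xs. f (x # xs))) / card U"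
proof -
  have "measure_pmf.expectation (pmf_of_set (permutations_of_set U)) f
    = (\<Sum>x\<in>U. measure_pmf.expectation (map_pmf ((#) x) (pmf_of_set (permutations_of_set (U - {x})))) f /\<^sub>R card U)"
    unfolding random_permutation_of_set[OF assms] map_pmf_def[symmetric]
    using assms by (intro pmf_expectation_bind_pmf_of_set) auto
  also have "\<dots> = (\<Sum>x\<in>U. measure_pmf.expectation (pmf_of_set (permutations_of_set (U - {x}))) (\<lambda>xs. f (x # xs)) / card U)"
    by (simp add: divide_inverse mult.commute)
  finally show ?thesis by (simp add: sum_divide_distrib)
qed

lemma expectation_mono_finite:
  fixes f h :: "'c \<Rightarrow> real"
  assumes "finite (set_pmf p)" "\<And>x. x \<in> set_pmf p \<Longrightarrow> f x \<le> h x"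
  shows "measure_pmf.expectation p f \<le> measure_pmf.expectation p h"
  using assms by (intro integral_mono_AE integrable_measure_pmf_finite) (auto simp: AE_measure_pmf_iff)

lemma expectation_bind_finite:
  fixes h :: "'b \<Rightarrow> real"
  assumes "finite (set_pmf p)" "\<And>x. x \<in> set_pmf p \<Longrightarrow> finite (set_pmf (f x))"
  shows "measure_pmf.expectation (bind_pmf p f) h
    = measure_pmf.expectation p (\<lambda>x. measure_pmf.expectation (f x) h)"
  using assms by (subst pmf_expectation_bind[where A="set_pmf p"])
    (auto simp: integral_measure_pmf[where A="set_pmf p"])

text \<open>A two-stage experiment: the conditional probability of \<open>S\<close> is bounded by 1
  after a first stage in \<open>B\<close> and by \<open>c\<close> after any other.\<close>

lemma prob_bind_finite_le:
  assumes "finite (set_pmf p)" "\<And>x. x \<in> set_pmf p \<Longrightarrow> finite (set_pmf (f x))"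
    and "\<And>x. x \<in> set_pmf p \<Longrightarrow> x \<notin> B \<Longrightarrow> measure_pmf.prob (f x) S \<le> c" and "0 \<le> c"
  shows "measure_pmf.prob (bind_pmf p f) S \<le> measure_pmf.prob p B + c"
proof -
  have int: "integrable (measure_pmf p) (h :: 'a \<Rightarrow> real)" for h
    using assms(1) by (rule integrable_measure_pmf_finite)
  have "measure_pmf.prob (bind_pmf p f) S = measure_pmf.expectation (bind_pmf p f) (indicat_real S)"
    by simp
  also have "\<dots> = measure_pmf.expectation p (\<lambda>x. measure_pmf.prob (f x) S)"
    by (subst expectation_bind_finite[OF assms(1,2)]) auto
  also have "\<dots> \<le> measure_pmf.expectation p (\<lambda>x. indicat_real B x + c)"
  proof (rule expectation_mono_finite[OF assms(1)])
    fix x assume "x \<in> set_pmf p"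
    then show "measure_pmf.prob (f x) S \<le> indicat_real B x + c"
      using assms(3)[of x] assms(4) by (cases "x \<in> B") (auto intro: order.trans[OF measure_pmf.prob_le_1])
  qed
  also have "\<dots> = measure_pmf.prob p B + c"
    by (subst Bochner_Integration.integral_add[OF int int]) simp
  finally show ?thesis .
qed

text \<open>Markov's inequality. The strict inequality lets it survive \<open>b = 0\<close>, where
  \<open>f\<close> vanishes almost surely. That case does occur: a disjoint union of cliques has
  optimum 0.\<close>

lemma prob_gt_double_expectation_le_half:
  fixes f :: "'a \<Rightarrow> real"
  assumes "finite (set_pmf p)" "\<And>x. f x \<ge> 0" "measure_pmf.expectation p f \<le> b"
  shows "measure_pmf.prob p {x. f x > 2 * b} \<le> 1 / 2"
proof -
  have int: "integrable (measure_pmf p) f" using assms(1) by (rule integrable_measure_pmf_finite)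
  have nn: "measure_pmf.expectation p f \<ge> 0" using assms(2) by simp
  show ?thesis
  proof (cases "b > 0")
    case True
    have "measure_pmf.prob p {x. f x > 2 * b} \<le> measure_pmf.prob p {x \<in> space (measure_pmf p). f x \<ge> 2 * b}"
      by (intro measure_pmf.finite_measure_mono) auto
    also have "\<dots> \<le> measure_pmf.expectation p f / (2 * b)"
      using int assms(2) True by (intro integral_Markov_inequality_measure[where A="{}"]) auto
    also have "\<dots> \<le> 1 / 2" using assms(3) True by (simp add: field_simps)
    finally show ?thesis .
  next
    case False
    then have b: "b = 0" "measure_pmf.expectation p f = 0" using nn assms(3) by auto
    then have "AE x in measure_pmf p. f x = 0"
      using integral_nonneg_eq_0_iff_AE[OF int] assms(2) by auto
    then have "measure_pmf.prob p {x. f x > 2 * b} = 0"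
      using b by (auto simp: measure_pmf_zero_iff AE_measure_pmf_iff)
    then show ?thesis by simp
  qed
qed

lemma hoeffding_count:
  assumes "finite D" "D \<noteq> {}" "s > 0" "\<tau> > 0"
  shows "measure_pmf.prob (Pi_pmf {..<s} dflt (\<lambda>_. pmf_of_set D))
      {y. \<bar>(\<Sum>i<s. of_bool (Q (y i))) - real s * (real (card {x\<in>D. Q x}) / real (card D))\<bar> \<ge> real s * \<tau>}
    \<le> 2 * exp (- 2 * real s * \<tau>\<^sup>2)"
proof -
  let ?p = "Pi_pmf {..<s} dflt (\<lambda>_. pmf_of_set D)"
  let ?M = "measure_pmf ?p"
  let ?X = "\<lambda>i y. of_bool (Q (y i)) :: real"
  have comp: "map_pmf (\<lambda>y. y i) (Pi_pmf {..<s} dflt (\<lambda>_. pmf_of_set D)) = pmf_of_set D" if "i < s" for i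
    using that by (simp add: Pi_pmf_component)
  \<comment> \<open>The library locale for iid variables compares every variable with one
    representative, here \<open>?X 0\<close>; both have the law of a single draw from
    \<open>D\<close>.\<close>
  have distr: "distr ?M borel (?X i) = distr (measure_pmf (pmf_of_set D)) borel (\<lambda>x. of_bool (Q x))" if "i < s" for i
    by (subst comp[OF that, symmetric], subst map_pmf_rep_eq, subst distr_distr) (auto simp: o_def)
  interpret iid_interval_bounded_random_variables ?M "{..<s}" ?X "?X 0" 0 1
  proof
    have "prob_space.indep_vars ?M (\<lambda>_. count_space UNIV) (\<lambda>i y. y i) {..<s}"
      using indep_vars_Pi_pmf[of "{..<s}" dflt "\<lambda>_. pmf_of_set D"] by simp
    then have "prob_space.indep_vars ?M (\<lambda>_. borel) (\<lambda>i. (\<lambda>x. of_bool (Q x) :: real) \<circ> (\<lambda>y. y i)) {..<s}"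
      by (rule prob_space.indep_vars_compose[OF prob_space_measure_pmf]) simp
    then show "prob_space.indep_vars ?M (\<lambda>_. borel) ?X {..<s}" by (simp add: o_def)
  qed (use assms(3) distr in \<open>auto simp: AE_measure_pmf_iff\<close>)
  interpret H: Hoeffding_ineq_iid ?M "{..<s}" ?X "?X 0" 0 1 "measure_pmf.expectation ?p (?X 0)"
    by unfold_locales simp
  have "measure_pmf.expectation ?p (?X 0) = measure_pmf.expectation (map_pmf (\<lambda>y. y 0) (Pi_pmf {..<s} dflt (\<lambda>_. pmf_of_set D))) (\<lambda>x. of_bool (Q x))"
    by simp
  also have "\<dots> = real (card {x\<in>D. Q x}) / real (card D)"
    unfolding comp[OF assms(3)] using assms by (simp add: integral_pmf_of_set Int_def)
  finally have mu: "measure_pmf.expectation ?p (?X 0) = \<dots>" .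
  have ne: "{..<s} \<noteq> {}" using assms(3) by auto
  have "0 \<le> real s * \<tau>" using assms by simp
  from H.Hoeffding_ineq_abs_ge[OF this _ ne]
  have "measure_pmf.prob ?p {y. \<bar>(\<Sum>i<s. ?X i y) - real s * measure_pmf.expectation ?p (?X 0)\<bar> \<ge> real s * \<tau>}
      \<le> 2 * exp (- 2 * (real s * \<tau>)\<^sup>2 / real s)"
    by (simp only: space_measure_pmf card_lessThan) simp
  also have "- 2 * (real s * \<tau>)\<^sup>2 / real s = - 2 * real s * \<tau>\<^sup>2"
    using assms by (simp add: power2_eq_square)
  finally show ?thesis unfolding mu .
qed


subsection \<open>Truncated pivot\<close>

text \<open>Ordered pairs are counted, so that sums over \<open>X\<close> and \<open>Y\<close> can
  be split and swapped freely; a symmetric relation inside one set is counted twice.\<close>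

definition pair_sum :: "('a \<Rightarrow> 'a \<Rightarrow> bool) \<Rightarrow> 'a set \<Rightarrow> 'a set \<Rightarrow> real" where
  "pair_sum r X Y = (\<Sum>u\<in>X. \<Sum>w\<in>Y. of_bool (r u w))"

definition mismatch :: "('a \<Rightarrow> 'a \<Rightarrow> bool) \<Rightarrow> ('a \<Rightarrow> 'b) \<Rightarrow> 'a \<Rightarrow> 'a \<Rightarrow> bool" where
  "mismatch nb g u w \<longleftrightarrow> u \<noteq> w \<and> (nb u w \<longleftrightarrow> g u \<noteq> g w)"

text \<open>For symmetric \<open>nb\<close> this is twice the clustering cost of \<open>g\<close>;
  see \<open>disagreement_eq_cc_cost\<close>.\<close>

definition disagreement :: "('a \<Rightarrow> 'a \<Rightarrow> bool) \<Rightarrow> 'a set \<Rightarrow> ('a \<Rightarrow> 'b) \<Rightarrow> real" where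
  "disagreement nb A g = pair_sum (mismatch nb g) A A"

lemma pair_sum_nonneg: "pair_sum r X Y \<ge> 0"
  unfolding pair_sum_def by (intro sum_nonneg) auto

lemma pair_sum_mono:
  assumes "finite X'" "finite Y'" "X \<subseteq> X'" "Y \<subseteq> Y'"
    and "\<And>u w. u \<in> X \<Longrightarrow> w \<in> Y \<Longrightarrow> r u w \<Longrightarrow> r' u w"
  shows "pair_sum r X Y \<le> pair_sum r' X' Y'"
proof -
  have "pair_sum r X Y \<le> (\<Sum>u\<in>X. \<Sum>w\<in>Y. of_bool (r' u w))"
    unfolding pair_sum_def using assms(5) by (intro sum_mono) (auto simp: of_bool_def)
  also have "\<dots> \<le> (\<Sum>u\<in>X. \<Sum>w\<in>Y'. of_bool (r' u w))"
    using assms by (intro sum_mono sum_mono2) auto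
  also have "\<dots> \<le> pair_sum r' X' Y'"
    unfolding pair_sum_def using assms by (intro sum_mono2 sum_nonneg) auto
  finally show ?thesis .
qed

lemma pair_sum_cong:
  assumes "\<And>u w. u \<in> X \<Longrightarrow> w \<in> Y \<Longrightarrow> r u w = r' u w"
  shows "pair_sum r X Y = pair_sum r' X Y"
  unfolding pair_sum_def using assms by (intro sum.cong) auto

lemma pair_sum_Un1:
  assumes "finite X" "finite X'" "X \<inter> X' = {}"
  shows "pair_sum r (X \<union> X') Y = pair_sum r X Y + pair_sum r X' Y"
  unfolding pair_sum_def using assms by (rule sum.union_disjoint)

lemma pair_sum_Un2:
  assumes "finite Y" "finite Y'" "Y \<inter> Y' = {}"
  shows "pair_sum r X (Y \<union> Y') = pair_sum r X Y + pair_sum r X Y'"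
  unfolding pair_sum_def using assms by (simp add: sum.union_disjoint sum.distrib del: sum_of_bool_eq)

lemma pair_sum_Un:
  assumes "finite X" "finite Y" "X \<inter> Y = {}"
  shows "pair_sum r (X \<union> Y) (X \<union> Y)
    = pair_sum r X X + pair_sum r X Y + (pair_sum r Y X + pair_sum r Y Y)"
  by (simp only: pair_sum_Un1[OF assms] pair_sum_Un2[OF assms])

lemma pair_sum_swap: "pair_sum r X Y = pair_sum (\<lambda>u w. r w u) Y X"
  unfolding pair_sum_def by (rule sum.swap)

lemma pair_sum_eq_card:
  assumes "finite X" "finite Y"
  shows "pair_sum r X Y = real (card {(u, w). u \<in> X \<and> w \<in> Y \<and> r u w})"
proof -
  have "{(u, w). u \<in> X \<and> w \<in> Y \<and> r u w} = (SIGMA u:X. {w\<in>Y. r u w})" by auto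
  with assms show ?thesis
    by (simp add: pair_sum_def Int_def)
qed

lemma pair_sum_restrict:
  assumes "finite Z" "X \<subseteq> Z" "Y \<subseteq> Z"
  shows "pair_sum r X Y = pair_sum (\<lambda>u w. u \<in> X \<and> w \<in> Y \<and> r u w) Z Z"
proof -
  have "finite X" "finite Y" using assms finite_subset by auto
  then show ?thesis using assms
    by (simp add: pair_sum_eq_card) (intro arg_cong[where f=card], auto)
qed

lemma sum_filter_of_bool:
  fixes f :: "'a \<Rightarrow> real"
  assumes "finite S"
  shows "(\<Sum>v\<in>{v\<in>S. P v}. f v) = (\<Sum>v\<in>S. of_bool (P v) * f v)"
  using assms by (simp add: Int_def)

lemma sum_rotate:
  "(\<Sum>x\<in>S. \<Sum>u\<in>S. \<Sum>w\<in>S. f w x u) = (\<Sum>x\<in>S. \<Sum>u\<in>S. \<Sum>w\<in>S. f x u w)"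
proof -
  have "(\<Sum>x\<in>S. \<Sum>u\<in>S. \<Sum>w\<in>S. f w x u) = (\<Sum>x\<in>S. \<Sum>w\<in>S. \<Sum>u\<in>S. f w x u)"
    by (intro sum.cong refl sum.swap)
  also have "\<dots> = (\<Sum>w\<in>S. \<Sum>x\<in>S. \<Sum>u\<in>S. f w x u)" by (rule sum.swap)
  finally show ?thesis .
qed

text \<open>
  The nodes of the list are processed in order. The unclustered nodes are \<open>A \<union> B\<close>; those in \<open>B\<close> have
  already seen one processed neighbour that was clustered before its turn. A node that sees a second
  such neighbour leaves \<open>A \<union> B\<close> and remains a singleton. A node therefore only ever consults its
  first two neighbours in the order.
\<close>

primrec truncated_pivot ::
    "('a \<Rightarrow> 'a \<Rightarrow> bool) \<Rightarrow> 'a list \<Rightarrow> 'a set \<Rightarrow> 'a set \<Rightarrow> 'a \<Rightarrow> 'a" where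
  "truncated_pivot nb [] A B = (\<lambda>v. v)"
| "truncated_pivot nb (x # xs) A B =
    (if x \<in> A \<union> B
     then (\<lambda>v. if v \<in> A \<union> B \<and> (v = x \<or> nb v x) then x
               else truncated_pivot nb xs {v\<in>A. v \<noteq> x \<and> \<not> nb v x} {v\<in>B. v \<noteq> x \<and> \<not> nb v x} v)
     else truncated_pivot nb xs {v\<in>A. \<not> nb v x} ({v\<in>A. nb v x} \<union> {v\<in>B. \<not> nb v x}))"

lemma truncated_pivot_outside:
  "v \<notin> A \<union> B \<Longrightarrow> truncated_pivot nb xs A B v = v"
  by (induction xs arbitrary: A B) auto

text \<open>Keeps clusters apart: a pivot and the nodes that have left \<open>A \<union> B\<close>
  can no longer supply labels for the nodes that remain.\<close>

lemma truncated_pivot_inside: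
  "v \<in> A \<union> B \<Longrightarrow> truncated_pivot nb xs A B v \<in> A \<union> B"
proof (induction xs arbitrary: A B)
  case (Cons x xs)
  show ?case
  proof (cases "x \<in> A \<union> B")
    case True
    let ?A = "{v\<in>A. v \<noteq> x \<and> \<not> nb v x}" and ?B = "{v\<in>B. v \<noteq> x \<and> \<not> nb v x}"
    show ?thesis
    proof (cases "v = x \<or> nb v x")
      case False
      then have "v \<in> ?A \<union> ?B" using Cons.prems by auto
      from Cons.IH[OF this] show ?thesis using True False by auto
    qed (use True Cons.prems in auto)
  next
    case False
    let ?A = "{v\<in>A. \<not> nb v x}" and ?B = "{v\<in>A. nb v x} \<union> {v\<in>B. \<not> nb v x}"
    show ?thesis
    proof (cases "v \<in> ?A \<union> ?B")
      case True
      from Cons.IH[OF this] show ?thesis using False by auto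
    next
      case v: False
      have "truncated_pivot nb (x # xs) A B v = v"
        using False truncated_pivot_outside[OF v, of nb xs] by simp
      then show ?thesis using Cons.prems by simp
    qed
  qed
qed auto

section \<open>Expected cost of truncated pivot: one-step recurrences, potential and bad
  triangles\<close>

locale finite_graph =
  fixes V :: "'a set" and nb :: "'a \<Rightarrow> 'a \<Rightarrow> bool"
  assumes fin: "finite V"
    and sym: "nb u w \<Longrightarrow> nb w u"
    and irr: "\<not> nb u u"
begin

abbreviation "nonadj u w \<equiv> u \<noteq> w \<and> \<not> nb u w"

lemma pair_sum_nb_sym: "pair_sum nb X Y = pair_sum nb Y X"
  by (subst pair_sum_swap) (auto intro!: pair_sum_cong dest: sym)

text \<open>\<open>C\<close> is the new cluster. It errs on its missing inner edges and on every
  edge leaving it, the latter in both orders. The remaining nodes never receive the label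
  \<open>x\<close>, so the rest of the cost is that of the recursive call.\<close>

lemma disagreement_pivot_step:
  assumes "A \<union> B \<subseteq> V" and "x \<in> A \<union> B"
  defines "C \<equiv> {v\<in>A \<union> B. v = x \<or> nb v x}"
  shows "disagreement nb (A \<union> B) (truncated_pivot nb (x # xs) A B)
    \<le> pair_sum nonadj C C + 2 * pair_sum nb C (A \<union> B - C)
      + disagreement nb (A \<union> B - C)
          (truncated_pivot nb xs {v\<in>A. v \<noteq> x \<and> \<not> nb v x} {v\<in>B. v \<noteq> x \<and> \<not> nb v x})"
proof -
  let ?R = "A \<union> B - C" and ?g = "truncated_pivot nb (x # xs) A B"
  let ?h = "truncated_pivot nb xs {v\<in>A. v \<noteq> x \<and> \<not> nb v x} {v\<in>B. v \<noteq> x \<and> \<not> nb v x}"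
  have f: "finite C" "finite ?R" using finite_subset[OF _ fin] assms by auto
  have AB: "A \<union> B = C \<union> ?R" unfolding C_def by auto
  have gC: "?g v = x" if "v \<in> C" for v using that assms by (auto simp: C_def)
  have gR: "?g v = ?h v" if "v \<in> ?R" for v using that assms by (auto simp: C_def)
  have hR: "?h v \<noteq> x" if "v \<in> ?R" for v
  proof -
    have "v \<in> {v\<in>A. v \<noteq> x \<and> \<not> nb v x} \<union> {v\<in>B. v \<noteq> x \<and> \<not> nb v x}" using that by (auto simp: C_def)
    from truncated_pivot_inside[OF this] show ?thesis by fastforce
  qed
  have 1: "pair_sum (mismatch nb ?g) C C = pair_sum nonadj C C"
    using gC by (intro pair_sum_cong) (auto simp: mismatch_def)
  have 2: "pair_sum (mismatch nb ?g) C ?R = pair_sum nb C ?R"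
    using gC gR hR by (intro pair_sum_cong) (fastforce simp: mismatch_def irr)
  have 3: "pair_sum (mismatch nb ?g) ?R C = pair_sum nb ?R C"
    using gC gR hR by (intro pair_sum_cong) (fastforce simp: mismatch_def irr)
  have 4: "pair_sum (mismatch nb ?g) ?R ?R = pair_sum (mismatch nb ?h) ?R ?R"
    using gR by (intro pair_sum_cong) (simp add: mismatch_def)
  have "disagreement nb (A \<union> B) ?g = disagreement nb (C \<union> ?R) ?g" using AB by simp
  also have "\<dots> = pair_sum nonadj C C + pair_sum nb C ?R + (pair_sum nb ?R C + pair_sum (mismatch nb ?h) ?R ?R)"
    unfolding disagreement_def by (subst pair_sum_Un[OF f], blast) (simp only: 1 2 3 4)
  also have "pair_sum nb ?R C = pair_sum nb C ?R" by (rule pair_sum_nb_sym)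
  finally show ?thesis by (simp add: disagreement_def)
qed

text \<open>The nodes of \<open>Z\<close> see their second clustered neighbour and become
  singletons, which cuts all their edges to unclustered nodes. Edges inside \<open>Z\<close> are
  charged more than once, hence only an inequality.\<close>

lemma disagreement_dead_step:
  assumes "A \<union> B \<subseteq> V" and "x \<notin> A \<union> B" and "A \<inter> B = {}"
  defines "Z \<equiv> {v\<in>B. nb v x}"
  shows "disagreement nb (A \<union> B) (truncated_pivot nb (x # xs) A B)
    \<le> 2 * pair_sum nb Z (A \<union> B)
      + disagreement nb (A \<union> B - Z)
          (truncated_pivot nb xs {v\<in>A. \<not> nb v x} ({v\<in>A. nb v x} \<union> {v\<in>B. \<not> nb v x}))"
proof -
  let ?R = "A \<union> B - Z" and ?g = "truncated_pivot nb (x # xs) A B"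
  let ?h = "truncated_pivot nb xs {v\<in>A. \<not> nb v x} ({v\<in>A. nb v x} \<union> {v\<in>B. \<not> nb v x})"
  have f: "finite Z" "finite ?R" "finite (A \<union> B)" using finite_subset[OF _ fin] assms by auto
  have AB: "A \<union> B = Z \<union> ?R" unfolding Z_def by auto
  have g: "?g = ?h" using assms by auto
  have R: "?R = {v\<in>A. \<not> nb v x} \<union> ({v\<in>A. nb v x} \<union> {v\<in>B. \<not> nb v x})"
    using assms by auto
  have hZ: "?h v = v" if "v \<in> Z" for v
    using that assms by (intro truncated_pivot_outside) (auto simp: Z_def)
  have hR: "?h v \<in> ?R" if "v \<in> ?R" for v
    using truncated_pivot_inside[of v "{v\<in>A. \<not> nb v x}" "{v\<in>A. nb v x} \<union> {v\<in>B. \<not> nb v x}" nb xs] that R by simp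
  have 1: "pair_sum (mismatch nb ?h) Z (Z \<union> ?R) = pair_sum nb Z (Z \<union> ?R)"
    using hZ hR by (intro pair_sum_cong) (fastforce simp: mismatch_def irr)
  have 2: "pair_sum (mismatch nb ?h) ?R Z = pair_sum nb ?R Z"
    using hZ hR by (intro pair_sum_cong) (fastforce simp: mismatch_def irr)
  have "disagreement nb (A \<union> B) ?g = disagreement nb (Z \<union> ?R) ?h" using AB g by simp
  also have "\<dots> = pair_sum nb Z (Z \<union> ?R) + (pair_sum nb ?R Z + disagreement nb ?R ?h)"
    unfolding disagreement_def
    by (subst pair_sum_Un1[OF f(1,2)], blast, subst (2) pair_sum_Un2[OF f(1,2)], blast)
      (simp only: 1 2)
  also have "pair_sum nb ?R Z = pair_sum nb Z ?R" by (rule pair_sum_nb_sym)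
  also have "\<dots> \<le> pair_sum nb Z (A \<union> B)" by (rule pair_sum_mono) (use f Z_def in auto)
  finally show ?thesis using AB by simp
qed

text \<open>
  \<open>U\<close> is the set of unprocessed nodes. For an unclustered node with \<open>a\<close> unclustered and \<open>b\<close> clustered
  unprocessed neighbours, the last two summands contribute \<open>b\<close>, plus \<open>a\<close> if the node is in \<open>B\<close>. The
  \<open>a\<close> pays for its edges if it becomes a singleton. The drift vanishes: \<open>b\<close> of its neighbours advance
  the node, each adding \<open>a\<close>, while \<open>a\<close> of them cluster it, each removing at least \<open>b\<close>.
\<close>

definition potential :: "('a \<Rightarrow> 'b) \<Rightarrow> 'a set \<Rightarrow> 'a set \<Rightarrow> 'a set \<Rightarrow> real" where
  "potential g U A B = 5 * disagreement nb (A \<union> B) g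
     + 2 * (pair_sum nb (A \<union> B) (U - (A \<union> B)) + pair_sum nb B (A \<union> B))"

text \<open>The members of \<open>C\<close> other than \<open>x\<close> turn into clustered
  unprocessed nodes, so each edge from \<open>C\<close> to the rest may add to the second summand.
  In exchange the neighbours of \<open>x\<close> drop their own contribution to it.\<close>

lemma potential_pivot_step:
  assumes "U \<subseteq> V" "A \<union> B \<subseteq> U" and "x \<in> A \<union> B"
  defines "C \<equiv> {v\<in>A \<union> B. v = x \<or> nb v x}"
  shows "potential g (U - {x}) {v\<in>A. v \<noteq> x \<and> \<not> nb v x} {v\<in>B. v \<noteq> x \<and> \<not> nb v x}
    \<le> potential g U A B + 2 * pair_sum nb C (A \<union> B - C)
      - 5 * (disagreement nb (A \<union> B) g - disagreement nb (A \<union> B - C) g)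
      - 2 * pair_sum nb {v\<in>A \<union> B. nb v x} (U - (A \<union> B))"
proof -
  let ?A = "{v\<in>A. v \<noteq> x \<and> \<not> nb v x}" and ?B = "{v\<in>B. v \<noteq> x \<and> \<not> nb v x}"
  let ?R = "A \<union> B - C"
  have f: "finite C" "finite ?R" "finite (A \<union> B)" "finite B" "finite U" "finite (U - (A \<union> B))"
    using finite_subset[OF _ fin] assms by auto
  have R: "?A \<union> ?B = ?R" by (auto simp: C_def)
  have U: "U - {x} - ?R \<subseteq> (U - (A \<union> B)) \<union> C" by (auto simp: C_def)
  have dC: "C \<subseteq> A \<union> B" by (auto simp: C_def)
  have "pair_sum nb ?R (U - {x} - ?R) \<le> pair_sum nb ?R ((U - (A \<union> B)) \<union> C)"
    using f U by (intro pair_sum_mono) auto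
  also have "\<dots> = pair_sum nb ?R (U - (A \<union> B)) + pair_sum nb ?R C"
    using f dC by (intro pair_sum_Un2) auto
  also have "pair_sum nb ?R C = pair_sum nb C ?R" by (rule pair_sum_nb_sym)
  finally have 1: "pair_sum nb ?R (U - {x} - ?R) \<le> pair_sum nb ?R (U - (A \<union> B)) + pair_sum nb C ?R" .
  have 2: "pair_sum nb ?B ?R \<le> pair_sum nb B (A \<union> B)"
    using f by (intro pair_sum_mono) auto
  have "pair_sum nb (A \<union> B) (U - (A \<union> B)) = pair_sum nb (C \<union> ?R) (U - (A \<union> B))"
    using dC by (intro arg_cong2[where f="pair_sum nb"]) auto
  also have "\<dots> = pair_sum nb C (U - (A \<union> B)) + pair_sum nb ?R (U - (A \<union> B))"
    using f by (intro pair_sum_Un1) auto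
  finally have 3: "pair_sum nb (A \<union> B) (U - (A \<union> B)) = \<dots>" .
  have 4: "pair_sum nb {v\<in>A \<union> B. nb v x} (U - (A \<union> B)) \<le> pair_sum nb C (U - (A \<union> B))"
    using f by (intro pair_sum_mono) (auto simp: C_def)
  show ?thesis unfolding potential_def R using 1 2 3 4 by (simp add: algebra_simps)
qed

text \<open>Neighbours of \<open>x\<close> in \<open>A\<close> move to \<open>B\<close> and start to
  contribute their edges to \<open>A \<union> B\<close>. The nodes of \<open>Z\<close> release
  theirs, but two charges of the same size arise: they now count as clustered neighbours of others,
  and their edges are cut. The release covers one charge; the other is the share of \<open>Z\<close>
  on the right-hand side.\<close>

lemma potential_dead_step:
  assumes "U \<subseteq> V" "A \<union> B \<subseteq> U" and "x \<in> U" "x \<notin> A \<union> B" and "A \<inter> B = {}"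
  defines "Z \<equiv> {v\<in>B. nb v x}"
  shows "potential g (U - {x}) {v\<in>A. \<not> nb v x} ({v\<in>A. nb v x} \<union> {v\<in>B. \<not> nb v x})
     + 2 * pair_sum nb Z (A \<union> B)
    \<le> potential g U A B + 2 * pair_sum nb {v\<in>A \<union> B. nb v x} (A \<union> B)"
proof -
  let ?A = "{v\<in>A. \<not> nb v x}" and ?B = "{v\<in>A. nb v x} \<union> {v\<in>B. \<not> nb v x}"
  let ?R = "A \<union> B - Z" and ?Y = "{v\<in>A. nb v x}"
  have fV: "finite X" if "X \<subseteq> V" for X using finite_subset[OF that fin] .
  have f: "finite Z" "finite ?R" "finite (A \<union> B)" "finite A" "finite B" "finite U" "finite (U - (A \<union> B))"
    using assms by (auto intro!: fV)
  have R: "?A \<union> ?B = ?R" using assms by auto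
  have m: "disagreement nb ?R g \<le> disagreement nb (A \<union> B) g"
    unfolding disagreement_def using f by (intro pair_sum_mono) auto
  have "pair_sum nb ?R (U - {x} - ?R) \<le> pair_sum nb (A \<union> B) ((U - (A \<union> B)) \<union> Z)"
    using f by (intro pair_sum_mono) auto
  also have "\<dots> = pair_sum nb (A \<union> B) (U - (A \<union> B)) + pair_sum nb (A \<union> B) Z"
    using f by (intro pair_sum_Un2) (auto simp: Z_def)
  also have "pair_sum nb (A \<union> B) Z = pair_sum nb Z (A \<union> B)" by (rule pair_sum_nb_sym)
  finally have 1: "pair_sum nb ?R (U - {x} - ?R)
      \<le> pair_sum nb (A \<union> B) (U - (A \<union> B)) + pair_sum nb Z (A \<union> B)" .
  have "pair_sum nb ?B ?R \<le> pair_sum nb (?Y \<union> (B - Z)) (A \<union> B)"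
    using f by (intro pair_sum_mono) (auto simp: Z_def)
  also have "\<dots> = pair_sum nb ?Y (A \<union> B) + pair_sum nb (B - Z) (A \<union> B)"
    using f assms(5) by (intro pair_sum_Un1) auto
  finally have 2: "pair_sum nb ?B ?R \<le> \<dots>" .
  have "pair_sum nb B (A \<union> B) = pair_sum nb ((B - Z) \<union> Z) (A \<union> B)"
    by (intro arg_cong2[where f="pair_sum nb"]) (auto simp: Z_def)
  also have "\<dots> = pair_sum nb (B - Z) (A \<union> B) + pair_sum nb Z (A \<union> B)"
    using f by (intro pair_sum_Un1) auto
  finally have 3: "pair_sum nb B (A \<union> B) = \<dots>" .
  have "pair_sum nb {v\<in>A \<union> B. nb v x} (A \<union> B) = pair_sum nb (?Y \<union> Z) (A \<union> B)"
    by (intro arg_cong2[where f="pair_sum nb"]) (auto simp: Z_def)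
  also have "\<dots> = pair_sum nb ?Y (A \<union> B) + pair_sum nb Z (A \<union> B)"
    using f assms(5) by (intro pair_sum_Un1) (auto simp: Z_def)
  finally have 4: "pair_sum nb {v\<in>A \<union> B. nb v x} (A \<union> B) = \<dots>" .
  show ?thesis unfolding potential_def R using 1 2 3 4 m by (simp add: algebra_simps)
qed

text \<open>A bad triangle, two edges and a missing one, with its centre first. Each one appears as
  exactly two triples, one per order of its ends.\<close>

definition bad :: "'a \<Rightarrow> 'a \<Rightarrow> 'a \<Rightarrow> bool" where
  "bad c u w \<longleftrightarrow> nb c u \<and> nb c w \<and> u \<noteq> w \<and> \<not> nb u w"

text \<open>
  Every labelling errs on a pair of each bad triangle, and each node of a bad triangle removes all
  three pairs of it when it becomes a pivot.
\<close>

lemma bad_triangle_charging: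
  fixes g :: "'a \<Rightarrow> 'b"
  assumes "S \<subseteq> V"
  defines "C \<equiv> \<lambda>x. {v\<in>S. v = x \<or> nb v x}"
  shows "(\<Sum>x\<in>S. pair_sum nonadj (C x) (C x) + 4 * pair_sum nb (C x) (S - C x))
    \<le> 5 * (\<Sum>x\<in>S. disagreement nb S g - disagreement nb (S - C x) g)"
proof -
  have fS: "finite S" using finite_subset[OF assms(1) fin] .
  have Cs: "C x \<subseteq> S" for x by (auto simp: C_def)
  \<comment> \<open>With pivot \<open>x\<close>, the missing pairs inside the cluster are the
    triples with centre \<open>x\<close>, and the edges leaving it are the triples with end
    \<open>x\<close>. Both sums equal \<open>N\<close>, so the left-hand side is
    \<open>N + 4 * N\<close>. This is the origin of the factor 5.\<close>
  define N where "N = (\<Sum>x\<in>S. pair_sum (bad x) S S)"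
  have "pair_sum nonadj (C x) (C x) = pair_sum (bad x) S S" if "x \<in> S" for x
    using Cs that by (subst pair_sum_restrict[OF fS])
      (auto simp: bad_def C_def irr intro!: pair_sum_cong dest: sym)
  then have 1: "(\<Sum>x\<in>S. pair_sum nonadj (C x) (C x)) = N" by (simp add: N_def)
  have "pair_sum nb (C x) (S - C x) = pair_sum (\<lambda>u w. bad u x w) S S" if "x \<in> S" for x
    using Cs that by (subst pair_sum_restrict[OF fS])
      (auto simp: bad_def C_def irr intro!: pair_sum_cong dest: sym)
  then have "(\<Sum>x\<in>S. pair_sum nb (C x) (S - C x)) = (\<Sum>x\<in>S. pair_sum (\<lambda>u w. bad u x w) S S)"
    by simp
  also have "\<dots> = N" unfolding N_def pair_sum_def by (rule sum.swap)
  finally have 2: "(\<Sum>x\<in>S. pair_sum nb (C x) (S - C x)) = N" .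
  let ?m = "mismatch nb g"
  \<comment> \<open>A mistake of \<open>g\<close> on the pair \<open>(u, w)\<close>, seen from a
    third node \<open>x\<close> adjacent to both, only to \<open>u\<close>, or only to
    \<open>w\<close>. The three cases exclude each other, and in each an end of the pair lies in
    \<open>C x\<close>, so the mistake disappears together with \<open>C x\<close>.\<close>
  let ?p = "\<lambda>x u w. ?m u w \<and> nb x u \<and> nb x w"
  let ?q = "\<lambda>x u w. ?m u w \<and> nb x u \<and> x \<noteq> w \<and> \<not> nb x w"
  let ?r = "\<lambda>x u w. ?m u w \<and> nb x w \<and> x \<noteq> u \<and> \<not> nb x u"
  have m_sym: "?m u w = ?m w u" for u w by (auto simp: mismatch_def dest: sym)
  have "N \<le> (\<Sum>x\<in>S. \<Sum>u\<in>S. \<Sum>w\<in>S. of_bool (?p x u w) + of_bool (?q w x u) + of_bool (?r u w x))"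
    unfolding N_def pair_sum_def
    by (intro sum_mono) (auto simp: bad_def mismatch_def of_bool_def dest: sym)
  also have "\<dots> = (\<Sum>x\<in>S. pair_sum (?p x) S S) + (\<Sum>x\<in>S. \<Sum>u\<in>S. \<Sum>w\<in>S. of_bool (?q w x u))
      + (\<Sum>x\<in>S. \<Sum>u\<in>S. \<Sum>w\<in>S. of_bool (?r u w x))"
    by (simp add: sum.distrib pair_sum_def del: sum_of_bool_eq)
  also have "(\<Sum>x\<in>S. \<Sum>u\<in>S. \<Sum>w\<in>S. of_bool (?q w x u) :: real) = (\<Sum>x\<in>S. pair_sum (?q x) S S)"
    unfolding pair_sum_def by (rule sum_rotate)
  also have "(\<Sum>x\<in>S. \<Sum>u\<in>S. \<Sum>w\<in>S. of_bool (?r u w x) :: real) = (\<Sum>x\<in>S. pair_sum (?r x) S S)"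
    unfolding pair_sum_def by (rule sum_rotate[symmetric])
  also have "(\<Sum>x\<in>S. pair_sum (?p x) S S) + (\<Sum>x\<in>S. pair_sum (?q x) S S) + (\<Sum>x\<in>S. pair_sum (?r x) S S)
      \<le> (\<Sum>x\<in>S. disagreement nb S g - disagreement nb (S - C x) g)"
    unfolding sum.distrib[symmetric]
  proof (intro sum_mono)
    fix x assume "x \<in> S"
    have "pair_sum (?p x) S S + pair_sum (?q x) S S + pair_sum (?r x) S S
        + disagreement nb (S - C x) g \<le> disagreement nb S g"
      unfolding disagreement_def
      unfolding pair_sum_restrict[of S "S - C x", OF fS Diff_subset Diff_subset]
      unfolding pair_sum_def sum.distrib[symmetric]
      by (intro sum_mono) (auto simp: C_def of_bool_def dest: sym)
    then show "pair_sum (?p x) S S + pair_sum (?q x) S S + pair_sum (?r x) S S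
        \<le> disagreement nb S g - disagreement nb (S - C x) g" by simp
  qed
  finally have "N \<le> (\<Sum>x\<in>S. disagreement nb S g - disagreement nb (S - C x) g)" .
  then show ?thesis by (simp add: sum.distrib sum_distrib_left[symmetric] 1 2)
qed


text \<open>The supermartingale property, with the cost incurred in the step included in
  \<open>F x\<close>. Summed over all choices of \<open>x\<close>, the bad triangles (2 for cut
  edges plus 2 for the potential give their coefficient 4) are paid by the decrease of
  \<open>5 * disagreement\<close>, and the growth in steps with clustered \<open>x\<close> is paid
  by the release in pivot steps.\<close>

lemma potential_step:
  fixes g :: "'a \<Rightarrow> 'b"
  assumes "U \<subseteq> V" "A \<union> B \<subseteq> U" and AB: "A \<inter> B = {}"
    and F_pivot: "\<And>x. x \<in> A \<union> B \<Longrightarrow>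
      F x \<le> pair_sum nonadj {v\<in>A \<union> B. v = x \<or> nb v x} {v\<in>A \<union> B. v = x \<or> nb v x}
        + 2 * pair_sum nb {v\<in>A \<union> B. v = x \<or> nb v x} (A \<union> B - {v\<in>A \<union> B. v = x \<or> nb v x})
        + potential g (U - {x}) {v\<in>A. v \<noteq> x \<and> \<not> nb v x} {v\<in>B. v \<noteq> x \<and> \<not> nb v x}"
    and F_dead: "\<And>x. x \<in> U - (A \<union> B) \<Longrightarrow> F x \<le> 2 * pair_sum nb {v\<in>B. nb v x} (A \<union> B)
        + potential g (U - {x}) {v\<in>A. \<not> nb v x} ({v\<in>A. nb v x} \<union> {v\<in>B. \<not> nb v x})"
  shows "(\<Sum>x\<in>U. F x) \<le> card U * potential g U A B"
proof -
  let ?S = "A \<union> B" and ?\<Phi> = "potential g U A B"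
  let ?C = "\<lambda>x. {v\<in>?S. v = x \<or> nb v x}" and ?N = "\<lambda>x. {v\<in>?S. nb v x}"
  let ?D = "\<lambda>x. disagreement nb ?S g - disagreement nb (?S - ?C x) g"
  have fU: "finite U" and fS: "finite ?S" using assms finite_subset[OF _ fin] by auto
  have 1: "F x \<le> ?\<Phi> + (pair_sum nonadj (?C x) (?C x) + 4 * pair_sum nb (?C x) (?S - ?C x))
      - 5 * ?D x - 2 * pair_sum nb (?N x) (U - ?S)" if "x \<in> ?S" for x
    using F_pivot[OF that] potential_pivot_step[OF assms(1,2) that, of g] by linarith
  have 2: "F x \<le> ?\<Phi> + 2 * pair_sum nb (?N x) ?S" if "x \<in> U - ?S" for x
    using F_dead[OF that] potential_dead_step[OF assms(1,2) _ _ AB, of x g] that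
    by (auto intro: order.trans)
  \<comment> \<open>The zero drift: both sides are the sum over unclustered \<open>v\<close> of the
    product of its numbers of unclustered and of clustered unprocessed neighbours.\<close>
  have "(\<Sum>x\<in>U - ?S. pair_sum nb (?N x) ?S)
      = (\<Sum>x\<in>U - ?S. \<Sum>v\<in>?S. of_bool (nb v x) * (\<Sum>u\<in>?S. of_bool (nb v u)))"
    unfolding pair_sum_def using fS by (intro sum.cong refl sum_filter_of_bool)
  also have "\<dots> = (\<Sum>v\<in>?S. (\<Sum>x\<in>U - ?S. of_bool (nb v x)) * (\<Sum>u\<in>?S. of_bool (nb v u)))"
    by (subst sum.swap) (simp only: sum_distrib_right)
  also have "\<dots> = (\<Sum>v\<in>?S. (\<Sum>u\<in>?S. of_bool (nb v u)) * (\<Sum>x\<in>U - ?S. of_bool (nb v x)))"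
    by (simp only: mult.commute)
  also have "\<dots> = (\<Sum>x\<in>?S. \<Sum>v\<in>?S. of_bool (nb v x) * (\<Sum>u\<in>U - ?S. of_bool (nb v u)))"
    by (subst sum.swap) (simp only: sum_distrib_right)
  also have "\<dots> = (\<Sum>x\<in>?S. pair_sum nb (?N x) (U - ?S))"
    unfolding pair_sum_def using fS by (intro sum.cong refl sum_filter_of_bool[symmetric])
  finally have 3: "(\<Sum>x\<in>U - ?S. pair_sum nb (?N x) ?S) = (\<Sum>x\<in>?S. pair_sum nb (?N x) (U - ?S))" .
  have 4: "(\<Sum>x\<in>?S. pair_sum nonadj (?C x) (?C x) + 4 * pair_sum nb (?C x) (?S - ?C x)) \<le> 5 * (\<Sum>x\<in>?S. ?D x)"
    by (rule bad_triangle_charging) (use assms in auto)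
  have "(\<Sum>x\<in>U. F x) = (\<Sum>x\<in>U - ?S. F x) + (\<Sum>x\<in>?S. F x)"
    by (rule sum.subset_diff) (use assms fU in auto)
  also have "\<dots> \<le> (\<Sum>x\<in>U - ?S. ?\<Phi> + 2 * pair_sum nb (?N x) ?S)
      + (\<Sum>x\<in>?S. ?\<Phi> + (pair_sum nonadj (?C x) (?C x) + 4 * pair_sum nb (?C x) (?S - ?C x))
          - 5 * ?D x - 2 * pair_sum nb (?N x) (U - ?S))"
    using 1 2 by (intro add_mono sum_mono) auto
  also have "\<dots> \<le> (\<Sum>x\<in>U - ?S. ?\<Phi>) + (\<Sum>x\<in>?S. ?\<Phi>)"
    using 3 4 unfolding sum.distrib sum_subtractf sum_distrib_left[symmetric] by linarith
  also have "\<dots> = (\<Sum>x\<in>U. ?\<Phi>)"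
    by (rule sum.subset_diff[symmetric]) (use assms fU in auto)
  finally show ?thesis by simp
qed

text \<open>Induction on the number of unprocessed nodes. After the first node is fixed, the rest of
  a uniform order is a uniform order of the remaining nodes, so the hypothesis bounds the recursive
  call and \<open>potential_step\<close> averages over the first node.\<close>

lemma expectation_truncated_pivot_le_potential:
  fixes g :: "'a \<Rightarrow> 'b"
  assumes "U \<subseteq> V" "A \<union> B \<subseteq> U" "A \<inter> B = {}"
  shows "measure_pmf.expectation (pmf_of_set (permutations_of_set U))
      (\<lambda>xs. disagreement nb (A \<union> B) (truncated_pivot nb xs A B)) \<le> potential g U A B"
  using assms
proof (induction "card U" arbitrary: U A B)
  case 0
  then have "U = {}" using finite_subset[OF _ fin] by auto
  with 0 show ?case by (auto simp: potential_def disagreement_def pair_sum_def pmf_of_set_singleton)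
next
  case (Suc k)
  have fU: "finite U" "U \<noteq> {}" using Suc finite_subset[OF _ fin] by auto
  let ?S = "A \<union> B"
  let ?E = "\<lambda>U. measure_pmf.expectation (pmf_of_set (permutations_of_set U))"
  define F where "F = (\<lambda>x. ?E (U - {x}) (\<lambda>xs. disagreement nb ?S (truncated_pivot nb (x # xs) A B)))"
  have fp: "finite (set_pmf (pmf_of_set (permutations_of_set (U - {x}))))" for x
    using fU by (subst set_pmf_of_set) auto
  have E_const: "?E (U - {x}) (\<lambda>xs. c + h xs) = c + ?E (U - {x}) h" for x c and h :: "'a list \<Rightarrow> real"
    using fp[of x] by (subst Bochner_Integration.integral_add) (auto intro: integrable_measure_pmf_finite)
  have k: "k = card (U - {x})" if "x \<in> U" for x using Suc.hyps that fU by simp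
  have "(\<Sum>x\<in>U. F x) \<le> card U * potential g U A B"
  proof (rule potential_step[OF Suc.prems])
    fix x assume x: "x \<in> ?S"
    let ?C = "{v\<in>?S. v = x \<or> nb v x}"
    let ?A = "{v\<in>A. v \<noteq> x \<and> \<not> nb v x}" and ?B = "{v\<in>B. v \<noteq> x \<and> \<not> nb v x}"
    let ?c = "pair_sum nonadj ?C ?C + 2 * pair_sum nb ?C (?S - ?C)"
    have R: "?S - ?C = ?A \<union> ?B" by auto
    have "F x \<le> ?E (U - {x}) (\<lambda>xs. ?c + disagreement nb (?A \<union> ?B) (truncated_pivot nb xs ?A ?B))"
      unfolding F_def R[symmetric] using Suc.prems
      by (intro expectation_mono_finite fp disagreement_pivot_step[OF _ x]) blast
    also have "\<dots> \<le> ?c + potential g (U - {x}) ?A ?B"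
      unfolding E_const using Suc.prems x by (intro add_left_mono Suc.hyps(1) k) auto
    finally show "F x \<le> ?c + potential g (U - {x}) ?A ?B" .
  next
    fix x assume x: "x \<in> U - ?S"
    let ?Z = "{v\<in>B. nb v x}"
    let ?A = "{v\<in>A. \<not> nb v x}" and ?B = "{v\<in>A. nb v x} \<union> {v\<in>B. \<not> nb v x}"
    let ?c = "2 * pair_sum nb ?Z ?S"
    have R: "?S - ?Z = ?A \<union> ?B" using Suc.prems by auto
    have "F x \<le> ?E (U - {x}) (\<lambda>xs. ?c + disagreement nb (?A \<union> ?B) (truncated_pivot nb xs ?A ?B))"
      unfolding F_def R[symmetric] using Suc.prems x
      by (intro expectation_mono_finite fp disagreement_dead_step) blast+
    also have "\<dots> \<le> ?c + potential g (U - {x}) ?A ?B"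
      unfolding E_const using Suc.prems x by (intro add_left_mono Suc.hyps(1) k) auto
    finally show "F x \<le> ?c + potential g (U - {x}) ?A ?B" .
  qed
  then have "(\<Sum>x\<in>U. F x) / card U \<le> potential g U A B"
    using fU by (simp add: field_simps card_gt_0_iff)
  then show ?case unfolding expectation_random_permutation[OF fU] F_def .
qed

text \<open>At the start every node is unclustered and \<open>B\<close> is empty, so both edge
  summands of the potential vanish.\<close>

theorem expectation_truncated_pivot:
  "measure_pmf.expectation (pmf_of_set (permutations_of_set V))
      (\<lambda>xs. disagreement nb V (truncated_pivot nb xs V {})) \<le> 5 * disagreement nb V g"
  using expectation_truncated_pivot_le_potential[of V V "{}" g]
  by (simp add: potential_def pair_sum_def)

end

section \<open>Two neighbours per node determine the outcome of truncated pivot\<close>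

lemma filter_in_set_take:
  "distinct xs \<Longrightarrow> filter (\<lambda>u. u \<in> set (take k (filter P xs))) xs = take k (filter P xs)"
proof (induction xs arbitrary: k)
  case (Cons x xs)
  show ?case
  proof (cases "P x \<and> k \<noteq> 0")
    case True
    then obtain j where "k = Suc j" using not0_implies_Suc by blast
    moreover have "filter (\<lambda>u. u = x \<or> u \<in> set (take j (filter P xs))) xs
        = filter (\<lambda>u. u \<in> set (take j (filter P xs))) xs"
      using Cons.prems by (intro filter_cong) auto
    ultimately show ?thesis using True Cons by simp
  next
    case False
    have "x \<notin> set (take k (filter P xs))" using Cons.prems by (auto dest: in_set_takeD)
    then show ?thesis using False Cons by (cases "P x") auto
  qed
qed simp

text \<open>A node of \<open>A\<close> has two looks left and a node of \<open>B\<close> has one; a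
  neighbour that is processed without clustering the node uses up a look. Hence \<open>nb'\<close>
  may keep just the first two neighbours of each node, although it is then no longer symmetric. This
  is what keeps the replies of the nodes short.\<close>

lemma truncated_pivot_cong:
  assumes "distinct xs"
    and "\<And>v. v \<in> A \<Longrightarrow> filter (nb' v) xs = take 2 (filter (nb v) xs)"
    and "\<And>v. v \<in> B \<Longrightarrow> filter (nb' v) xs = take 1 (filter (nb v) xs)"
  shows "truncated_pivot nb' xs A B = truncated_pivot nb xs A B"
  using assms
proof (induction xs arbitrary: A B)
  case (Cons x xs)
  have eq: "nb' v x = nb v x" if "v \<in> A \<union> B" for v
  proof (rule ccontr)
    assume ne: "nb' v x \<noteq> nb v x"
    \<comment> \<open>If \<open>x\<close> is a neighbour at all, it is the first one, so every
      nonempty prefix of the neighbour list decides about \<open>x\<close> correctly.\<close>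
    have "\<exists>k. filter (nb' v) (x # xs) = take (Suc k) (filter (nb v) (x # xs))"
      using that Cons.prems(2,3)[of v] by (metis One_nat_def Suc_1 Un_iff)
    then obtain k where k: "filter (nb' v) (x # xs) = take (Suc k) (filter (nb v) (x # xs))" ..
    have "x \<in> set (filter (nb' v) (x # xs)) \<longleftrightarrow> x \<in> set (filter (nb v) (x # xs))"
    proof (cases "nb v x")
      case False
      then have "x \<notin> set (filter (nb v) (x # xs))" by simp
      then show ?thesis unfolding k using in_set_takeD by fast
    qed (use k in simp)
    moreover have "x \<in> set (filter P (x # xs)) \<longleftrightarrow> P x" for P by simp
    ultimately show False using ne by metis
  qed
  have A: "filter (nb' v) xs = take 2 (filter (nb v) xs)" if "v \<in> A" "\<not> nb v x" for v
    using that Cons.prems(2)[of v] eq[of v] by simp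
  have A': "filter (nb' v) xs = take 1 (filter (nb v) xs)" if "v \<in> A" "nb v x" for v
    using that Cons.prems(2)[of v] eq[of v] by (simp add: numeral_2_eq_2)
  have B: "filter (nb' v) xs = take 1 (filter (nb v) xs)" if "v \<in> B" "\<not> nb v x" for v
    using that Cons.prems(3)[of v] eq[of v] by simp
  show ?case
  proof (cases "x \<in> A \<union> B")
    case True
    let ?A = "{v\<in>A. v \<noteq> x \<and> \<not> nb v x}" and ?B = "{v\<in>B. v \<noteq> x \<and> \<not> nb v x}"
    have A': "{v\<in>A. v \<noteq> x \<and> \<not> nb' v x} = ?A" and B': "{v\<in>B. v \<noteq> x \<and> \<not> nb' v x} = ?B"
      using eq by auto
    have IH: "truncated_pivot nb' xs ?A ?B = truncated_pivot nb xs ?A ?B"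
      using Cons.prems(1) A B by (intro Cons.IH) auto
    have "v \<in> A \<union> B \<and> (v = x \<or> nb' v x) \<longleftrightarrow> v \<in> A \<union> B \<and> (v = x \<or> nb v x)" for v
      using eq by blast
    then show ?thesis unfolding truncated_pivot.simps if_P[OF True] A' B' IH by presburger
  next
    case False
    let ?A = "{v\<in>A. \<not> nb v x}" and ?B = "{v\<in>A. nb v x} \<union> {v\<in>B. \<not> nb v x}"
    have "{v\<in>A. \<not> nb' v x} = ?A" "{v\<in>A. nb' v x} \<union> {v\<in>B. \<not> nb' v x} = ?B" using eq by auto
    moreover have "truncated_pivot nb' xs ?A ?B = truncated_pivot nb xs ?A ?B"
      using Cons.prems(1) A A' B by (intro Cons.IH) auto
    ultimately show ?thesis unfolding truncated_pivot.simps if_not_P[OF False] by metis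
  qed
qed simp

subsection \<open>Clusterings as labellings\<close>

definition label_clusters :: "'a set \<Rightarrow> ('a \<Rightarrow> 'b) \<Rightarrow> 'a set set" where
  "label_clusters V g = (\<lambda>l. {v\<in>V. g v = l}) ` g ` V"

lemma partition_on_label_clusters: "partition_on V (label_clusters V g)"
  by (rule partition_onI) (auto simp: label_clusters_def disjnt_def)

text \<open>Each cluster is labelled by one of its own nodes. Extensional functions from
  \<open>V\<close> to \<open>V\<close> therefore cover all clusterings, which makes the union bound
  finite.\<close>

lemma label_clusters_surj:
  assumes "partition_on V P"
  obtains g where "g \<in> V \<rightarrow>\<^sub>E V" "label_clusters V g = P"
proof -
  define cl where "cl v = (THE C. C \<in> P \<and> v \<in> C)" for v
  have cl: "cl v = C" if "C \<in> P" "v \<in> C" for v C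
    unfolding cl_def using that assms partition_onD2[OF assms]
    by (intro the_equality) (auto simp: disjoint_def)
  define g where "g = (\<lambda>v\<in>V. SOME u. u \<in> cl v)"
  have g: "g v = (SOME u. u \<in> C)" if "C \<in> P" "v \<in> C" for v C
    using that cl[OF that] partition_onD1[OF assms] by (auto simp: g_def)
  have gC: "g v \<in> C" if "C \<in> P" "v \<in> C" for v C
    unfolding g[OF that] using that by (auto intro: someI)
  have C: "{v\<in>V. g v = g u} = C" if "C \<in> P" "u \<in> C" for u C
  proof (intro set_eqI iffI)
    fix v assume v: "v \<in> {v\<in>V. g v = g u}"
    then obtain C' where C': "C' \<in> P" "v \<in> C'" using partition_onD1[OF assms] by auto
    with v gC[OF C'] have "g u \<in> C'" by simp
    moreover have "g u \<in> C" using gC[OF that] .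
    ultimately have "C' = C" using partition_onD2[OF assms] C' that by (auto simp: disjoint_def)
    then show "v \<in> C" using C' by simp
  qed (use that g partition_onD1[OF assms] in auto)
  have "g \<in> V \<rightarrow>\<^sub>E V"
  proof (rule PiE_I)
    fix v assume "v \<in> V"
    then obtain C where "C \<in> P" "v \<in> C" using partition_onD1[OF assms] by auto
    then show "g v \<in> V" using gC partition_onD1[OF assms] by blast
  qed (simp add: g_def)
  moreover have "label_clusters V g = P"
  proof (intro set_eqI iffI)
    fix C assume "C \<in> label_clusters V g"
    then obtain u where "u \<in> V" "C = {v\<in>V. g v = g u}" by (auto simp: label_clusters_def)
    moreover obtain C' where "C' \<in> P" "u \<in> C'" using \<open>u \<in> V\<close> partition_onD1[OF assms] by auto
    ultimately show "C \<in> P" using C[of C' u] by simp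
  next
    fix C assume "C \<in> P"
    moreover then obtain u where "u \<in> C" using partition_onD3[OF assms] by (metis ex_in_conv)
    ultimately have "C = {v\<in>V. g v = g u}" "u \<in> V" using C partition_onD1[OF assms] by auto
    then show "C \<in> label_clusters V g" by (auto simp: label_clusters_def)
  qed
  ultimately show thesis using that by blast
qed

lemma card_ordered_pairs:
  assumes "finite M" "\<And>e. e \<in> M \<Longrightarrow> card e = 2"
  shows "card {(u, w). u \<noteq> w \<and> {u, w} \<in> M} = 2 * card M"
proof -
  let ?T = "\<lambda>e. {(u, w). {u, w} = e}"
  have T: "\<exists>a b. a \<noteq> b \<and> e = {a, b} \<and> ?T e = {(a, b), (b, a)}" if e: "e \<in> M" for e
  proof -
    obtain a b where "e = {a, b}" "a \<noteq> b" using assms(2)[OF e] unfolding card_2_iff by blast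
    moreover from this have "?T e = {(a, b), (b, a)}" by (auto simp: doubleton_eq_iff)
    ultimately show ?thesis by blast
  qed
  have T2: "finite (?T e)" "card (?T e) = 2" if "e \<in> M" for e
    using T[OF that] by auto
  have "u \<noteq> w" if "{u, w} \<in> M" for u w using assms(2)[OF that] by auto
  then have "{(u, w). u \<noteq> w \<and> {u, w} \<in> M} = (\<Union>e\<in>M. ?T e)" by blast
  also have "card \<dots> = (\<Sum>e\<in>M. card (?T e))"
    using assms(1) T2 by (intro card_UN_disjoint) auto
  also have "\<dots> = (\<Sum>e\<in>M. 2)" using T2 by (intro sum.cong) auto
  finally show ?thesis by simp
qed

lemma disagreement_eq_cc_cost:
  assumes "simple_graph V E"
  shows "disagreement (\<lambda>u w. {u, w} \<in> E) V g = 2 * real (cc_cost V E (label_clusters V g))"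
proof -
  let ?P = "label_clusters V g"
  let ?M1 = "{e \<in> E. \<not> within_cluster ?P e}" and ?M2 = "{e \<in> node_pairs V - E. within_cluster ?P e}"
  have fV: "finite V" and E: "E \<subseteq> node_pairs V" using assms by (auto simp: simple_graph_def)
  have fN: "finite (node_pairs V)" using fV by (simp add: node_pairs_def)
  have f: "finite ?M1" "finite ?M2" using fN finite_subset[OF E fN] by auto
  have within: "within_cluster ?P {u, w} \<longleftrightarrow> g u = g w" if "u \<in> V" "w \<in> V" for u w
    using that by (auto simp: within_cluster_def label_clusters_def)
  have "{(u, w). u \<in> V \<and> w \<in> V \<and> mismatch (\<lambda>u w. {u, w} \<in> E) g u w}
      = {(u, w). u \<noteq> w \<and> {u, w} \<in> ?M1 \<union> ?M2}"
  proof -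
    have V: "u \<in> V \<and> w \<in> V" if "{u, w} \<in> ?M1 \<union> ?M2" for u w
      using that E by (auto simp: node_pairs_def)
    have "mismatch (\<lambda>u w. {u, w} \<in> E) g u w \<longleftrightarrow> u \<noteq> w \<and> {u, w} \<in> ?M1 \<union> ?M2"
      if "u \<in> V" "w \<in> V" for u w
      using that within[OF that] by (auto simp: mismatch_def node_pairs_def)
    with V show ?thesis by blast
  qed
  moreover have "card {(u, w). u \<noteq> w \<and> {u, w} \<in> ?M1 \<union> ?M2} = 2 * card (?M1 \<union> ?M2)"
    using f E by (intro card_ordered_pairs) (auto simp: node_pairs_def)
  moreover have "card (?M1 \<union> ?M2) = cc_cost V E ?P"
    unfolding cc_cost_def using f by (intro card_Un_disjoint) auto
  ultimately show ?thesis
    unfolding disagreement_def using fV by (simp add: pair_sum_eq_card)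
qed

lemma finite_partitions: "finite V \<Longrightarrow> finite {P. partition_on V P}"
  by (rule finite_subset[of _ "Pow (Pow V)"]) (auto simp: partition_on_def)

lemma cc_opt_attained:
  assumes "simple_graph V E"
  obtains g where "g \<in> V \<rightarrow>\<^sub>E V" "disagreement (\<lambda>u w. {u, w} \<in> E) V g = 2 * real (cc_opt V E)"
proof -
  have "finite V" using assms by (simp add: simple_graph_def)
  then have "finite (cc_cost V E ` {P. partition_on V P})" using finite_partitions by blast
  moreover have "cc_cost V E ` {P. partition_on V P} \<noteq> {}"
    using partition_on_label_clusters by blast
  ultimately have "cc_opt V E \<in> cc_cost V E ` {P. partition_on V P}"
    unfolding cc_opt_def by (rule Min_in)
  then obtain P where P: "partition_on V P" "cc_cost V E P = cc_opt V E" by auto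
  obtain g where "g \<in> V \<rightarrow>\<^sub>E V" "label_clusters V g = P" using label_clusters_surj[OF P(1)] .
  then show thesis using that disagreement_eq_cc_cost[OF assms, of g] P by simp
qed


subsection \<open>Refinement by sampling\<close>

text \<open>The symmetric difference of the two cluster graphs, in which nodes are joined if they
  have the same label.\<close>

definition label_diff :: "('a \<Rightarrow> 'b) \<Rightarrow> ('a \<Rightarrow> 'c) \<Rightarrow> 'a \<Rightarrow> 'a \<Rightarrow> bool" where
  "label_diff g h u w \<longleftrightarrow> u \<noteq> w \<and> (g u = g w) \<noteq> (h u = h w)"

text \<open>
  The edge set of the graph and that of the clustering \<open>g\<close> differ in \<open>d\<close> ordered pairs, of which the
  multiset contains at most \<open>s\<close> samples. Switching from \<open>g\<close> to \<open>h\<close> adds an error on each pair on which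
  \<open>g\<close> and \<open>h\<close> differ, except that it repairs the error on those among the \<open>d\<close> pairs.
\<close>

definition estimate ::
    "'a set \<Rightarrow> ('a \<Rightarrow> 'b) \<Rightarrow> real \<Rightarrow> nat \<Rightarrow> ('a \<times> 'a) multiset \<Rightarrow> ('a \<Rightarrow> 'c) \<Rightarrow> real" where
  "estimate V g d s M h = pair_sum (label_diff g h) V V + d
     - 2 * d * (real (size {#(u, w) \<in># M. label_diff g h u w#}) / real s)"

definition refine ::
    "'a set \<Rightarrow> ('a \<Rightarrow> 'b) \<Rightarrow> real \<Rightarrow> nat \<Rightarrow> ('a \<times> 'a) multiset \<Rightarrow> 'a \<Rightarrow> 'a" where
  "refine V g d s M = arg_min_on (estimate V g d s M) (V \<rightarrow>\<^sub>E V)"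

text \<open>Needed for \<open>restrict g V\<close>, and for a labelling read from a list of words,
  which is only meaningful on \<open>V\<close>.\<close>

lemma estimate_cong:
  assumes "\<And>v. v \<in> V \<Longrightarrow> g v = g' v" and "\<And>u w. (u, w) \<in># M \<Longrightarrow> u \<in> V \<and> w \<in> V"
  shows "estimate V g d s M h = estimate V g' d s M h"
proof -
  have "label_diff g h u w = label_diff g' h u w" if "u \<in> V" "w \<in> V" for u w
    using that assms(1) by (auto simp: label_diff_def)
  moreover from this have "{#(u, w) \<in># M. label_diff g h u w#} = {#(u, w) \<in># M. label_diff g' h u w#}"
    using assms(2) by (intro filter_mset_cong) auto
  moreover have "pair_sum (label_diff g h) V V = pair_sum (label_diff g' h) V V"
    using calculation(1) by (rule pair_sum_cong)
  ultimately show ?thesis unfolding estimate_def by simp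
qed

context finite_graph
begin

definition mismatches :: "('a \<Rightarrow> 'b) \<Rightarrow> ('a \<times> 'a) set" where
  "mismatches g = {(u, w). u \<in> V \<and> w \<in> V \<and> mismatch nb g u w}"

lemma finite_mismatches: "finite (mismatches g)"
  by (rule finite_subset[of _ "V \<times> V"]) (auto simp: mismatches_def fin)

lemma disagreement_eq_card: "disagreement nb V g = real (card (mismatches g))"
  by (simp add: disagreement_def pair_sum_eq_card fin mismatches_def)

lemma finite_labels: "finite (V \<rightarrow>\<^sub>E V)"
  by (simp add: finite_PiE fin)

lemma labels_nonempty: "V \<rightarrow>\<^sub>E V \<noteq> {}"
  by (auto simp: PiE_eq_empty_iff)

lemma refine_in: "refine V g d s M \<in> V \<rightarrow>\<^sub>E V"
  unfolding refine_def using finite_labels labels_nonempty by (rule arg_min_if_finite(1))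

lemma refine_least: "h \<in> V \<rightarrow>\<^sub>E V \<Longrightarrow> estimate V g d s M (refine V g d s M) \<le> estimate V g d s M h"
  unfolding refine_def using finite_labels labels_nonempty by (rule arg_min_least)

text \<open>With the graph, \<open>g\<close> and \<open>h\<close> viewed as edge sets, this is the
  size of a symmetric difference of symmetric differences: the graph against \<open>h\<close> is the
  graph against \<open>g\<close>, corrected by \<open>g\<close> against \<open>h\<close>.\<close>

lemma disagreement_shift:
  "disagreement nb V h = pair_sum (label_diff g h) V V + disagreement nb V g
     - 2 * real (card {(u, w) \<in> mismatches g. label_diff g h u w})"
proof -
  let ?c = "\<lambda>u w. mismatch nb g u w \<and> label_diff g h u w"
  have *: "of_bool (mismatch nb h u w) + 2 * of_bool (?c u w)
      = (of_bool (label_diff g h u w) + of_bool (mismatch nb g u w) :: real)" for u w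
    by (cases "u = w"; cases "nb u w"; cases "g u = g w"; cases "h u = h w")
      (simp_all add: mismatch_def label_diff_def)
  have "disagreement nb V h + 2 * pair_sum ?c V V = pair_sum (label_diff g h) V V + disagreement nb V g"
    unfolding disagreement_def pair_sum_def sum_distrib_left sum.distrib[symmetric] * ..
  moreover have "pair_sum ?c V V = real (card {(u, w) \<in> mismatches g. label_diff g h u w})"
    unfolding pair_sum_eq_card[OF fin fin]
    by (intro arg_cong[where f="\<lambda>x. real (card x)"]) (auto simp: mismatches_def)
  ultimately show ?thesis by simp
qed

text \<open>A deterministic safeguard, valid for misleading samples as well. Since \<open>g\<close>
  competes with estimate \<open>d\<close> and a sampled fraction is at most 1, the minimiser differs
  from \<open>g\<close> on at most \<open>2 * d\<close> pairs. The restriction of \<open>g\<close>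
  to \<open>V\<close> is used because candidates have to be extensional.\<close>

lemma disagreement_refine_le_triple:
  assumes "size M \<le> s" "\<And>v. v \<in> V \<Longrightarrow> g v \<in> V"
    and M: "\<And>u w. (u, w) \<in># M \<Longrightarrow> u \<in> V \<and> w \<in> V"
  shows "disagreement nb V (refine V g (disagreement nb V g) s M) \<le> 3 * disagreement nb V g"
proof -
  let ?d = "disagreement nb V g"
  let ?h = "refine V g ?d s M"
  have d: "?d \<ge> 0" by (simp add: disagreement_def pair_sum_nonneg)
  have "estimate V g ?d s M ?h \<le> estimate V g ?d s M (restrict g V)"
    using assms by (intro refine_least) auto
  also have "\<dots> = estimate V (restrict g V) ?d s M (restrict g V)"
    using M by (intro estimate_cong) auto
  also have "\<dots> = ?d" by (simp add: estimate_def label_diff_def pair_sum_def)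
  finally have "pair_sum (label_diff g ?h) V V
      \<le> 2 * ?d * (real (size {#(u, w) \<in># M. label_diff g ?h u w#}) / real s)"
    by (simp add: estimate_def)
  also have "real (size {#(u, w) \<in># M. label_diff g ?h u w#}) / real s \<le> 1"
    using order.trans[OF size_filter_mset_lesseq assms(1), of "\<lambda>(u, w). label_diff g ?h u w"]
    by (auto simp: divide_le_eq_1)
  then have "2 * ?d * (real (size {#(u, w) \<in># M. label_diff g ?h u w#}) / real s) \<le> 2 * ?d"
    using d by (intro mult_left_le) auto
  finally have "pair_sum (label_diff g ?h) V V \<le> 2 * ?d" .
  then show ?thesis using disagreement_shift[of ?h g] by simp
qed

text \<open>Accuracy is required for all labellings at once, since the minimiser depends on the
  sample.\<close>

definition good_sample :: "('a \<Rightarrow> 'b) \<Rightarrow> real \<Rightarrow> nat \<Rightarrow> ('a \<times> 'a) multiset \<Rightarrow> bool" where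
  "good_sample g \<tau> s M \<longleftrightarrow> (\<forall>h \<in> V \<rightarrow>\<^sub>E V.
     \<bar>disagreement nb V g * (real (size {#(u, w) \<in># M. label_diff g h u w#}) / real s)
       - real (card {(u, w) \<in> mismatches g. label_diff g h u w})\<bar> \<le> \<tau> * disagreement nb V g)"

text \<open>The sampled count enters the estimate with factor 2, so the estimate errs by at most
  \<open>2 * \<tau> * d\<close>, once at the minimiser and once at \<open>h\<close>.\<close>

lemma disagreement_refine_good:
  assumes "good_sample g \<tau> s M" "h \<in> V \<rightarrow>\<^sub>E V"
  shows "disagreement nb V (refine V g (disagreement nb V g) s M)
    \<le> disagreement nb V h + 4 * \<tau> * disagreement nb V g"
proof -
  let ?d = "disagreement nb V g"
  have *: "\<bar>estimate V g ?d s M h - disagreement nb V h\<bar> \<le> 2 * \<tau> * ?d" if "h \<in> V \<rightarrow>\<^sub>E V" for h :: "'a \<Rightarrow> 'a"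
  proof -
    let ?c = "?d * (real (size {#(u, w) \<in># M. label_diff g h u w#}) / real s)"
    let ?k = "real (card {(u, w) \<in> mismatches g. label_diff g h u w})"
    have "\<bar>?c - ?k\<bar> \<le> \<tau> * ?d" using assms(1) that unfolding good_sample_def by blast
    moreover have "estimate V g ?d s M h - disagreement nb V h = 2 * (?k - ?c)"
      unfolding disagreement_shift[of h g] estimate_def by (simp add: algebra_simps)
    ultimately show ?thesis by (simp add: abs_le_iff)
  qed
  from *[OF refine_in, of g ?d s M] *[OF assms(2)] refine_least[OF assms(2), of g ?d s M]
  show ?thesis by linarith
qed

text \<open>The default value of the product distribution is never sampled.\<close>

definition sample_pmf :: "'a \<times> 'a \<Rightarrow> nat \<Rightarrow> ('a \<Rightarrow> 'b) \<Rightarrow> ('a \<times> 'a) multiset pmf" where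
  "sample_pmf dflt s g = (if mismatches g = {} then return_pmf {#}
     else map_pmf (\<lambda>y. image_mset y (mset_set {..<s}))
       (Pi_pmf {..<s} dflt (\<lambda>_. pmf_of_set (mismatches g))))"

lemma sample_pmf_support:
  assumes "M \<in> set_pmf (sample_pmf dflt s g)"
  shows "size M \<le> s" "(u, w) \<in># M \<Longrightarrow> u \<in> V \<and> w \<in> V"
proof -
  have "size M \<le> s \<and> set_mset M \<subseteq> mismatches g"
    using assms finite_mismatches[of g]
    by (auto simp: sample_pmf_def set_Pi_pmf PiE_dflt_def split: if_splits)
  then show "size M \<le> s" "(u, w) \<in># M \<Longrightarrow> u \<in> V \<and> w \<in> V" by (auto simp: mismatches_def)
qed

lemma finite_sample_pmf: "finite (set_pmf (sample_pmf dflt s g))"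
proof (cases "mismatches g = {}")
  case False
  then have "finite (set_pmf (Pi_pmf {..<s} dflt (\<lambda>_. pmf_of_set (mismatches g))))"
    using finite_mismatches[of g] by (simp add: set_Pi_pmf finite_PiE_dflt)
  with False show ?thesis by (simp add: sample_pmf_def)
qed (simp add: sample_pmf_def)

lemma prob_bad_sample:
  assumes "s > 0" "\<tau> > 0"
  shows "measure_pmf.prob (sample_pmf dflt s g) {M. \<not> good_sample g \<tau> s M}
    \<le> card (V \<rightarrow>\<^sub>E V) * (2 * exp (- 2 * real s * \<tau>\<^sup>2))"
proof (cases "mismatches g = {}")
  case True
  then have "good_sample g \<tau> s {#}" by (simp add: good_sample_def disagreement_eq_card)
  then show ?thesis using True by (simp add: sample_pmf_def)
next
  case False
  let ?D = "mismatches g"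
  let ?p = "Pi_pmf {..<s} dflt (\<lambda>_. pmf_of_set ?D)"
  let ?Q = "\<lambda>h. \<lambda>(u, w). label_diff g h u w"
  let ?B = "\<lambda>h. {y. \<bar>(\<Sum>i<s. of_bool (?Q h (y i))) - real s * (real (card {x\<in>?D. ?Q h x}) / real (card ?D))\<bar> \<ge> real s * \<tau>}"
  have D: "finite ?D" "card ?D > 0" using False finite_mismatches by (auto simp: card_gt_0_iff)
  have "measure_pmf.prob (sample_pmf dflt s g) {M. \<not> good_sample g \<tau> s M}
      = measure_pmf.prob ?p {y. \<not> good_sample g \<tau> s (image_mset y (mset_set {..<s}))}"
    using False by (simp add: sample_pmf_def vimage_def)
  also have "\<dots> \<le> measure_pmf.prob ?p (\<Union>h\<in>V \<rightarrow>\<^sub>E V. ?B h)"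
  proof (intro measure_pmf.finite_measure_mono subsetI)
    fix y assume "y \<in> {y. \<not> good_sample g \<tau> s (image_mset y (mset_set {..<s}))}"
    then obtain h where h: "h \<in> V \<rightarrow>\<^sub>E V" and
      *: "\<bar>card ?D * (real (size (filter_mset (?Q h) (image_mset y (mset_set {..<s})))) / real s)
         - real (card {x\<in>?D. ?Q h x})\<bar> > \<tau> * card ?D"
    proof -
      have "{(u, w) \<in> ?D. label_diff g h u w} = {x\<in>?D. ?Q h x}" for h :: "'a \<Rightarrow> 'a" by auto
      then show ?thesis
        using \<open>y \<in> _\<close> that by (auto simp: good_sample_def disagreement_eq_card not_le simp del: times_divide_eq_right)
    qed
    have "real (size (filter_mset (?Q h) (image_mset y (mset_set {..<s})))) = (\<Sum>i<s. of_bool (?Q h (y i)))"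
      by (simp add: filter_mset_image_mset Int_def)
    with * have "\<bar>card ?D * ((\<Sum>i<s. of_bool (?Q h (y i))) / real s) - real (card {x\<in>?D. ?Q h x})\<bar> > \<tau> * card ?D"
      by metis
    \<comment> \<open>Rescaling by \<open>card ?D / s\<close> turns an error relative to the number
      of mismatches into the additive deviation of Hoeffding's bound.\<close>
    also have "card ?D * ((\<Sum>i<s. of_bool (?Q h (y i))) / real s) - real (card {x\<in>?D. ?Q h x})
      = (card ?D / s) * ((\<Sum>i<s. of_bool (?Q h (y i))) - real s * (real (card {x\<in>?D. ?Q h x}) / real (card ?D)))"
      using D assms by (simp add: field_simps)
    finally have "(card ?D / s) * \<bar>(\<Sum>i<s. of_bool (?Q h (y i))) - real s * (real (card {x\<in>?D. ?Q h x}) / real (card ?D))\<bar>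
        > (card ?D / s) * (s * \<tau>)"
      using assms by (simp add: abs_mult mult.commute)
    then have "y \<in> ?B h"
      using D assms by (subst (asm) mult_less_cancel_left_pos) auto
    with h show "y \<in> (\<Union>h\<in>V \<rightarrow>\<^sub>E V. ?B h)" by blast
  qed simp
  also have "\<dots> \<le> (\<Sum>h\<in>V \<rightarrow>\<^sub>E V. measure_pmf.prob ?p (?B h))"
    by (intro measure_pmf.finite_measure_subadditive_finite finite_labels) auto
  also have "\<dots> \<le> (\<Sum>h\<in>V \<rightarrow>\<^sub>E V. 2 * exp (- 2 * real s * \<tau>\<^sup>2))"
    using False D assms by (intro sum_mono hoeffding_count)
  finally show ?thesis by simp
qed

section \<open>The whole random experiment: best of \<open>K\<close> pivot runs, then
  refinement\<close>

definition best_pivot :: "nat \<Rightarrow> (nat \<Rightarrow> 'a list) \<Rightarrow> 'a \<Rightarrow> 'a" where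
  "best_pivot K p = truncated_pivot nb
     (p (arg_min_on (\<lambda>j. disagreement nb V (truncated_pivot nb (p j) V {})) {..<K})) V {}"

lemma disagreement_best_pivot_le:
  assumes "j < K"
  shows "disagreement nb V (best_pivot K p) \<le> disagreement nb V (truncated_pivot nb (p j) V {})"
  unfolding best_pivot_def using assms by (intro arg_min_least) auto

lemma best_pivot_in: "v \<in> V \<Longrightarrow> best_pivot K p v \<in> V"
  unfolding best_pivot_def using truncated_pivot_inside[of v V "{}"] by simp

definition orders_pmf :: "nat \<Rightarrow> (nat \<Rightarrow> 'a list) pmf" where
  "orders_pmf K = Pi_pmf {..<K} [] (\<lambda>_. pmf_of_set (permutations_of_set V))"

text \<open>The experiment without any machines; \<open>protocol_law\<close> identifies it with the
  output of the protocol.\<close>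

definition cluster_pmf :: "'a \<times> 'a \<Rightarrow> nat \<Rightarrow> nat \<Rightarrow> ('a \<Rightarrow> 'a) pmf" where
  "cluster_pmf dflt K s = do {
     p \<leftarrow> orders_pmf K;
     M \<leftarrow> sample_pmf dflt s (best_pivot K p);
     return_pmf (refine V (best_pivot K p) (disagreement nb V (best_pivot K p)) s M)}"

lemma set_random_order: "set_pmf (pmf_of_set (permutations_of_set V)) = permutations_of_set V"
  using fin by (intro set_pmf_of_set) auto

lemma finite_orders_pmf: "finite (set_pmf (orders_pmf K))"
  unfolding orders_pmf_def using fin by (simp add: set_Pi_pmf finite_PiE_dflt set_random_order)

text \<open>The 10 is twice the expected ratio 5: by Markov each run exceeds it with probability at
  most 1/2, and the best run does so only if all \<open>K\<close> independent runs do.\<close>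

lemma prob_best_pivot_bad:
  "measure_pmf.prob (orders_pmf K) {p. disagreement nb V (best_pivot K p) > 10 * disagreement nb V h}
    \<le> (1 / 2) ^ K"
proof -
  let ?r = "pmf_of_set (permutations_of_set V)"
  let ?f = "\<lambda>xs. disagreement nb V (truncated_pivot nb xs V {})"
  have half: "measure_pmf.prob ?r {xs. ?f xs > 2 * (5 * disagreement nb V h)} \<le> 1 / 2"
    using fin expectation_truncated_pivot[of h]
    by (intro prob_gt_double_expectation_le_half)
      (auto simp: set_random_order disagreement_def pair_sum_nonneg)
  have "measure_pmf.prob (orders_pmf K) {p. disagreement nb V (best_pivot K p) > 10 * disagreement nb V h}
      \<le> measure_pmf.prob (orders_pmf K) (Pi {..<K} (\<lambda>_. {xs. ?f xs > 2 * (5 * disagreement nb V h)}))"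
    using disagreement_best_pivot_le
    by (intro measure_pmf.finite_measure_mono) (auto intro: less_le_trans)
  also have "\<dots> = (\<Prod>j<K. measure_pmf.prob ?r {xs. ?f xs > 2 * (5 * disagreement nb V h)})"
    unfolding orders_pmf_def by (rule measure_Pi_pmf_Pi) simp
  also have "\<dots> \<le> (\<Prod>j<K. 1 / 2)" using half by (intro prod_mono) auto
  finally show ?thesis by (simp add: power_divide)
qed

text \<open>The best run is no worse than run 0, which has the law of a single run.\<close>

lemma expectation_best_pivot:
  assumes "K > 0"
  shows "measure_pmf.expectation (orders_pmf K) (\<lambda>p. disagreement nb V (best_pivot K p))
    \<le> 5 * disagreement nb V h"
proof -
  let ?f = "\<lambda>xs. disagreement nb V (truncated_pivot nb xs V {})"
  have "measure_pmf.expectation (orders_pmf K) (\<lambda>p. disagreement nb V (best_pivot K p))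
      \<le> measure_pmf.expectation (orders_pmf K) (\<lambda>p. ?f (p 0))"
    using finite_orders_pmf disagreement_best_pivot_le[OF assms] by (intro expectation_mono_finite)
  also have "\<dots> = measure_pmf.expectation (map_pmf (\<lambda>p. p 0) (orders_pmf K)) ?f" by simp
  also have "map_pmf (\<lambda>p. p 0) (orders_pmf K) = pmf_of_set (permutations_of_set V)"
    unfolding orders_pmf_def using assms by (subst Pi_pmf_component) auto
  also have "measure_pmf.expectation \<dots> ?f \<le> 5 * disagreement nb V h"
    by (rule expectation_truncated_pivot)
  finally show ?thesis .
qed

text \<open>With \<open>\<tau> = 1 / 20\<close> the refinement loses
  \<open>4 * \<tau> * d = d / 5\<close>, which is at most twice the cost of \<open>h\<close> if
  \<open>d\<close> is at most ten times that cost; together this is 3. The exponent is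
  \<open>2 * s * \<tau>\<^sup>2 = s / 200\<close>.\<close>

theorem prob_cluster_pmf:
  assumes "s > 0" and h: "h \<in> V \<rightarrow>\<^sub>E V"
  shows "measure_pmf.prob (cluster_pmf dflt K s) {x. disagreement nb V x > 3 * disagreement nb V h}
    \<le> (1 / 2) ^ K + card (V \<rightarrow>\<^sub>E V) * (2 * exp (- real s / 200))"
proof -
  let ?S = "{x. disagreement nb V x > 3 * disagreement nb V h}"
  let ?r = "\<lambda>p M. refine V (best_pivot K p) (disagreement nb V (best_pivot K p)) s M"
  let ?c = "card (V \<rightarrow>\<^sub>E V) * (2 * exp (- real s / 200))"
  let ?B = "{p. disagreement nb V (best_pivot K p) > 10 * disagreement nb V h}"
  have "measure_pmf.prob (cluster_pmf dflt K s) ?S \<le> measure_pmf.prob (orders_pmf K) ?B + ?c"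
    unfolding cluster_pmf_def
  proof (rule prob_bind_finite_le)
    fix p assume "p \<notin> ?B"
    then have b: "disagreement nb V (best_pivot K p) \<le> 10 * disagreement nb V h" by simp
    have "measure_pmf.prob (sample_pmf dflt s (best_pivot K p) \<bind> (\<lambda>M. return_pmf (?r p M))) ?S
        = measure_pmf.prob (sample_pmf dflt s (best_pivot K p)) (?r p -` ?S)"
      unfolding map_pmf_def[symmetric] by simp
    also have "\<dots> \<le> measure_pmf.prob (sample_pmf dflt s (best_pivot K p))
        {M. \<not> good_sample (best_pivot K p) (1 / 20) s M}"
      using disagreement_refine_good[OF _ h, of "best_pivot K p" "1 / 20" s] b
      by (intro measure_pmf.finite_measure_mono) fastforce+
    also have "\<dots> \<le> ?c"
      using prob_bad_sample[OF assms(1), of "1 / 20" dflt "best_pivot K p"]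
      by (simp add: power2_eq_square)
    finally show "measure_pmf.prob (sample_pmf dflt s (best_pivot K p) \<bind> (\<lambda>M. return_pmf (?r p M))) ?S \<le> ?c" .
  qed (auto simp: finite_orders_pmf finite_sample_pmf)
  then show ?thesis using prob_best_pivot_bad[of K h] by linarith
qed

text \<open>A good sample yields the cost of \<open>h\<close> plus \<open>d / 5\<close>, a bad one
  at most \<open>3 * d\<close>. Since \<open>d\<close> is at most 5 times the cost of
  \<open>h\<close> in expectation, the factors are 1, 1 and 15 times the failure bound.\<close>

theorem expectation_cluster_pmf:
  assumes "s > 0" "K > 0" and h: "h \<in> V \<rightarrow>\<^sub>E V"
  shows "measure_pmf.expectation (cluster_pmf dflt K s) (disagreement nb V)
    \<le> (2 + 15 * (card (V \<rightarrow>\<^sub>E V) * (2 * exp (- real s / 200)))) * disagreement nb V h"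
proof -
  let ?r = "\<lambda>p M. refine V (best_pivot K p) (disagreement nb V (best_pivot K p)) s M"
  let ?c = "card (V \<rightarrow>\<^sub>E V) * (2 * exp (- real s / 200))"
  let ?d = "\<lambda>p. disagreement nb V (best_pivot K p)"
  have d: "?d p \<ge> 0" for p by (simp add: disagreement_def pair_sum_nonneg)
  have inner: "measure_pmf.expectation (sample_pmf dflt s (best_pivot K p) \<bind> (\<lambda>M. return_pmf (?r p M)))
      (disagreement nb V) \<le> disagreement nb V h + (1 / 5 + 3 * ?c) * ?d p" for p
  proof -
    let ?q = "sample_pmf dflt s (best_pivot K p)"
    let ?B = "{M. \<not> good_sample (best_pivot K p) (1 / 20) s M}"
    have int: "integrable (measure_pmf ?q) (f :: _ \<Rightarrow> real)" for f
      by (rule integrable_measure_pmf_finite[OF finite_sample_pmf])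
    have "measure_pmf.expectation (?q \<bind> (\<lambda>M. return_pmf (?r p M))) (disagreement nb V)
        = measure_pmf.expectation ?q (\<lambda>M. disagreement nb V (?r p M))"
      unfolding map_pmf_def[symmetric] by simp
    also have "\<dots> \<le> measure_pmf.expectation ?q
        (\<lambda>M. (disagreement nb V h + ?d p / 5) + 3 * ?d p * indicat_real ?B M)"
    proof (rule expectation_mono_finite[OF finite_sample_pmf])
      fix M assume M: "M \<in> set_pmf ?q"
      show "disagreement nb V (?r p M) \<le> (disagreement nb V h + ?d p / 5) + 3 * ?d p * indicat_real ?B M"
      proof (cases "good_sample (best_pivot K p) (1 / 20) s M")
        case True
        from disagreement_refine_good[OF this h] True show ?thesis by simp
      next
        case False
        have "disagreement nb V (?r p M) \<le> 3 * ?d p"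
          using sample_pmf_support[OF M] best_pivot_in by (intro disagreement_refine_le_triple) auto
        moreover have "disagreement nb V h \<ge> 0" by (simp add: disagreement_def pair_sum_nonneg)
        ultimately show ?thesis using False d[of p] by simp
      qed
    qed
    also have "\<dots> = (disagreement nb V h + ?d p / 5) + 3 * ?d p * measure_pmf.prob ?q ?B"
      by (subst Bochner_Integration.integral_add[OF int int]) simp
    also have "measure_pmf.prob ?q ?B \<le> ?c"
      using prob_bad_sample[OF assms(1), of "1 / 20" dflt "best_pivot K p"] by (simp add: power2_eq_square)
    then have "(disagreement nb V h + ?d p / 5) + 3 * ?d p * measure_pmf.prob ?q ?B
        \<le> (disagreement nb V h + ?d p / 5) + 3 * ?d p * ?c"
      using d by (intro add_left_mono mult_left_mono) auto
    finally show ?thesis by (simp add: algebra_simps)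
  qed
  have int: "integrable (measure_pmf (orders_pmf K)) (f :: _ \<Rightarrow> real)" for f
    by (rule integrable_measure_pmf_finite[OF finite_orders_pmf])
  have "measure_pmf.expectation (cluster_pmf dflt K s) (disagreement nb V)
      = measure_pmf.expectation (orders_pmf K) (\<lambda>p. measure_pmf.expectation
          (sample_pmf dflt s (best_pivot K p) \<bind> (\<lambda>M. return_pmf (?r p M))) (disagreement nb V))"
    unfolding cluster_pmf_def
    by (rule expectation_bind_finite) (auto simp: finite_orders_pmf finite_sample_pmf)
  also have "\<dots> \<le> measure_pmf.expectation (orders_pmf K) (\<lambda>p. disagreement nb V h + (1 / 5 + 3 * ?c) * ?d p)"
    using inner by (intro expectation_mono_finite finite_orders_pmf)
  also have "\<dots> = disagreement nb V h + (1 / 5 + 3 * ?c) * measure_pmf.expectation (orders_pmf K) ?d"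
    by (subst Bochner_Integration.integral_add[OF int int]) simp
  also have "\<dots> \<le> disagreement nb V h + (1 / 5 + 3 * ?c) * (5 * disagreement nb V h)"
    using expectation_best_pivot[OF assms(2)] by (intro add_left_mono mult_left_mono) auto
  finally show ?thesis by (simp add: algebra_simps)
qed

end

subsection \<open>Coordinator protocols\<close>

text \<open>
  An admissible placement may fill the local memory completely. Packing two words into one makes
  room for the messages. The residue 0 marks the last word of a list of odd length.
\<close>

fun pack :: "nat \<Rightarrow> nat list \<Rightarrow> nat list" where
  "pack B [] = []"
| "pack B [x] = [x * (B + 1)]"
| "pack B (x # y # xs) = (x * (B + 1) + (y + 1)) # pack B xs"

definition unpack :: "nat \<Rightarrow> nat list \<Rightarrow> nat list" where
  "unpack B zs = concat (map (\<lambda>z. if z mod (B + 1) = 0 then [z div (B + 1)]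
     else [z div (B + 1), z mod (B + 1) - 1]) zs)"

lemma unpack_pack: "\<forall>x\<in>set xs. x < B \<Longrightarrow> unpack B (pack B xs) = xs"
proof (induction B xs rule: pack.induct)
  case (3 B x y xs)
  have y: "y + 1 < B + 1" using 3(2) by simp
  then have "(x * (B + 1) + (y + 1)) mod (B + 1) = y + 1" "(x * (B + 1) + (y + 1)) div (B + 1) = x"
    by (simp_all only: mod_mult_self3 div_mult_self3 mod_less div_less)
  then show ?case using 3 by (simp add: unpack_def del: mult_Suc_right)
qed (auto simp: unpack_def simp del: mult_Suc_right)

lemma length_pack: "length (pack B xs) = (length xs + 1) div 2"
  by (induction B xs rule: pack.induct) auto

lemma pack_less:
  assumes "\<forall>x\<in>set xs. x < B" "z \<in> set (pack B xs)"
  shows "z < B * (B + 1)"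
  using assms
proof (induction B xs rule: pack.induct)
  case (3 B x y xs)
  have "(x + 1) * (B + 1) \<le> B * (B + 1)" using 3 by (intro mult_right_mono) auto
  then have "x * (B + 1) + (y + 1) < B * (B + 1)" using 3 by (auto simp: algebra_simps)
  then show ?case using 3 by auto
qed (auto intro: add_less_le_mono mult_le_mono)

text \<open>Input and replies share one format, node, length, list, so that a single parser reads
  both.\<close>

fun parse :: "nat list \<Rightarrow> (nat \<times> nat list) list" where
  "parse (v # k # xs) = (v, take k xs) # parse (drop k xs)"
| "parse _ = []"

definition serialize :: "(nat \<times> nat list) list \<Rightarrow> nat list" where
  "serialize L = concat (map (\<lambda>(v, ws). v # length ws # ws) L)"

lemma parse_serialize: "parse (serialize L) = L"
  by (induction L) (auto simp: serialize_def)

text \<open>Only machine 0 ever makes random choices, so the product over all machines collapses to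
  its law.\<close>

lemma Pi_pmf_single_random:
  assumes "finite A" "x \<in> A" "\<And>i. i \<in> A - {x} \<Longrightarrow> p i = return_pmf (h i)"
  shows "Pi_pmf A d p = map_pmf (\<lambda>y i. if i = x then y else if i \<in> A then h i else d) (p x)"
proof -
  have "Pi_pmf A d p = Pi_pmf (insert x (A - {x})) d p" using assms by (simp add: insert_absorb)
  also have "\<dots> = map_pmf (\<lambda>(y, f). f(x := y)) (pair_pmf (p x) (Pi_pmf (A - {x}) d p))"
    using assms by (subst Pi_pmf_insert) auto
  also have "Pi_pmf (A - {x}) d p = Pi_pmf (A - {x}) d (\<lambda>i. return_pmf (h i))"
    using assms by (intro Pi_pmf_cong) auto
  also have "\<dots> = return_pmf (\<lambda>i. if i \<in> A - {x} then h i else d)"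
    using assms by (subst Pi_pmf_return_pmf) auto
  also have "map_pmf (\<lambda>(y, f). f(x := y)) (pair_pmf (p x) \<dots>)
      = map_pmf (\<lambda>y i. if i = x then y else if i \<in> A then h i else d) (p x)"
    unfolding pair_return_pmf2 pmf.map_comp by (intro map_pmf_cong) (auto simp: fun_eq_iff)
  finally show ?thesis .
qed

text \<open>
  A phase \<open>t < T\<close> of a coordinator protocol takes three rounds. Machine 0 draws a message of length \<open>L\<close>
  from its previous message and the replies to it, and sends a different part of it to each machine;
  each machine forwards its part to all machines; finally every machine replies to machine 0, node
  by node. Sending the whole message from machine 0 to all machines directly would exceed its memory.
\<close>

locale coordinator =
  fixes n M S w L T B :: nat
    and draw :: "nat \<Rightarrow> nat list \<Rightarrow> (nat \<Rightarrow> nat list) \<Rightarrow> nat list pmf"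
    and node_reply :: "nat \<Rightarrow> nat list \<Rightarrow> nat \<Rightarrow> nat set \<Rightarrow> nat list"
    and result :: "nat list \<Rightarrow> (nat \<Rightarrow> nat list) \<Rightarrow> nat \<Rightarrow> nat"
begin

definition reply :: "nat \<Rightarrow> nat list \<Rightarrow> nat list \<Rightarrow> nat list" where
  "reply t xs b = serialize (map (\<lambda>(v, ws). (v, node_reply t b v (set ws))) (parse xs))"

definition gather :: "(nat \<Rightarrow> nat list) \<Rightarrow> nat \<Rightarrow> nat list" where
  "gather inbox v =
     (case map_of (concat (map (\<lambda>j. parse (inbox j)) [0..<M])) v of None \<Rightarrow> [] | Some ws \<Rightarrow> ws)"

text \<open>Rounded up so that \<open>M\<close> parts cover the whole message; the waste is the
  \<open>M\<close> in the bound \<open>L + M\<close>.\<close>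

definition chunk :: nat where
  "chunk = L div M + 1"

definition part :: "nat \<Rightarrow> nat list \<Rightarrow> nat list" where
  "part j b = take chunk (drop (j * chunk) b)"

text \<open>Round 0 starts from the raw input. Every later phase starts from the packed input
  followed by the last message, which is found by its fixed length \<open>L\<close>.\<close>

definition stored :: "nat \<Rightarrow> nat list \<Rightarrow> nat list" where
  "stored r xs = (if r = 0 then pack B xs else take (length xs - L) xs)"

definition last_message :: "nat \<Rightarrow> nat list \<Rightarrow> nat list" where
  "last_message r xs = (if r = 0 then [] else drop (length xs - L) xs)"

definition step :: "nat \<Rightarrow> nat \<Rightarrow> mpc_memory \<Rightarrow> mpc_memory pmf" where
  "step r i x =
    (if r mod 3 = 0 then
       (if i = 0 then map_pmf (\<lambda>b. (stored r (fst x), \<lambda>j. if j < M then part j b else []))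
          (draw (r div 3) (last_message r (fst x)) (gather (snd x)))
        else return_pmf (stored r (fst x), \<lambda>_. []))
     else if r mod 3 = 1 then return_pmf (fst x, \<lambda>j. if j < M then snd x 0 else [])
     else let b = concat (map (snd x) [0..<M])
       in return_pmf (fst x @ b, \<lambda>j. if j = 0 then reply (r div 3) (unpack B (fst x)) b else []))"

text \<open>The argument 1 of \<open>last_message\<close> just stands for a nonzero round, in which
  the memory ends with a message.\<close>

definition algorithm :: mpc_algorithm where
  "algorithm = \<lparr>machines = M, local_memory = S, word_bits = w, rounds = 3 * T, local_step = step,
     local_output = (\<lambda>i x. if i = 0 then map (\<lambda>v. (v, result (last_message 1 (fst x)) (gather (snd x)) v)) [0..<n]
       else [])\<rparr>"

lemma algorithm_simps [simp]:
  "machines algorithm = M" "local_memory algorithm = S" "word_bits algorithm = w"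
  "rounds algorithm = 3 * T" "local_step algorithm = step"
  by (simp_all add: algorithm_def)

text \<open>The replies available when phase \<open>t\<close> starts. They belong to the message of
  phase \<open>t - 1\<close>, so there are none for \<open>t = 0\<close>.\<close>

definition answers :: "nat set set \<Rightarrow> nat \<Rightarrow> nat list \<Rightarrow> nat \<Rightarrow> nat list" where
  "answers E t b v = (if t > 0 \<and> v < n then node_reply (t - 1) b v (neighbours E v) else [])"

primrec messages :: "nat set set \<Rightarrow> nat \<Rightarrow> nat list pmf" where
  "messages E 0 = return_pmf []"
| "messages E (Suc t) = messages E t \<bind> (\<lambda>b. draw t b (answers E t b))"

lemma concat_parts:
  assumes "length b = L" "M > 0"
  shows "concat (map (\<lambda>j. part j b) [0..<M]) = b"
proof -
  have "concat (map (\<lambda>j. part j b) [0..<k]) = take (k * chunk) b" for k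
  proof (induction k)
    case (Suc k)
    have "take (Suc k * chunk) b = take (k * chunk + chunk) b" by (simp add: add.commute)
    with Suc show ?case by (simp add: part_def take_add)
  qed simp
  moreover have "L \<le> M * chunk"
    unfolding chunk_def using assms(2) by (metis add_mult_distrib2 div_mult_mod_eq mod_less_divisor mult.commute mult.right_neutral nat_add_left_cancel_le less_imp_le)
  ultimately show ?thesis using assms by simp
qed

end

text \<open>The size conditions concern only messages of positive probability. \<open>L'\<close>
  bounds all replies together, because machine 0 receives all of them; the bound on
  \<open>B * (B + 1)\<close> makes a packed pair fit into a word. The packed input takes half of the
  memory, and the other half has to hold a message together with the replies or with the
  \<open>M\<close> words of rounding.\<close>

locale coordinator_run = coordinator +
  fixes E :: "nat set set" and f :: "nat \<Rightarrow> nat" and L' :: nat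
  assumes M: "M > 0" and T: "T > 0"
    and graph: "simple_graph {..<n} E"
    and placement: "admissible_placement algorithm {..<n} E f"
    and length_draw: "\<And>t b. t < T \<Longrightarrow> b \<in> set_pmf (messages E (Suc t)) \<Longrightarrow> length b = L"
    and n_le: "n \<le> B" and B_le: "B * (B + 1) \<le> 2 ^ w"
    and word_draw: "\<And>t b a. t < T \<Longrightarrow> b \<in> set_pmf (messages E (Suc t)) \<Longrightarrow> a \<in> set b \<Longrightarrow> a < 2 ^ w"
    and word_reply: "\<And>t b v a. t < T \<Longrightarrow> b \<in> set_pmf (messages E (Suc t)) \<Longrightarrow> v < n \<Longrightarrow>
      a \<in> set (node_reply t b v (neighbours E v)) \<Longrightarrow> a < 2 ^ w"
    and length_reply: "\<And>t b. t < T \<Longrightarrow> b \<in> set_pmf (messages E (Suc t)) \<Longrightarrow>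
      (\<Sum>v<n. 2 + length (node_reply t b v (neighbours E v))) \<le> L'"
    and L'_word: "L' < 2 ^ w"
    and result_word: "\<And>b v. b \<in> set_pmf (messages E T) \<Longrightarrow> v < n \<Longrightarrow> result b (answers E T b) v < 2 ^ w"
    and memory: "(S + 1) div 2 + L + L' \<le> S" "(S + 1) div 2 + L + M \<le> S" "2 * n \<le> S"
begin

definition nodes :: "nat \<Rightarrow> nat list" where
  "nodes i = sorted_list_of_set {v \<in> {..<n}. f v = i}"

definition inp :: "nat \<Rightarrow> nat list" where
  "inp i = concat (map (encode_node E) (nodes i))"

definition packed :: "nat \<Rightarrow> nat list" where
  "packed i = pack B (inp i)"

lemma set_nodes: "set (nodes i) = {v. v < n \<and> f v = i}" and distinct_nodes: "distinct (nodes i)"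
  by (auto simp: nodes_def)

lemma nbrs: "neighbours E v \<subseteq> {..<n}"
  using graph by (auto simp: neighbours_def simple_graph_def node_pairs_def)

lemma finite_nbrs: "finite (neighbours E v)"
  using nbrs finite_subset by blast

lemma inp_serialize: "inp i = serialize (map (\<lambda>v. (v, sorted_list_of_set (neighbours E v))) (nodes i))"
  unfolding inp_def serialize_def encode_node_def by (simp add: o_def)

lemma reply_inp: "reply t (inp i) b = serialize (map (\<lambda>v. (v, node_reply t b v (neighbours E v))) (nodes i))"
  unfolding reply_def inp_serialize parse_serialize by (simp add: o_def finite_nbrs)

lemma inp_less: "\<forall>x\<in>set (inp i). x < B"
proof -
  have "card (neighbours E v) < n" if "v < n" for v
  proof -
    have "v \<notin> neighbours E v"
      using graph by (auto simp: neighbours_def simple_graph_def node_pairs_def)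
    then have "neighbours E v \<subset> {..<n}" using nbrs that by blast
    from psubset_card_mono[OF _ this] show ?thesis by simp
  qed
  then show ?thesis using nbrs n_le finite_nbrs set_nodes
    by (fastforce simp: inp_def encode_node_def)
qed

lemma unpack_packed: "unpack B (packed i) = inp i"
  unfolding packed_def by (rule unpack_pack[OF inp_less])

lemma length_packed: "i < M \<Longrightarrow> length (packed i) \<le> (S + 1) div 2"
  using placement unfolding packed_def length_pack admissible_placement_def
  by (auto simp: words_used_def input_config_def inp_def nodes_def intro!: div_le_mono)

lemma packed_less: "a \<in> set (packed i) \<Longrightarrow> a < 2 ^ w"
  unfolding packed_def using pack_less[OF inp_less] B_le by (meson less_le_trans)

lemma input_config_eq: "input_config {..<n} E f = (\<lambda>i. (inp i, \<lambda>_. []))"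
  by (simp add: input_config_def inp_def nodes_def)

text \<open>The configurations before the rounds \<open>3 * t\<close>, \<open>3 * t + 1\<close> and \<open>3 * t + 2\<close>.\<close>

definition conf0 :: "nat \<Rightarrow> nat list \<Rightarrow> mpc_config" where
  "conf0 t b = (if t = 0 then input_config {..<n} E f
     else (\<lambda>i. (if i < M then packed i @ b else [],
       \<lambda>j. if i = 0 \<and> j < M then reply (t - 1) (inp j) b else [])))"

definition conf1 :: "nat list \<Rightarrow> mpc_config" where
  "conf1 b = (\<lambda>i. (if i < M then packed i else [], \<lambda>j. if i < M \<and> j = 0 then part i b else []))"

definition conf2 :: "nat list \<Rightarrow> mpc_config" where
  "conf2 b = (\<lambda>i. (if i < M then packed i else [], \<lambda>j. if i < M \<and> j < M then part j b else []))"

text \<open>Looking replies up by node makes what machine 0 learns independent of the placement, as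
  long as every node lies on some machine.\<close>

lemma gather_conf0: "gather (snd (conf0 t b 0)) = answers E t b"
proof (cases "t = 0")
  case True
  have "concat (map (\<lambda>j. parse []) [0..<M]) = []" by simp
  then have "gather (\<lambda>_. []) v = []" for v unfolding gather_def by (simp only: map_of.simps option.case)
  with True show ?thesis by (simp add: fun_eq_iff answers_def conf0_def input_config_eq)
next
  case False
  let ?r = "\<lambda>v. (v, node_reply (t - 1) b v (neighbours E v))"
  let ?ns = "concat (map nodes [0..<M])"
  have "map (\<lambda>j. parse (snd (conf0 t b 0) j)) [0..<M] = map (\<lambda>j. map ?r (nodes j)) [0..<M]"
    using False by (intro map_cong) (auto simp: conf0_def reply_inp parse_serialize)
  then have eq: "concat (map (\<lambda>j. parse (snd (conf0 t b 0) j)) [0..<M]) = map ?r ?ns"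
    by (simp only: map_concat map_map o_def)
  have ns: "set ?ns = {..<n}"
    using placement by (auto simp: set_nodes admissible_placement_def)
  have "map_of (map ?r xs) v = (if v \<in> set xs then Some (snd (?r v)) else None)" for xs v
    by (induction xs) auto
  then show ?thesis unfolding gather_def eq using ns False
    by (auto simp: fun_eq_iff answers_def simp del: set_concat)
qed

section \<open>Exact law of the configurations, round by round\<close>

lemma stored_conf0:
  assumes "i < M" "t > 0 \<Longrightarrow> length b = L"
  shows "stored (3 * t) (fst (conf0 t b i)) = packed i"
  using assms by (auto simp: stored_def conf0_def input_config_eq packed_def)

lemma last_message_conf0:
  assumes "t > 0 \<Longrightarrow> length b = L" "t = 0 \<Longrightarrow> b = []"
  shows "last_message (3 * t) (fst (conf0 t b 0)) = b"
  using assms M by (auto simp: last_message_def conf0_def)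

lemma round0:
  assumes "t > 0 \<Longrightarrow> length b = L" "t = 0 \<Longrightarrow> b = []"
  shows "mpc_round algorithm (3 * t) (conf0 t b) = map_pmf conf1 (draw t b (answers E t b))"
proof -
  let ?h = "\<lambda>i. (packed i, \<lambda>_. []) :: mpc_memory"
  let ?g = "\<lambda>b'. (packed 0, \<lambda>j. if j < M then part j b' else []) :: mpc_memory"
  have s0: "step (3 * t) 0 (conf0 t b 0) = map_pmf ?g (draw t b (answers E t b))"
    using assms M by (simp add: step_def stored_conf0 last_message_conf0 gather_conf0)
  have si: "step (3 * t) i (conf0 t b i) = return_pmf (?h i)" if "i \<in> {..<M} - {0}" for i
    using assms that by (simp add: step_def stored_conf0)
  have "mpc_round algorithm (3 * t) (conf0 t b)
      = map_pmf deliver (map_pmf (\<lambda>y i. if i = 0 then y else if i \<in> {..<M} then ?h i else ([], \<lambda>_. []))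
          (step (3 * t) 0 (conf0 t b 0)))"
    unfolding mpc_round_def algorithm_simps
    by (subst Pi_pmf_single_random[where x=0 and h="?h"]) (use M si in auto)
  also have "\<dots> = map_pmf conf1 (draw t b (answers E t b))"
    unfolding s0 pmf.map_comp
    using M by (intro map_pmf_cong refl) (auto simp: deliver_def conf1_def fun_eq_iff)
  finally show ?thesis .
qed

lemma round1: "mpc_round algorithm (3 * t + 1) (conf1 b) = return_pmf (conf2 b)"
proof -
  have s: "step (3 * t + 1) i (conf1 b i) = return_pmf (packed i, \<lambda>j. if j < M then part i b else [])"
    if "i < M" for i using that by (simp add: step_def conf1_def fun_eq_iff)
  have "Pi_pmf {..<M} ([], \<lambda>_. []) (\<lambda>i. step (3 * t + 1) i (conf1 b i))
      = Pi_pmf {..<M} ([], \<lambda>_. []) (\<lambda>i. return_pmf (packed i, \<lambda>j. if j < M then part i b else []))"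
    using s by (intro Pi_pmf_cong) auto
  then show ?thesis
    by (auto simp: mpc_round_def Pi_pmf_return_pmf deliver_def conf2_def fun_eq_iff)
qed

lemma step_conf2:
  assumes "length b = L" "i < M"
  shows "step (3 * t + 2) i (conf2 b i)
    = return_pmf (packed i @ b, \<lambda>j. if j = 0 then reply t (inp i) b else [])"
proof -
  have r: "(3 * t + 2) mod 3 = 2" "(3 * t + 2) div 3 = t" by presburger+
  have "concat (map (snd (conf2 b i)) [0..<M]) = concat (map (\<lambda>j. part j b) [0..<M])"
    using assms by (intro arg_cong[where f=concat] map_cong) (auto simp: conf2_def)
  then have "concat (map (snd (conf2 b i)) [0..<M]) = b" using concat_parts[OF assms(1) M] by simp
  moreover have "fst (conf2 b i) = packed i" using assms by (simp add: conf2_def)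
  ultimately show ?thesis unfolding step_def r by (simp add: unpack_packed Let_def fun_eq_iff)
qed

lemma round2:
  assumes "length b = L"
  shows "mpc_round algorithm (3 * t + 2) (conf2 b) = return_pmf (conf0 (Suc t) b)"
proof -
  have "Pi_pmf {..<M} ([], \<lambda>_. []) (\<lambda>i. step (3 * t + 2) i (conf2 b i))
      = Pi_pmf {..<M} ([], \<lambda>_. []) (\<lambda>i. return_pmf (packed i @ b, \<lambda>j. if j = 0 then reply t (inp i) b else []))"
    using step_conf2[OF assms] by (intro Pi_pmf_cong) auto
  then show ?thesis
    using M by (auto simp: mpc_round_def Pi_pmf_return_pmf deliver_def conf0_def fun_eq_iff)
qed

lemma length_messages:
  assumes "t \<le> T" "b \<in> set_pmf (messages E t)"
  shows "t > 0 \<Longrightarrow> length b = L" "t = 0 \<Longrightarrow> b = []"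
  using assms length_draw[of "t - 1" b] by (cases t; auto)+

lemma output_conf0:
  assumes "b \<in> set_pmf (messages E T)"
  shows "local_output algorithm 0 (conf0 T b 0) = map (\<lambda>v. (v, result b (answers E T b) v)) [0..<n]"
proof -
  have "last_message 1 (fst (conf0 T b 0)) = b"
    using length_messages(1)[OF order.refl assms T] T M by (simp add: last_message_def conf0_def)
  then show ?thesis by (simp add: algorithm_def gather_conf0)
qed

text \<open>In a phase only the draw is random, so the law of each configuration is the image of the
  law of the last message under a deterministic map.\<close>

lemma mpc_run_phase:
  assumes "t \<le> T"
  shows "mpc_run algorithm (input_config {..<n} E f) (3 * t) = map_pmf (conf0 t) (messages E t)"
    and "t < T \<Longrightarrow> mpc_run algorithm (input_config {..<n} E f) (3 * t + 1) = map_pmf conf1 (messages E (Suc t))"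
    and "t < T \<Longrightarrow> mpc_run algorithm (input_config {..<n} E f) (3 * t + 2) = map_pmf conf2 (messages E (Suc t))"
proof -
  let ?run = "mpc_run algorithm (input_config {..<n} E f)"
  have 1: "?run (3 * t + 1) = map_pmf conf1 (messages E (Suc t))"
    if "t < T" "?run (3 * t) = map_pmf (conf0 t) (messages E t)" for t
  proof -
    have "?run (3 * t + 1) = messages E t \<bind> (\<lambda>b. mpc_round algorithm (3 * t) (conf0 t b))"
      using that(2) by (simp add: bind_map_pmf)
    also have "\<dots> = messages E t \<bind> (\<lambda>b. map_pmf conf1 (draw t b (answers E t b)))"
      using that(1) length_messages[of t] by (intro bind_pmf_cong refl round0) auto
    finally show ?thesis by (simp add: map_bind_pmf)
  qed
  have 2: "?run (3 * t + 2) = map_pmf conf2 (messages E (Suc t))"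
    if "?run (3 * t + 1) = map_pmf conf1 (messages E (Suc t))" for t
  proof -
    have "?run (Suc (3 * t + 1)) = messages E (Suc t) \<bind> (\<lambda>b. mpc_round algorithm (3 * t + 1) (conf1 b))"
      unfolding mpc_run.simps(2) that bind_map_pmf ..
    then show ?thesis unfolding round1 by (simp add: map_pmf_def)
  qed
  have 3: "?run (3 * Suc t) = map_pmf (conf0 (Suc t)) (messages E (Suc t))"
    if "t < T" "?run (3 * t + 2) = map_pmf conf2 (messages E (Suc t))" for t
  proof -
    have "?run (Suc (3 * t + 2)) = messages E (Suc t) \<bind> (\<lambda>b. mpc_round algorithm (3 * t + 2) (conf2 b))"
      unfolding mpc_run.simps(2) that(2) bind_map_pmf ..
    also have "\<dots> = messages E (Suc t) \<bind> (\<lambda>b. return_pmf (conf0 (Suc t) b))"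
      using that(1) length_messages(1)[of "Suc t"] by (intro bind_pmf_cong refl round2) auto
    also have "Suc (3 * t + 2) = 3 * Suc t" by simp
    finally show ?thesis unfolding map_pmf_def .
  qed
  show 0: "?run (3 * t) = map_pmf (conf0 t) (messages E t)"
    using assms
  proof (induction t)
    case 0
    then show ?case by (simp add: conf0_def)
  next
    case (Suc t)
    then show ?case using 1[of t] 2[of t] 3[of t] by simp
  qed
  show "?run (3 * t + 1) = map_pmf conf1 (messages E (Suc t))" if "t < T" using 1[OF that 0] .
  show "?run (3 * t + 2) = map_pmf conf2 (messages E (Suc t))" if "t < T" using 2[OF 1[OF that 0]] .
qed

section \<open>Memory bounds at every point of a round\<close>

lemma sum_length_parts:
  assumes "length b = L"
  shows "(\<Sum>j<M. length (part j b)) = L"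
proof -
  have "(\<Sum>j<M. length (part j b)) = length (concat (map (\<lambda>j. part j b) [0..<M]))"
    by (simp add: length_concat o_def sum_list_sum_nth atLeast0LessThan)
  then show ?thesis using concat_parts[OF assms M] assms by simp
qed

lemma length_part: "length (part j b) \<le> chunk"
  by (simp add: part_def)

lemma chunk_le: "M * chunk \<le> L + M"
  by (simp add: chunk_def algebra_simps)

lemma set_part: "set (part j b) \<subseteq> set b"
  unfolding part_def by (meson order.trans set_drop_subset set_take_subset)

lemma length_reply_inp:
  "length (reply t (inp i) b) = (\<Sum>v | v < n \<and> f v = i. 2 + length (node_reply t b v (neighbours E v)))"
  using sum_list_distinct_conv_sum_set[OF distinct_nodes, of "\<lambda>v. 2 + length (node_reply t b v (neighbours E v))" i]
  by (simp add: reply_inp serialize_def length_concat o_def set_nodes)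

lemma sum_length_reply:
  assumes "t < T" "b \<in> set_pmf (messages E (Suc t))"
  shows "(\<Sum>i<M. length (reply t (inp i) b)) \<le> L'"
proof -
  have "(\<Sum>i<M. length (reply t (inp i) b)) = (\<Sum>i<M. \<Sum>v\<in>{v\<in>{..<n}. f v = i}. 2 + length (node_reply t b v (neighbours E v)))"
    unfolding length_reply_inp by (simp add: lessThan_def)
  also have "\<dots> = (\<Sum>v<n. 2 + length (node_reply t b v (neighbours E v)))"
    using placement by (intro sum.group) (auto simp: admissible_placement_def)
  finally show ?thesis using length_reply[OF assms] by simp
qed

lemma length_one_reply:
  assumes "t < T" "b \<in> set_pmf (messages E (Suc t))" "i < M"
  shows "length (reply t (inp i) b) \<le> L'"
  using sum_length_reply[OF assms(1,2)] member_le_sum[of i "{..<M}" "\<lambda>i. length (reply t (inp i) b)"] assms(3)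
  by simp

lemma reply_words:
  assumes "t < T" "b \<in> set_pmf (messages E (Suc t))" "a \<in> set (reply t (inp i) b)"
  shows "a < 2 ^ w"
proof -
  obtain v where v: "v < n" and "a = v \<or> a = length (node_reply t b v (neighbours E v))
      \<or> a \<in> set (node_reply t b v (neighbours E v))"
    using assms(3) by (auto simp: reply_inp serialize_def set_nodes)
  moreover have "v < 2 ^ w"
  proof -
    have "v < B" using v n_le by simp
    also have "B \<le> B * (B + 1)" by simp
    finally show ?thesis using B_le by simp
  qed
  moreover have "length (node_reply t b v (neighbours E v)) < 2 ^ w"
  proof -
    have "2 + length (node_reply t b v (neighbours E v)) \<le> L'"
      using length_reply[OF assms(1,2)] v
        member_le_sum[of v "{..<n}" "\<lambda>v. 2 + length (node_reply t b v (neighbours E v))"] by simp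
    then show ?thesis using L'_word by simp
  qed
  ultimately show ?thesis using word_reply[OF assms(1,2) v] by auto
qed

lemma memory_conf0:
  assumes "t \<le> T" "b \<in> set_pmf (messages E t)" "i < M"
  shows "memory_ok algorithm (conf0 t b i)"
proof (cases t)
  case 0
  have "a < 2 ^ w" if "a \<in> set (inp i)" for a
  proof -
    have "a < B" using inp_less that by blast
    also have "B \<le> B * (B + 1)" by simp
    finally show ?thesis using B_le by simp
  qed
  then show ?thesis using placement assms(3) 0
    by (auto simp: memory_ok_def conf0_def admissible_placement_def is_word_def input_config_eq)
next
  case (Suc u)
  then have b: "length b = L" "u < T" "b \<in> set_pmf (messages E (Suc u))"
    using assms length_messages by auto
  have "(\<Sum>j<M. length (snd (conf0 t b i) j)) \<le> L'"
    using sum_length_reply[OF b(2,3)] Suc by (cases "i = 0") (auto simp: conf0_def)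
  then have "words_used algorithm (conf0 t b i) \<le> S"
    using length_packed[OF assms(3)] memory(1) b Suc assms(3) by (simp add: words_used_def conf0_def)
  moreover have "a < 2 ^ w" if "a \<in> set (fst (conf0 t b i))" for a
    using that packed_less word_draw[OF b(2,3)] Suc by (auto simp: conf0_def split: if_splits)
  moreover have "a < 2 ^ w" if "a \<in> set (snd (conf0 t b i) j)" for a j
    using that reply_words[OF b(2,3)] Suc by (auto simp: conf0_def split: if_splits)
  ultimately show ?thesis by (auto simp: memory_ok_def is_word_def)
qed

lemma memory_chunks:
  assumes "t < T" "b \<in> set_pmf (messages E (Suc t))" "i < M"
    and "\<And>j. set (out j) \<subseteq> set b" "(\<Sum>j<M. length (out j)) \<le> L + M"
  shows "memory_ok algorithm (packed i, out)"
proof -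
  have "words_used algorithm (packed i, out) \<le> S"
    using length_packed[OF assms(3)] memory(2) assms(5) by (simp add: words_used_def)
  then show ?thesis
    using packed_less word_draw[OF assms(1,2)] assms(4) by (fastforce simp: memory_ok_def is_word_def)
qed

lemma memory_reply:
  assumes "t < T" "b \<in> set_pmf (messages E (Suc t))" "i < M"
  shows "memory_ok algorithm (packed i @ b, \<lambda>j. if j = 0 then reply t (inp i) b else [])"
proof -
  have "(\<Sum>j<M. length (if j = 0 then reply t (inp i) b else [])) = length (reply t (inp i) b)"
    using M by (simp add: if_distrib[of length] sum.delta cong: if_cong)
  then have "words_used algorithm (packed i @ b, \<lambda>j. if j = 0 then reply t (inp i) b else []) \<le> S"
    using length_packed[OF assms(3)] memory(1) length_one_reply[OF assms] length_draw[OF assms(1,2)]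
    by (simp add: words_used_def)
  then show ?thesis
    using packed_less word_draw[OF assms(1,2)] reply_words[OF assms(1,2)]
    by (auto simp: memory_ok_def is_word_def split: if_splits)
qed

lemma part_sum_le:
  assumes "i < M"
  shows "(\<Sum>j<M. length (if j = 0 then part i b else [])) \<le> L + M"
    and "(\<Sum>j<M. length (if j < M then part i b else [])) \<le> L + M"
proof -
  have c: "M * length (part i b) \<le> L + M"
    using mult_le_mono2[OF length_part] chunk_le by (rule order.trans)
  then show "(\<Sum>j<M. length (if j < M then part i b else [])) \<le> L + M" by simp
  have "length (part i b) \<le> L + M" using c M by (cases M) auto
  then show "(\<Sum>j<M. length (if j = 0 then part i b else [])) \<le> L + M"
    using M by (simp add: if_distrib[of length] sum.delta cong: if_cong)
qed

lemma parts_sum_le: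
  assumes "length b = L"
  shows "(\<Sum>j<M. length (if j < M then part j b else [])) \<le> L + M"
  using sum_length_parts[OF assms] by simp

theorem respects_memory_algorithm: "respects_memory algorithm (input_config {..<n} E f)"
proof -
  let ?run = "mpc_run algorithm (input_config {..<n} E f)"
  have cases3: "\<exists>t. r = 3 * t \<or> r = 3 * t + 1 \<or> r = 3 * t + 2" for r :: nat by presburger
  have conf: "memory_ok algorithm (c i)" if r: "r \<le> 3 * T" "c \<in> set_pmf (?run r)" "i < M" for r c i
  proof -
    obtain t where "r = 3 * t \<or> r = 3 * t + 1 \<or> r = 3 * t + 2" using cases3 by blast
    then consider "r = 3 * t" "t \<le> T" | "r = 3 * t + 1" "t < T" | "r = 3 * t + 2" "t < T"
      using r(1) by fastforce
    then show ?thesis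
    proof cases
      case 1
      then show ?thesis using r memory_conf0 mpc_run_phase(1)[of t] by auto
    next
      case 2
      then obtain b where b: "b \<in> set_pmf (messages E (Suc t))" "c = conf1 b"
        using r(2) unfolding 2(1) mpc_run_phase(2)[OF less_imp_le[OF 2(2)] 2(2)] set_map_pmf by blast
      have "memory_ok algorithm (packed i, \<lambda>j. if j = 0 then part i b else [])"
        using set_part[of i b] by (intro memory_chunks[OF 2(2) b(1) r(3)] part_sum_le(1)[OF r(3)]) auto
      then show ?thesis using r(3) by (simp add: b conf1_def)
    next
      case 3
      then obtain b where b: "b \<in> set_pmf (messages E (Suc t))" "c = conf2 b"
        using r(2) unfolding 3(1) mpc_run_phase(3)[OF less_imp_le[OF 3(2)] 3(2)] set_map_pmf by blast
      have "memory_ok algorithm (packed i, \<lambda>j. if j < M then part j b else [])"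
        using set_part[of _ b]
        by (intro memory_chunks[OF 3(2) b(1) r(3)] parts_sum_le[OF length_draw[OF 3(2) b(1)]]) auto
      then show ?thesis using r(3) by (simp add: b conf2_def)
    qed
  qed
  have step: "memory_ok algorithm x"
    if r: "r < 3 * T" "c \<in> set_pmf (?run r)" "i < M" "x \<in> set_pmf (step r i (c i))" for r c i x
  proof -
    obtain t where "r = 3 * t \<or> r = 3 * t + 1 \<or> r = 3 * t + 2" using cases3 by blast
    then consider "r = 3 * t" "t < T" | "r = 3 * t + 1" "t < T" | "r = 3 * t + 2" "t < T"
      using r(1) by fastforce
    then show ?thesis
    proof cases
      case 1
      then obtain b where b: "b \<in> set_pmf (messages E t)" "c = conf0 t b"
        using r mpc_run_phase(1)[of t] by auto
      have l: "t > 0 \<Longrightarrow> length b = L" "t = 0 \<Longrightarrow> b = []" using length_messages[of t b] 1 b by auto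
      show ?thesis
      proof (cases "i = 0")
        case True
        then obtain b' where b': "b' \<in> set_pmf (draw t b (answers E t b))"
            and x: "x = (packed 0, \<lambda>j. if j < M then part j b' else [])"
          using r(4) 1 l M by (auto simp: b step_def stored_conf0 last_message_conf0 gather_conf0)
        have m: "b' \<in> set_pmf (messages E (Suc t))" using b b' by auto
        show ?thesis unfolding x using set_part[of _ b']
          by (intro memory_chunks[OF 1(2) m M] parts_sum_le[OF length_draw[OF 1(2) m]]) auto
      next
        case False
        then have x: "x = (packed i, \<lambda>_. [])"
          using r 1 l by (simp add: b step_def stored_conf0)
        \<comment> \<open>The outbox is empty; an arbitrary possible message serves to instantiate
          \<open>memory_chunks\<close>.\<close>
        obtain b' where "b' \<in> set_pmf (messages E (Suc t))" using set_pmf_not_empty by fast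
        then show ?thesis unfolding x using memory_chunks[OF 1(2) _ r(3), of b' "\<lambda>_. []"] by simp
      qed
    next
      case 2
      then obtain b where b: "b \<in> set_pmf (messages E (Suc t))" "c = conf1 b"
        using r(2) unfolding 2(1) mpc_run_phase(2)[OF less_imp_le[OF 2(2)] 2(2)] set_map_pmf by blast
      have "x = (packed i, \<lambda>j. if j < M then part i b else [])"
        using r 2 by (simp add: b step_def conf1_def fun_eq_iff)
      moreover have "memory_ok algorithm (packed i, \<lambda>j. if j < M then part i b else [])"
        using set_part[of i b] by (intro memory_chunks[OF 2(2) b(1) r(3)] part_sum_le(2)[OF r(3)]) auto
      ultimately show ?thesis by simp
    next
      case 3
      then obtain b where b: "b \<in> set_pmf (messages E (Suc t))" "c = conf2 b"
        using r(2) unfolding 3(1) mpc_run_phase(3)[OF less_imp_le[OF 3(2)] 3(2)] set_map_pmf by blast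
      have "x = (packed i @ b, \<lambda>j. if j = 0 then reply t (inp i) b else [])"
        using r 3 step_conf2[OF length_draw[OF 3(2) b(1)] r(3)] by (simp add: b)
      then show ?thesis using memory_reply[OF 3(2) b(1) r(3)] by simp
    qed
  qed
  have out: "output_ok algorithm (local_output algorithm i (c i))"
    if c: "c \<in> set_pmf (?run (3 * T))" "i < M" for c i
  proof (cases "i = 0")
    case True
    obtain b where b: "b \<in> set_pmf (messages E T)" "c = conf0 T b"
      using c mpc_run_phase(1)[of T] by auto
    have "v < 2 ^ w" if "v < n" for v
    proof -
      have "v < B" using that n_le by simp
      also have "B \<le> B * (B + 1)" by simp
      finally show ?thesis using B_le by simp
    qed
    then show ?thesis
      using True result_word[OF b(1)] memory(3) output_conf0[OF b(1)]
      by (auto simp: output_ok_def is_word_def b)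
  qed (simp add: output_ok_def algorithm_def)
  show ?thesis unfolding respects_memory_def algorithm_simps using conf step out by blast
qed

theorem mpc_clustering_algorithm:
  "mpc_clustering algorithm (input_config {..<n} E f)
    = map_pmf (\<lambda>b. label_clusters {..<n} (result b (answers E T b))) (messages E T)"
proof -
  have "output_clusters algorithm (conf0 T b) = label_clusters {..<n} (result b (answers E T b))"
    if "b \<in> set_pmf (messages E T)" for b
  proof -
    let ?L = "\<Union>i<M. set (local_output algorithm i (conf0 T b i))"
    have "?L = set (local_output algorithm 0 (conf0 T b 0))"
      using M by (auto simp: algorithm_def split: if_splits)
    then have "?L = (\<lambda>v. (v, result b (answers E T b) v)) ` {..<n}"
      using output_conf0[OF that] by (simp add: atLeast0LessThan)
    moreover from this have "Range ?L = result b (answers E T b) ` {..<n}" by auto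
    ultimately show ?thesis
      unfolding output_clusters_def label_clusters_def Let_def algorithm_simps
      by (intro image_cong) auto
  qed
  then show ?thesis
    unfolding mpc_clustering_def algorithm_simps mpc_run_phase(1)[OF order.refl] pmf.map_comp
    by (intro map_pmf_cong) auto
qed

end

subsection \<open>The clustering protocol\<close>

lemma refine_cong:
  assumes "\<And>v. v \<in> V \<Longrightarrow> g v = g' v" and "\<And>u w. (u, w) \<in># M \<Longrightarrow> u \<in> V \<and> w \<in> V"
  shows "refine V g d s M = refine V g' d s M"
  unfolding refine_def by (intro arg_cong2[where f=arg_min_on] ext estimate_cong assms refl)

text \<open>Replies arrive grouped by node, whereas samples are drawn in the order of
  \<open>k\<close>. Only the multiset is preserved, which is why \<open>estimate\<close> works with
  multisets.\<close>

lemma mset_concat_by_key: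
  "mset (concat (map (\<lambda>v. map (h v) (filter (\<lambda>k. c k = v) ks)) [0..<n]))
    = mset (map (\<lambda>k. h (c k) k) (filter (\<lambda>k. c k < (n :: nat)) ks))"
proof (induction n)
  case (Suc n)
  have "mset (map (\<lambda>k. h (c k) k) (filter (\<lambda>k. c k < Suc n) ks))
      = mset (map (\<lambda>k. h (c k) k) (filter (\<lambda>k. c k < n) ks)) + mset (map (h n) (filter (\<lambda>k. c k = n) ks))"
    by (induction ks) auto
  with Suc show ?case by simp
qed simp

lemma truncated_pivot_in:
  "v \<in> A \<Longrightarrow> truncated_pivot nb xs A {} v \<in> A"
  using truncated_pivot_inside[of v A "{}"] by simp

text \<open>
  The messages of the three phases are: \<open>K\<close> random orders of the nodes; the \<open>K\<close> labellings that truncated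
  pivot computes from them; the best labelling together with \<open>s\<close> uniformly random slots \<open>(v, i)\<close> and the
  number of slots, where a slot stands for the \<open>i\<close>-th node on which \<open>v\<close> and the labelling disagree.
  The replies of a node are: its first two neighbours in each order; its number of disagreements with
  each labelling; the nodes in the sampled slots that belong to it. The number \<open>n\<close> is not a node and
  serves as padding.
\<close>

locale cc_protocol =
  fixes n K s :: nat
begin

text \<open>One length for all messages, since receivers split them off by length:
  \<open>K * n\<close> covers the first two, \<open>n + 2 * s + 1\<close> the third.\<close>

definition len :: nat where
  "len = K * n + n + 2 * s + 1"

definition pad :: "nat list \<Rightarrow> nat list" where
  "pad xs = xs @ replicate (len - length xs) 0"

definition block :: "nat \<Rightarrow> nat list \<Rightarrow> nat list" where
  "block j b = take n (drop (j * n) b)"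

text \<open>The errors of \<open>g\<close> at \<open>v\<close>, computed from the neighbourhood
  \<open>N\<close> of \<open>v\<close> alone, as the machine holding \<open>v\<close> can
  do.\<close>

definition row :: "(nat \<Rightarrow> nat) \<Rightarrow> nat set \<Rightarrow> nat \<Rightarrow> nat set" where
  "row g N v = {w. w < n \<and> v \<noteq> w \<and> (w \<in> N \<longleftrightarrow> g v \<noteq> g w)}"

definition encode_blocks :: "(nat \<Rightarrow> nat list) \<Rightarrow> nat list" where
  "encode_blocks p = pad (concat (map p [0..<K]))"

text \<open>Uniform slots amount to uniform ordered error pairs, although machine 0 knows only the
  counts \<open>d v\<close>. The value \<open>(n, 0)\<close> belongs to no node, so nobody answers
  it.\<close>

definition samples :: "(nat \<Rightarrow> nat) \<Rightarrow> (nat \<Rightarrow> nat \<times> nat) pmf" where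
  "samples d = (if \<forall>v<n. d v = 0 then return_pmf (\<lambda>_. (n, 0))
     else Pi_pmf {..<s} (n, 0) (\<lambda>_. pmf_of_set (SIGMA v:{..<n}. {..<d v})))"

definition encode_samples :: "nat list \<Rightarrow> (nat \<Rightarrow> nat) \<Rightarrow> (nat \<Rightarrow> nat \<times> nat) \<Rightarrow> nat list" where
  "encode_samples g d y =
     pad (g @ map (fst \<circ> y) [0..<s] @ map (snd \<circ> y) [0..<s] @ [\<Sum>v<n. d v])"

definition best_index :: "(nat \<Rightarrow> nat list) \<Rightarrow> nat" where
  "best_index F = arg_min_on (\<lambda>j. real (\<Sum>v<n. F v ! j)) {..<K}"

definition draw :: "nat \<Rightarrow> nat list \<Rightarrow> (nat \<Rightarrow> nat list) \<Rightarrow> nat list pmf" where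
  "draw t b F =
    (if t = 0 then
       map_pmf encode_blocks (Pi_pmf {..<K} [] (\<lambda>_. pmf_of_set (permutations_of_set {..<n})))
     else if t = 1 then
       return_pmf (encode_blocks (\<lambda>j. map (truncated_pivot (\<lambda>v u. u \<in> set (take 2 (drop (2 * j) (F v))))
         (block j b) {..<n} {}) [0..<n]))
     else (let j = best_index F; d = (\<lambda>v. F v ! j)
       in map_pmf (encode_samples (block j b) d) (samples d)))"

text \<open>Appending \<open>[n, n]\<close> gives each order exactly two words, so those of order
  \<open>j\<close> start at offset \<open>2 * j\<close>.\<close>

definition node_reply :: "nat \<Rightarrow> nat list \<Rightarrow> nat \<Rightarrow> nat set \<Rightarrow> nat list" where
  "node_reply t b v N =
    (if t = 0 then concat (map (\<lambda>j. take 2 (filter (\<lambda>u. u \<in> N) (block j b) @ [n, n])) [0..<K])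
     else if t = 1 then map (\<lambda>j. card (row (nth (block j b)) N v)) [0..<K]
     else map (\<lambda>k. sorted_list_of_set (row (nth b) N v) ! (b ! (n + s + k)))
       (filter (\<lambda>k. b ! (n + k) = v) [0..<s]))"

definition result :: "nat list \<Rightarrow> (nat \<Rightarrow> nat list) \<Rightarrow> nat \<Rightarrow> nat" where
  "result b F = refine {..<n} (nth b) (real (b ! (n + 2 * s))) s
     (mset (concat (map (\<lambda>v. map (Pair v) (F v)) [0..<n])))"

lemma encode_blocks_cong:
  assumes "\<And>j. j < K \<Longrightarrow> p j = q j"
  shows "encode_blocks p = encode_blocks q"
proof -
  have "map p [0..<K] = map q [0..<K]" using assms by (intro map_cong) auto
  then show ?thesis unfolding encode_blocks_def by (rule arg_cong)
qed

lemma length_concat_blocks: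
  assumes "\<And>j. j < m \<Longrightarrow> length (p j) = n"
  shows "length (concat (map p [0..<m])) = m * n"
  using assms by (induction m) auto

lemma length_encode_blocks:
  assumes "\<And>j. j < K \<Longrightarrow> length (p j) = n"
  shows "length (encode_blocks p) = len"
  using length_concat_blocks[of K p] assms by (simp add: encode_blocks_def pad_def len_def)

lemma block_concat:
  assumes "\<And>j. j < m \<Longrightarrow> length (p j) = n" "j < m"
  shows "block j (concat (map p [0..<m]) @ zs) = p j"
  using assms
proof (induction m arbitrary: zs)
  case (Suc m)
  show ?case
  proof (cases "j = m")
    case True
    then show ?thesis using Suc.prems length_concat_blocks[of m p] by (simp add: block_def)
  next
    case False
    then show ?thesis using Suc.IH[of "p m @ zs"] Suc.prems by simp
  qed
qed simp

lemma block_encode_blocks: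
  assumes "\<And>j. j < K \<Longrightarrow> length (p j) = n" "j < K"
  shows "block j (encode_blocks p) = p j"
  unfolding encode_blocks_def pad_def using assms by (rule block_concat)

lemma set_encode_blocks: "set (encode_blocks p) \<subseteq> (\<Union>j<K. set (p j)) \<union> {0}"
  by (auto simp: encode_blocks_def pad_def)

lemma encode_samples_nth:
  assumes "length g = n"
  shows "v < n \<Longrightarrow> encode_samples g d y ! v = g ! v"
    and "k < s \<Longrightarrow> encode_samples g d y ! (n + k) = fst (y k)"
    and "k < s \<Longrightarrow> encode_samples g d y ! (n + s + k) = snd (y k)"
    and "encode_samples g d y ! (n + 2 * s) = (\<Sum>v<n. d v)"
  using assms by (auto simp: encode_samples_def pad_def nth_append)

lemma length_encode_samples: "length g = n \<Longrightarrow> length (encode_samples g d y) = len"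
  by (simp add: encode_samples_def pad_def len_def)

lemma set_encode_samples:
  "set (encode_samples g d y) \<subseteq> set g \<union> (fst \<circ> y) ` {..<s} \<union> (snd \<circ> y) ` {..<s} \<union> {\<Sum>v<n. d v, 0}"
  by (auto simp: encode_samples_def pad_def)

end

locale cc_run = cc_protocol +
  fixes E :: "nat set set"
  assumes graph: "simple_graph {..<n} E" and K: "K > 0"
begin

abbreviation adj :: "nat \<Rightarrow> nat \<Rightarrow> bool" where
  "adj \<equiv> \<lambda>u w. {u, w} \<in> E"

sublocale G: finite_graph "{..<n}" adj
proof
  show "\<not> {u, u} \<in> E" for u using graph by (auto simp: simple_graph_def node_pairs_def)
qed (auto simp: insert_commute)

abbreviation answers :: "nat \<Rightarrow> nat list \<Rightarrow> nat \<Rightarrow> nat list" where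
  "answers \<equiv> coordinator.answers n node_reply E"

abbreviation messages :: "nat \<Rightarrow> nat list pmf" where
  "messages \<equiv> coordinator.messages n draw node_reply E"

definition pivot :: "(nat \<Rightarrow> nat list) \<Rightarrow> nat \<Rightarrow> nat \<Rightarrow> nat" where
  "pivot p j = truncated_pivot adj (p j) {..<n} {}"

abbreviation degree :: "(nat \<Rightarrow> nat) \<Rightarrow> nat \<Rightarrow> nat" where
  "degree g v \<equiv> card (row g (neighbours E v) v)"

lemma row_eq: "row g (neighbours E v) v = {w. w < n \<and> mismatch adj g v w}"
  by (auto simp: row_def mismatch_def neighbours_def insert_commute)

lemma row_cong: "(\<And>w. w < n \<Longrightarrow> g w = g' w) \<Longrightarrow> v < n \<Longrightarrow> row g N v = row g' N v"
  by (auto simp: row_def)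

lemma finite_row: "finite (row g N v)"
  by (rule finite_subset[of _ "{..<n}"]) (auto simp: row_def)

lemma card_row: "card (row g N v) \<le> n"
  using card_mono[of "{..<n}" "row g N v"] by (auto simp: row_def)

lemma mismatches_Sigma: "G.mismatches g = (SIGMA v:{..<n}. row g (neighbours E v) v)"
  by (auto simp: G.mismatches_def row_eq)

lemma sum_degree: "real (\<Sum>v<n. degree g v) = disagreement adj {..<n} g"
  unfolding G.disagreement_eq_card mismatches_Sigma using finite_row by simp

lemma orders_support:
  assumes "p \<in> set_pmf (G.orders_pmf K)" "j < K"
  shows "set (p j) = {..<n}" "distinct (p j)" "length (p j) = n"
proof -
  have "p j \<in> permutations_of_set {..<n}"
    using assms G.set_random_order by (auto simp: G.orders_pmf_def set_Pi_pmf PiE_dflt_def)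
  then show "set (p j) = {..<n}" "distinct (p j)" by (auto simp: permutations_of_set_def)
  then show "length (p j) = n" using distinct_card[of "p j"] by simp
qed

lemma messages_1: "messages 1 = map_pmf encode_blocks (G.orders_pmf K)"
  by (simp add: coordinator.messages.simps draw_def bind_return_pmf G.orders_pmf_def)

lemma pivot_in: "v < n \<Longrightarrow> pivot p j v < n"
  unfolding pivot_def using truncated_pivot_in[of v "{..<n}"] by auto

lemma draw_1:
  assumes "p \<in> set_pmf (G.orders_pmf K)"
  shows "draw 1 (encode_blocks p) (answers 1 (encode_blocks p))
    = return_pmf (encode_blocks (\<lambda>j. map (pivot p j) [0..<n]))"
proof -
  let ?b = "encode_blocks p"
  let ?F = "answers 1 ?b"
  have p: "set (p j) = {..<n}" "distinct (p j)" "length (p j) = n" "block j ?b = p j" if "j < K" for j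
    using orders_support[OF assms] block_encode_blocks[of p] that by auto
  have F: "take 2 (drop (2 * j) (?F v)) = take 2 (filter (\<lambda>u. u \<in> neighbours E v) (p j) @ [n, n])"
    if "j < K" "v < n" for j v
  proof -
    let ?q = "\<lambda>j. take 2 (filter (\<lambda>u. u \<in> neighbours E v) (block j ?b) @ [n, n])"
    \<comment> \<open>The block lemma is instantiated with block length 2 instead of
      \<open>n\<close>.\<close>
    have "take 2 (drop (2 * j) (concat (map ?q [0..<K]))) = ?q j"
      using cc_protocol.block_concat[of K ?q 2 j "[]"] that by (simp add: cc_protocol.block_def mult.commute)
    then show ?thesis using that p by (simp add: coordinator.answers_def node_reply_def)
  qed
  have tp: "truncated_pivot (\<lambda>v u. u \<in> set (take 2 (drop (2 * j) (?F v)))) (block j ?b) {..<n} {} = pivot p j"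
    if "j < K" for j
    unfolding pivot_def p(4)[OF that]
  proof (rule truncated_pivot_cong)
    fix v assume v: "v \<in> {..<n}"
    have eq: "filter (\<lambda>u. u \<in> neighbours E v) (p j) = filter (adj v) (p j)"
      by (intro filter_cong) (auto simp: neighbours_def insert_commute)
    have "filter (\<lambda>u. u \<in> set (take 2 (drop (2 * j) (?F v)))) (p j)
        = filter (\<lambda>u. u \<in> set (take 2 (filter (adj v) (p j)))) (p j)"
      using p(1)[OF that] v F[OF that] by (intro filter_cong) (auto simp: eq dest: in_set_takeD)
    also have "\<dots> = take 2 (filter (adj v) (p j))" by (rule filter_in_set_take[OF p(2)[OF that]])
    finally show "filter (\<lambda>u. u \<in> set (take 2 (drop (2 * j) (?F v)))) (p j) = take 2 (filter (adj v) (p j))" .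
  qed (use p that in auto)
  have "encode_blocks (\<lambda>j. map (truncated_pivot (\<lambda>v u. u \<in> set (take 2 (drop (2 * j) (?F v))))
      (block j ?b) {..<n} {}) [0..<n]) = encode_blocks (\<lambda>j. map (pivot p j) [0..<n])"
    by (rule encode_blocks_cong) (simp only: tp)
  then show ?thesis unfolding draw_def by simp
qed

lemma messages_2:
  "messages 2 = map_pmf (\<lambda>p. encode_blocks (\<lambda>j. map (pivot p j) [0..<n])) (G.orders_pmf K)"
proof -
  have "messages 2 = messages 1 \<bind> (\<lambda>b. draw 1 b (answers 1 b))"
    by (simp add: coordinator.messages.simps numeral_2_eq_2)
  also have "\<dots> = G.orders_pmf K \<bind> (\<lambda>p. return_pmf (encode_blocks (\<lambda>j. map (pivot p j) [0..<n])))"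
    unfolding messages_1 bind_map_pmf by (intro bind_pmf_cong refl draw_1)
  finally show ?thesis by (simp add: map_pmf_def)
qed

lemma draw_2:
  defines "b p \<equiv> encode_blocks (\<lambda>j. map (pivot p j) [0..<n])"
  shows "draw 2 (b p) (answers 2 (b p))
    = map_pmf (encode_samples (map (G.best_pivot K p) [0..<n]) (\<lambda>v. if v < n then degree (G.best_pivot K p) v else 0))
        (samples (degree (G.best_pivot K p)))"
proof -
  let ?F = "answers 2 (b p)"
  have bl: "block j (b p) = map (pivot p j) [0..<n]" if "j < K" for j
    unfolding b_def using that by (intro block_encode_blocks) auto
  have F: "?F v ! j = degree (pivot p j) v" if "v < n" "j < K" for v j
  proof -
    have "row (nth (map (pivot p j) [0..<n])) (neighbours E v) v = row (pivot p j) (neighbours E v) v"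
      using that by (intro row_cong) auto
    then show ?thesis using that by (simp add: coordinator.answers_def node_reply_def bl)
  qed
  \<comment> \<open>Both objectives agree on the indices below \<open>K\<close>, so the predicates
    under the choice operator coincide and ties are broken in the same way.\<close>
  have "best_index ?F = arg_min_on (\<lambda>j. disagreement adj {..<n} (pivot p j)) {..<K}"
  proof -
    have *: "real (\<Sum>v<n. ?F v ! j) = disagreement adj {..<n} (pivot p j)" if "j < K" for j
      unfolding sum_degree[symmetric] using F that by simp
    show ?thesis
      unfolding best_index_def arg_min_on_def arg_min_def is_arg_min_def
      by (intro arg_cong[where f=Eps] ext) (use * in auto)
  qed
  then have best: "pivot p (best_index ?F) = G.best_pivot K p"
    by (simp add: G.best_pivot_def pivot_def)
  have j: "best_index ?F < K"
    unfolding best_index_def using arg_min_if_finite(1)[of "{..<K}"] K by fastforce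
  have s: "samples (\<lambda>v. ?F v ! best_index ?F) = samples (degree (G.best_pivot K p))"
    unfolding samples_def using F[OF _ j] best
    by (auto intro!: arg_cong[where f="\<lambda>x. Pi_pmf {..<s} (n, 0) (\<lambda>_. pmf_of_set x)"] cong: Sigma_cong)
  have e: "encode_samples (block (best_index ?F) (b p)) (\<lambda>v. ?F v ! best_index ?F)
      = encode_samples (map (G.best_pivot K p) [0..<n]) (\<lambda>v. if v < n then degree (G.best_pivot K p) v else 0)"
    using F[OF _ j] by (auto simp: encode_samples_def bl[OF j] best fun_eq_iff)
  show ?thesis unfolding draw_def Let_def s e by simp
qed

definition message :: "(nat \<Rightarrow> nat) \<Rightarrow> (nat \<Rightarrow> nat \<times> nat) \<Rightarrow> nat list" where
  "message g y = encode_samples (map g [0..<n]) (\<lambda>v. if v < n then degree g v else 0) y"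

lemma messages_3:
  "messages 3 = G.orders_pmf K \<bind> (\<lambda>p. map_pmf (message (G.best_pivot K p)) (samples (degree (G.best_pivot K p))))"
proof -
  have "messages 3 = messages 2 \<bind> (\<lambda>b. draw 2 b (answers 2 b))"
    by (simp add: coordinator.messages.simps numeral_3_eq_3 numeral_2_eq_2)
  then show ?thesis unfolding messages_2 bind_map_pmf draw_2 message_def .
qed

text \<open>The default \<open>(n, 0)\<close> is a fixed point, as needed to move the map inside the
  product distribution.\<close>

definition pair_at :: "(nat \<Rightarrow> nat) \<Rightarrow> nat \<times> nat \<Rightarrow> nat \<times> nat" where
  "pair_at g = (\<lambda>(v, i). if v < n then (v, sorted_list_of_set (row g (neighbours E v) v) ! i) else (n, 0))"

abbreviation slots :: "(nat \<Rightarrow> nat) \<Rightarrow> (nat \<times> nat) set" where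
  "slots g \<equiv> SIGMA v:{..<n}. {..<degree g v}"

lemma pair_at_slots: "pair_at g ` slots g = G.mismatches g" "inj_on (pair_at g) (slots g)"
proof -
  let ?l = "\<lambda>v. sorted_list_of_set (row g (neighbours E v) v)"
  have "(\<lambda>i. ?l v ! i) ` {..<degree g v} = row g (neighbours E v) v" for v
    using finite_row by (metis atLeast0LessThan list.set_map map_nth set_upt
        sorted_list_of_set.length_sorted_key_list_of_set sorted_list_of_set.set_sorted_key_list_of_set)
  moreover have "pair_at g ` slots g = (SIGMA v:{..<n}. (\<lambda>i. ?l v ! i) ` {..<degree g v})"
    by (force simp: pair_at_def)
  ultimately show "pair_at g ` slots g = G.mismatches g" by (simp add: mismatches_Sigma)
  show "inj_on (pair_at g) (slots g)"
    by (auto simp: inj_on_def pair_at_def nth_eq_iff_index_eq split: if_splits)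
qed

lemma samples_support:
  assumes "y \<in> set_pmf (samples (degree g))"
  shows "(\<forall>k. y k = (n, 0)) \<and> G.mismatches g = {} \<or> (\<forall>k<s. y k \<in> slots g) \<and> slots g \<noteq> {}"
proof (cases "\<forall>v<n. degree g v = 0")
  case True
  then have "slots g = {}" by auto
  then have "G.mismatches g = {}" using pair_at_slots(1)[of g] by simp
  with True assms show ?thesis by (simp add: samples_def)
next
  case False
  then have "slots g \<noteq> {}" by auto
  moreover have "finite (slots g)" by simp
  ultimately have "\<forall>k<s. y k \<in> slots g"
    using assms by (auto simp: samples_def if_not_P[OF False] set_Pi_pmf PiE_dflt_def simp del: mem_Sigma_iff)
  with \<open>slots g \<noteq> {}\<close> show ?thesis by blast
qed

definition sampled :: "(nat \<Rightarrow> nat) \<Rightarrow> (nat \<Rightarrow> nat \<times> nat) \<Rightarrow> (nat \<times> nat) multiset" where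
  "sampled g y = mset (concat (map (\<lambda>v. map (Pair v) (answers 3 (message g y) v)) [0..<n]))"

lemma answers_3:
  assumes "v < n"
  shows "answers 3 (message g y) v = map (\<lambda>k. sorted_list_of_set (row g (neighbours E v) v) ! snd (y k))
    (filter (\<lambda>k. fst (y k) = v) [0..<s])"
proof -
  let ?b = "message g y"
  have nth: "w < n \<Longrightarrow> ?b ! w = g w" "k < s \<Longrightarrow> ?b ! (n + k) = fst (y k)" "k < s \<Longrightarrow> ?b ! (n + s + k) = snd (y k)"
    for w k using encode_samples_nth[of "map g [0..<n]"] by (auto simp: message_def)
  have row: "row (nth ?b) (neighbours E v) v = row g (neighbours E v) v"
    using nth assms by (intro row_cong) auto
  have "filter (\<lambda>k. ?b ! (n + k) = v) [0..<s] = filter (\<lambda>k. fst (y k) = v) [0..<s]"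
    using nth by (intro filter_cong) auto
  then show ?thesis using assms nth(3) by (simp add: coordinator.answers_def node_reply_def row)
qed

lemma sampled_eq:
  "sampled g y = mset (map (\<lambda>k. pair_at g (y k)) (filter (\<lambda>k. fst (y k) < n) [0..<s]))"
proof -
  let ?l = "\<lambda>v. sorted_list_of_set (row g (neighbours E v) v)"
  have "map (\<lambda>v. map (Pair v) (answers 3 (message g y) v)) [0..<n]
      = map (\<lambda>v. map (\<lambda>k. (v, ?l v ! snd (y k))) (filter (\<lambda>k. fst (y k) = v) [0..<s])) [0..<n]"
    by (rule map_cong) (simp_all add: answers_3)
  then have "sampled g y = mset (map (\<lambda>k. (fst (y k), ?l (fst (y k)) ! snd (y k))) (filter (\<lambda>k. fst (y k) < n) [0..<s]))"
    unfolding sampled_def by (simp only: mset_concat_by_key[where h="\<lambda>v k. (v, ?l v ! snd (y k))" and c="\<lambda>k. fst (y k)"])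
  also have "map (\<lambda>k. (fst (y k), ?l (fst (y k)) ! snd (y k))) (filter (\<lambda>k. fst (y k) < n) [0..<s])
      = map (\<lambda>k. pair_at g (y k)) (filter (\<lambda>k. fst (y k) < n) [0..<s])"
    by (intro map_cong) (auto simp: pair_at_def split: prod.splits)
  finally show ?thesis .
qed

text \<open>\<open>pair_at g\<close> is a bijection from slots to mismatches, so each uniform slot
  becomes a uniform mismatch, independently for all \<open>k\<close>.\<close>

lemma samples_law: "map_pmf (sampled g) (samples (degree g)) = G.sample_pmf (n, 0) s g"
proof (cases "\<forall>v<n. degree g v = 0")
  case True
  then have "slots g = {}" by auto
  then have "G.mismatches g = {}" using pair_at_slots(1)[of g] by simp
  with True show ?thesis by (simp add: samples_def G.sample_pmf_def sampled_eq)
next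
  case False
  then have ne: "slots g \<noteq> {}" by auto
  have fs: "finite (slots g)" by simp
  have mne: "G.mismatches g \<noteq> {}" using pair_at_slots(1)[of g] ne by blast
  let ?p = "Pi_pmf {..<s} (n, 0) (\<lambda>_. pmf_of_set (slots g))"
  have s: "samples (degree g) = ?p" using False unfolding samples_def by (rule if_not_P)
  have "map_pmf (sampled g) ?p = map_pmf (\<lambda>y. image_mset (pair_at g \<circ> y) (mset_set {..<s})) ?p"
  proof (intro map_pmf_cong refl)
    fix y assume "y \<in> set_pmf ?p"
    then have "\<forall>k<s. y k \<in> slots g" using samples_support[of y g] s mne by auto
    then have "filter (\<lambda>k. fst (y k) < n) [0..<s] = [0..<s]" by (auto simp: filter_id_conv)
    then show "sampled g y = image_mset (pair_at g \<circ> y) (mset_set {..<s})"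
      by (simp add: sampled_eq atLeast0LessThan o_def)
  qed
  also have "\<dots> = map_pmf (\<lambda>y. image_mset y (mset_set {..<s})) (map_pmf (\<lambda>y. pair_at g \<circ> y) ?p)"
    by (simp add: pmf.map_comp o_def)
  also have "map_pmf (\<lambda>y. pair_at g \<circ> y) ?p = Pi_pmf {..<s} (n, 0) (\<lambda>_. map_pmf (pair_at g) (pmf_of_set (slots g)))"
    by (rule Pi_pmf_map[symmetric]) (auto simp: pair_at_def)
  also have "map_pmf (pair_at g) (pmf_of_set (slots g)) = pmf_of_set (G.mismatches g)"
    using map_pmf_of_set_inj[OF pair_at_slots(2) ne fs] pair_at_slots(1) by simp
  finally show ?thesis unfolding s G.sample_pmf_def using mne by simp
qed

lemma result_message:
  assumes "y \<in> set_pmf (samples (degree g))"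
  shows "result (message g y) (answers 3 (message g y))
    = refine {..<n} g (disagreement adj {..<n} g) s (sampled g y)"
proof -
  have "sampled g y \<in> set_pmf (G.sample_pmf (n, 0) s g)"
    using assms unfolding samples_law[symmetric] by simp
  then have M: "(u, w) \<in># sampled g y \<Longrightarrow> u \<in> {..<n} \<and> w \<in> {..<n}" for u w
    by (rule G.sample_pmf_support)
  have d: "message g y ! (n + 2 * s) = (\<Sum>v<n. degree g v)"
    unfolding message_def by (subst encode_samples_nth(4)) auto
  have "result (message g y) (answers 3 (message g y))
      = refine {..<n} (nth (message g y)) (disagreement adj {..<n} g) s (sampled g y)"
    unfolding result_def sampled_def[symmetric] d sum_degree ..
  also have "\<dots> = refine {..<n} g (disagreement adj {..<n} g) s (sampled g y)"
    using M encode_samples_nth(1)[of "map g [0..<n]"] by (intro refine_cong) (auto simp: message_def)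
  finally show ?thesis .
qed

theorem protocol_law: "map_pmf (\<lambda>b. result b (answers 3 b)) (messages 3) = G.cluster_pmf (n, 0) K s"
proof -
  let ?g = "G.best_pivot K"
  have "map_pmf (\<lambda>y. result (message g y) (answers 3 (message g y))) (samples (degree g))
      = map_pmf (refine {..<n} g (disagreement adj {..<n} g) s) (G.sample_pmf (n, 0) s g)" for g
    unfolding samples_law[symmetric] pmf.map_comp o_def by (intro map_pmf_cong refl result_message)
  then show ?thesis
    unfolding messages_3 G.cluster_pmf_def by (simp add: map_bind_pmf pmf.map_comp o_def map_pmf_def[symmetric])
qed

lemma message_cases:
  assumes "t < 3" "b \<in> set_pmf (messages (Suc t))"
  obtains p where "t = 0" "p \<in> set_pmf (G.orders_pmf K)" "b = encode_blocks p"
  | p where "t = 1" "b = encode_blocks (\<lambda>j. map (pivot p j) [0..<n])"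
  | p y where "t = 2" "y \<in> set_pmf (samples (degree (G.best_pivot K p)))" "b = message (G.best_pivot K p) y"
proof -
  consider "t = 0" | "t = 1" | "t = 2" using assms(1) by linarith
  then show thesis
  proof cases
    case 1
    then show thesis using assms(2) messages_1 that(1) by auto
  next
    case 2
    then have "b \<in> set_pmf (messages 2)" using assms(2) by (simp add: numeral_2_eq_2)
    then show thesis using 2 unfolding messages_2 using that(2) by auto
  next
    case 3
    then have "b \<in> set_pmf (messages 3)" using assms(2) by (simp add: numeral_3_eq_3)
    then show thesis using 3 unfolding messages_3 using that(3) by auto
  qed
qed

lemma best_pivot_less: "v < n \<Longrightarrow> G.best_pivot K p v < n"
  using G.best_pivot_in[of v K p] by simp

lemma length_message:
  assumes "t < 3" "b \<in> set_pmf (messages (Suc t))"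
  shows "length b = len"
  using assms
proof (cases rule: message_cases)
  case (1 p)
  then show ?thesis using orders_support(3) by (auto intro: length_encode_blocks)
next
  case (2 p)
  then show ?thesis by (auto intro: length_encode_blocks)
next
  case (3 p y)
  then show ?thesis by (auto simp: message_def intro: length_encode_samples)
qed

lemma message_word:
  assumes "t < 3" "b \<in> set_pmf (messages (Suc t))" "a \<in> set b"
  shows "a \<le> n * n + n"
  using assms(1,2)
proof (cases rule: message_cases)
  case (1 p)
  then show ?thesis using assms(3) set_encode_blocks[of p] orders_support(1)[of p] by fastforce
next
  case (2 p)
  have "\<forall>x\<in>set (encode_blocks (\<lambda>j. map (pivot p j) [0..<n])). x \<le> n"
    using set_encode_blocks[of "\<lambda>j. map (pivot p j) [0..<n]"] pivot_in[of _ p] by (fastforce intro: less_imp_le)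
  then show ?thesis using assms(3) 2 by fastforce
next
  case (3 p y)
  let ?g = "G.best_pivot K p"
  have d: "degree ?g v \<le> n" for v by (rule card_row)
  have "(\<Sum>v<n. if v < n then degree ?g v else 0) \<le> (\<Sum>v<n. n)" using d by (intro sum_mono) auto
  then have sum: "(\<Sum>v<n. if v < n then degree ?g v else 0) \<le> n * n" by simp
  have y: "fst (y k) \<le> n" "snd (y k) \<le> n" if "k < s" for k
  proof -
    have "y k = (n, 0) \<or> y k \<in> slots ?g" using samples_support[OF 3(2)] that by blast
    then show "fst (y k) \<le> n" "snd (y k) \<le> n" using d by (auto simp: mem_Times_iff less_imp_le intro: order.trans[OF less_imp_le])
  qed
  have "a \<in> set (map ?g [0..<n]) \<union> (fst \<circ> y) ` {..<s} \<union> (snd \<circ> y) ` {..<s}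
      \<union> {\<Sum>v<n. if v < n then degree ?g v else 0, 0}"
    using assms(3) set_encode_samples unfolding 3(3) message_def by blast
  then have "a \<le> n \<or> a \<le> n * n" using y sum best_pivot_less[of _ p] by (auto intro: less_imp_le)
  then show ?thesis by linarith
qed

lemma reply_word:
  assumes "t < 3" "b \<in> set_pmf (messages (Suc t))" "v < n" "a \<in> set (node_reply t b v (neighbours E v))"
  shows "a \<le> n"
  using assms(1,2)
proof (cases rule: message_cases)
  case (1 p)
  have bl: "block j b = p j" if "j < K" for j
    using 1 that orders_support(3) by (auto intro: block_encode_blocks)
  obtain j where j: "j < K" "a \<in> set (take 2 (filter (\<lambda>u. u \<in> neighbours E v) (block j b) @ [n, n]))"
    using assms(4) 1(1) by (auto simp: node_reply_def)
  then have "a \<in> set (p j) \<union> {n}" using bl by (auto dest!: in_set_takeD)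
  then have "a \<in> {..<n} \<union> {n}" unfolding orders_support(1)[OF 1(2) j(1)] .
  then show ?thesis by auto
next
  case (2 p)
  then obtain j where "a = card (row (nth (block j b)) (neighbours E v) v)"
    using assms(4) unfolding node_reply_def by auto
  then show ?thesis using card_row by simp
next
  case (3 p y)
  let ?g = "G.best_pivot K p"
  have "a \<in> set (answers 3 (message ?g y) v)"
    using assms(3,4) 3 by (simp add: coordinator.answers_def)
  then obtain k where k: "k < s" "fst (y k) = v" "a = sorted_list_of_set (row ?g (neighbours E v) v) ! snd (y k)"
    unfolding answers_3[OF assms(3)] by auto
  then have "y k \<in> slots ?g" using samples_support[OF 3(2)] assms(3) by auto
  then have "snd (y k) < degree ?g v" using k by auto
  then have "a \<in> set (sorted_list_of_set (row ?g (neighbours E v) v))" unfolding k(3) by (intro nth_mem) simp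
  then show ?thesis using finite_row by (auto simp: row_def)
qed

text \<open>There are two header words per node. The replies proper take \<open>2 * K\<close> words
  per node in the first phase, \<open>K\<close> in the second, and at most \<open>s\<close> words
  altogether in the third.\<close>

lemma reply_length:
  assumes "t < 3" "b \<in> set_pmf (messages (Suc t))"
  shows "(\<Sum>v<n. 2 + length (node_reply t b v (neighbours E v))) \<le> 2 * n + 2 * K * n + s"
  using assms
proof (cases rule: message_cases)
  case (1 p)
  have "length (node_reply t b v (neighbours E v)) = K * 2" for v
    unfolding node_reply_def using 1 by (auto intro!: cc_protocol.length_concat_blocks)
  then show ?thesis by simp
next
  case (2 p)
  then show ?thesis by (simp add: node_reply_def)
next
  case (3 p y)
  let ?g = "G.best_pivot K p"
  have "(\<Sum>v<n. length (node_reply t b v (neighbours E v))) = (\<Sum>v<n. length (answers 3 b v))"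
    using 3 by (intro sum.cong) (auto simp: coordinator.answers_def)
  also have "\<dots> = size (sampled ?g y)"
    unfolding sampled_def 3(3) by (simp add: length_concat o_def sum_list_sum_nth atLeast0LessThan)
  also have "\<dots> \<le> s"
    using length_filter_le[of "\<lambda>k. fst (y k) < n" "[0..<s]"]
    unfolding sampled_eq size_mset length_map length_upt by simp
  finally show ?thesis by (simp only: sum.distrib) simp
qed

lemma result_less:
  assumes "v < n"
  shows "result b F v < n"
  using G.refine_in[of "nth b" "real (b ! (n + 2 * s))" s "mset (concat (map (\<lambda>v. map (Pair v) (F v)) [0..<n]))"] assms
  unfolding result_def by (auto dest: PiE_mem)

end

subsection \<open>Parameters\<close>

lemma sum_card_neighbours:
  fixes n :: nat
  assumes "simple_graph {..<n} E"
  shows "(\<Sum>v<n. card (neighbours E v)) = 2 * card E"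
proof -
  have E: "E \<subseteq> node_pairs {..<n}" using assms by (simp add: simple_graph_def)
  have fE: "finite E"
    by (rule finite_subset[of _ "Pow {..<n}"]) (use E in \<open>auto simp: node_pairs_def\<close>)
  have fin: "finite (neighbours E v)" for v
    by (rule finite_subset[of _ "{..<n}"]) (use E in \<open>auto simp: neighbours_def node_pairs_def\<close>)
  have "{(u, w). u \<noteq> w \<and> {u, w} \<in> E} = (SIGMA u:{..<n}. neighbours E u)"
    using E by (auto simp: neighbours_def node_pairs_def insert_commute)
  then have "card (SIGMA u:{..<n}. neighbours E u) = 2 * card E"
    using card_ordered_pairs[OF fE] E by (auto simp: node_pairs_def)
  then show ?thesis using fin by simp
qed

lemma card_neighbours_less:
  fixes n :: nat
  assumes "simple_graph {..<n} E" "v < n"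
  shows "card (neighbours E v) < n"
proof -
  have "v \<notin> neighbours E v" "neighbours E v \<subseteq> {..<n}"
    using assms by (auto simp: neighbours_def simple_graph_def node_pairs_def)
  then have "neighbours E v \<subset> {..<n}" using assms(2) by blast
  from psubset_card_mono[OF _ this] show ?thesis by simp
qed

text \<open>Nodes are laid out on a line by their encoded length, and \<open>v\<close> goes to the
  machine whose window of length \<open>q\<close> contains its starting point. Only the last node of
  a window can overshoot, and its encoding has at most \<open>n + 1\<close> words.\<close>

lemma admissible_placement_exists:
  assumes graph: "simple_graph {..<n} E"
    and S: "local_memory A = q + n + 1" and q: "q > 0"
    and M: "machines A = (2 * card E + 2 * n) div q + 1"
  shows "\<exists>f. admissible_placement A {..<n} E f"
proof -
  define wt where "wt v = 2 + card (neighbours E v)" for v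
  define P where "P v = (\<Sum>u<v. wt u)" for v
  define f where "f v = P v div q" for v
  have mono: "P u \<le> P v" if "u \<le> v" for u v
    unfolding P_def using that by (intro sum_mono2) auto
  have total: "P n = 2 * card E + 2 * n"
    unfolding P_def wt_def using sum_card_neighbours[OF graph] by (simp only: sum.distrib) simp
  have "f v < machines A" if "v < n" for v
    unfolding M f_def using mono[of v n] that total div_le_mono[of "P v" "P n" q] by simp
  moreover have "words_used A (input_config {..<n} E f i) \<le> local_memory A" for i
  proof -
    let ?X = "{v \<in> {..<n}. f v = i}"
    have "words_used A (input_config {..<n} E f i) = length (concat (map (encode_node E) (sorted_list_of_set ?X)))"
      by (simp add: words_used_def input_config_def)
    also have "\<dots> = (\<Sum>v\<leftarrow>sorted_list_of_set ?X. wt v)"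
      by (simp add: length_concat o_def encode_node_def wt_def)
    also have "\<dots> = (\<Sum>v\<in>?X. wt v)"
      by (subst sum_list_distinct_conv_sum_set) auto
    also have "\<dots> \<le> q + n + 1"
    proof (cases "?X = {}")
      case True
      show ?thesis unfolding True by simp
    next
      case False
      define x where "x = Max ?X"
      define y where "y = Min ?X"
      have f: "finite ?X" by simp
      have x: "x \<in> ?X" and y: "y \<in> ?X" unfolding x_def y_def using Max_in[OF f False] Min_in[OF f False] by auto
      have "?X \<subseteq> {y..<Suc x}"
      proof
        fix v assume "v \<in> ?X"
        then show "v \<in> {y..<Suc x}"
          unfolding x_def y_def using Max_ge[OF f, of v] Min_le[OF f, of v] by (simp add: less_Suc_eq_le)
      qed
      then have "(\<Sum>v\<in>?X. wt v) \<le> (\<Sum>v\<in>{y..<Suc x}. wt v)" by (intro sum_mono2) auto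
      moreover have "(\<Sum>v\<in>{y..<Suc x}. wt v) + P y = P (Suc x)"
      proof -
        have "y \<le> Suc x" using x f unfolding y_def by (meson Min_le le_SucI)
        then show ?thesis unfolding P_def lessThan_atLeast0
          using sum.atLeastLessThan_concat[of 0 y "Suc x" wt] by simp
      qed
      moreover have "P (Suc x) = P x + wt x" by (simp add: P_def)
      moreover have "P x < (i + 1) * q"
        using x q dividend_less_div_times[OF q, of "P x"] unfolding f_def by simp
      moreover have "i * q \<le> P y" using y unfolding f_def by auto
      moreover have "wt x \<le> n + 1" using card_neighbours_less[OF graph, of x] x by (simp add: wt_def)
      ultimately show ?thesis by (simp add: algebra_simps)
    qed
    finally show ?thesis using S by simp
  qed
  ultimately show ?thesis unfolding admissible_placement_def by blast
qed

definition lg :: "nat \<Rightarrow> nat" where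
  "lg n = nat \<lceil>log 2 (real n + 1)\<rceil>"

lemma lg_bounds:
  assumes "n \<ge> 1"
  shows "lg n \<ge> 1" "n < 2 ^ lg n" "real (lg n) \<le> 2 * log 2 (real n + 1)" "log 2 (real n + 1) \<ge> 1"
proof -
  let ?l = "log 2 (real n + 1)"
  have "log 2 2 \<le> ?l" using assms by (subst log_le_cancel_iff) auto
  then show l: "?l \<ge> 1" by simp
  then have "real (lg n) \<ge> 1" unfolding lg_def by linarith
  then show "lg n \<ge> 1" by simp
  show "real (lg n) \<le> 2 * ?l" unfolding lg_def using l by linarith
  have "real n + 1 = 2 powr ?l" by simp
  also have "\<dots> \<le> 2 powr real (lg n)" unfolding lg_def using l by (intro powr_mono) linarith+
  also have "\<dots> = real (2 ^ lg n)" by (simp add: powr_realpow)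
  finally have "real (n + 1) \<le> real (2 ^ lg n)" by simp
  then have "n + 1 \<le> 2 ^ lg n" by (simp only: of_nat_le_iff)
  then show "n < 2 ^ lg n" by simp
qed

locale cc_parameters =
  fixes c n m :: nat
begin

text \<open>The extra run halves the failure probability of the pivot stage and so makes room for
  that of the sampling stage.\<close>

definition K :: nat where
  "K = c * lg n + 1"

text \<open>
  Hoeffding's bound for a deviation of 1/20 is \<open>2 * exp (- s / 200)\<close>; the three summands of \<open>s\<close> pay for
  the union bound over \<open>n ^ n\<close> labellings, the failure probability and the expectation.
\<close>

definition s :: nat where
  "s = 200 * (n * lg n + c * lg n + 32)"

text \<open>Messages, replies and \<open>M\<close> fit into
  \<open>3 * K * n + 3 * s + 4 * n + 3\<close> words; \<open>D\<close> collects the coefficients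
  after each term is bounded by a multiple of \<open>n * lg n\<close>.\<close>

definition D :: nat where
  "D = 3 * (c + 1) + 600 * (c + 33) + 7"

text \<open>One half for the packed input, the other for communication.\<close>

definition S :: nat where
  "S = 2 * (D * (n * lg n))"

definition M :: nat where
  "M = (2 * m + 2 * n) div (S - n - 1) + 1"

text \<open>Lengths of replies have to be words: \<open>D\<close> bits for the factor
  \<open>D\<close> and \<open>2 * lg n\<close> for \<open>n * lg n\<close>. Packing needs
  \<open>2 * lg n + 1\<close> bits.\<close>

definition w :: nat where
  "w = (D + 3) * lg n"

definition algorithm :: mpc_algorithm where
  "algorithm = coordinator.algorithm n M S w (cc_protocol.len n K s) 3 (2 ^ lg n)
     (cc_protocol.draw n K s) (cc_protocol.node_reply n K s) (cc_protocol.result n s)"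

context
  assumes n: "n \<ge> 1"
begin

lemma n_lg: "n \<le> n * lg n" "lg n \<le> n * lg n" "1 \<le> n * lg n"
  using n lg_bounds(1)[OF n] by auto

lemma K_le: "K \<le> (c + 1) * lg n"
  unfolding K_def using lg_bounds(1)[OF n] by simp

lemma s_le: "s \<le> 200 * (c + 33) * (n * lg n)"
proof -
  have "c * lg n \<le> c * (n * lg n)" using n_lg by (intro mult_le_mono2)
  moreover have "(c + 33) * (n * lg n) = c * (n * lg n) + 33 * (n * lg n)" by (rule add_mult_distrib)
  ultimately have "n * lg n + c * lg n + 32 \<le> (c + 33) * (n * lg n)" using n_lg(3) by linarith
  from mult_le_mono2[OF this, of 200] show ?thesis unfolding s_def by (simp only: mult.assoc)
qed

lemma space_le:
  "cc_protocol.len n K s + (2 * n + 2 * K * n + s) + n + 2 \<le> D * (n * lg n)"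
proof -
  have "K * n \<le> (c + 1) * (n * lg n)" using mult_le_mono1[OF K_le, of n] by (simp add: algebra_simps)
  moreover have "D * (n * lg n) = 3 * ((c + 1) * (n * lg n)) + 3 * (200 * (c + 33) * (n * lg n)) + 7 * (n * lg n)"
    unfolding D_def by (simp add: algebra_simps)
  moreover have "2 * K * n = 2 * (K * n)" by simp
  ultimately show ?thesis unfolding cc_protocol.len_def using s_le n_lg by linarith
qed

lemma S_ge: "2 * (n + 2) \<le> S"
  unfolding S_def using space_le by simp

lemma S_half: "S \<le> 2 * (S - n - 1)"
  using S_ge by simp

text \<open>A machine can receive a part from each of the \<open>M\<close> machines, and rounding
  costs up to \<open>M\<close> words; this bound keeps them within the space planned in
  \<open>space_le\<close>.\<close>

lemma M_le:
  assumes "2 * m \<le> n * n - n"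
  shows "M \<le> n + 1"
proof -
  have q: "n + 1 \<le> S - n - 1" using S_ge by simp
  have "n \<le> n * n" using n by simp
  then have "2 * m + 2 * n \<le> n * (n + 1)" using assms unfolding add_mult_distrib2 by linarith
  also have "\<dots> \<le> n * (S - n - 1)" using q by (rule mult_le_mono2)
  finally have "(2 * m + 2 * n) div (S - n - 1) \<le> n * (S - n - 1) div (S - n - 1)" by (rule div_le_mono)
  then show ?thesis unfolding M_def using q by simp
qed

lemma total_memory_le: "M * S \<le> 4 * m + 4 * n + S"
proof -
  let ?q = "S - n - 1"
  have "(2 * m + 2 * n) div ?q * S \<le> (2 * m + 2 * n) div ?q * (2 * ?q)"
    using S_half by (intro mult_le_mono2)
  also have "\<dots> \<le> 2 * (2 * m + 2 * n)"
    using div_times_less_eq_dividend[of "2 * m + 2 * n" ?q] by (simp add: algebra_simps)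
  finally show ?thesis unfolding M_def by (simp add: algebra_simps)
qed

lemma word_bounds:
  "2 ^ lg n * (2 ^ lg n + 1) \<le> (2 :: nat) ^ w" "n * n + n < 2 ^ w" "2 * n + 2 * K * n + s < 2 ^ w"
proof -
  have l: "lg n \<ge> 1" "n < 2 ^ lg n" using lg_bounds[OF n] by auto
  have "2 ^ lg n * (2 ^ lg n + 1) \<le> (2 :: nat) ^ lg n * (2 ^ lg n * 2)" by (intro mult_le_mono2) simp
  also have "\<dots> = 2 ^ (2 * lg n + 1)" by (simp add: power_add mult_2)
  also have "\<dots> \<le> 2 ^ w" unfolding w_def using l(1) by (intro power_increasing) (auto simp: algebra_simps)
  finally show 1: "2 ^ lg n * (2 ^ lg n + 1) \<le> (2 :: nat) ^ w" .
  have "n * n + n = n * (n + 1)" by simp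
  also have "\<dots> < 2 ^ lg n * (2 ^ lg n + 1)" using l(2) by (intro mult_strict_mono) auto
  finally show "n * n + n < 2 ^ w" using 1 by simp
  have "2 * n + 2 * K * n + s < D * (n * lg n)" using space_le by simp
  also have "\<dots> \<le> 2 ^ D * (2 ^ lg n * 2 ^ lg n)"
    using l(2) less_exp[of D] less_exp[of "lg n"] by (intro mult_le_mono) auto
  also have "\<dots> = 2 ^ (D + 2 * lg n)" by (simp add: power_add mult_2)
  also have "\<dots> \<le> 2 ^ w"
  proof (rule power_increasing)
    have "D \<le> D * lg n" using l(1) by simp
    then show "D + 2 * lg n \<le> w" unfolding w_def add_mult_distrib by linarith
  qed simp
  finally show "2 * n + 2 * K * n + s < 2 ^ w" .
qed

lemma failure_bound:
  assumes "c' \<ge> 0" "c' \<le> real c"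
  defines "bad \<equiv> real (card ({..<n} \<rightarrow>\<^sub>E {..<n})) * (2 * exp (- real s / 200))"
  shows "(1 / 2) ^ K + bad \<le> real n powr (- c')" "15 * bad \<le> 1"
proof -
  have l: "n < 2 ^ lg n" using lg_bounds[OF n] by auto
  have half: "(1 / 2 :: real) ^ (c * lg n) \<le> real n powr (- c')"
  proof -
    have "real n powr c' \<le> (2 ^ lg n) powr c'"
      using l assms by (intro powr_mono2) (auto simp flip: of_nat_less_iff of_nat_power intro: less_imp_le)
    also have "\<dots> \<le> (2 ^ lg n) powr real c" using assms by (intro powr_mono) auto
    also have "\<dots> = 2 ^ (c * lg n)" by (simp add: powr_realpow power_mult[symmetric] mult.commute)
    finally show ?thesis using n by (simp add: powr_minus power_one_over field_simps)
  qed
  have "real (card ({..<n} \<rightarrow>\<^sub>E {..<n})) = real n ^ n" by (simp add: card_PiE)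
  also have "\<dots> \<le> (2 ^ lg n) ^ n" using l by (intro power_mono) (auto simp flip: of_nat_less_iff of_nat_power intro: less_imp_le)
  also have "\<dots> = 2 ^ (n * lg n)" by (simp add: power_mult[symmetric] mult.commute)
  also have "\<dots> \<le> exp 1 ^ (n * lg n)" using exp_ge_add_one_self[of 1] by (intro power_mono) auto
  also have "\<dots> = exp (real (n * lg n))" by (simp add: exp_of_nat_mult[symmetric])
  finally have card: "real (card ({..<n} \<rightarrow>\<^sub>E {..<n})) \<le> exp (real (n * lg n))" .
  have "bad \<le> exp (real (n * lg n)) * (2 * exp (- real s / 200))"
    unfolding bad_def by (intro mult_right_mono card) auto
  also have "\<dots> = 2 * exp (real (n * lg n) - real s / 200)" by (simp add: exp_add[symmetric] algebra_simps)
  also have "real (n * lg n) - real s / 200 = - real (c * lg n) - 32" by (simp add: s_def add_divide_distrib)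
  also have "exp (- real (c * lg n) - 32) = exp (- real (c * lg n)) * exp (- 32 :: real)" by (simp add: exp_add[symmetric])
  \<comment> \<open>Here the 32 in \<open>s\<close> pays: \<open>exp 32 \<ge> 33\<close> leaves the
    factor 2/33, and \<open>15 * 2 / 33 \<le> 1\<close> is what the expectation requires.\<close>
  also have "exp (- 32 :: real) \<le> 1 / 33"
    using exp_ge_add_one_self[of "32 :: real"] by (simp add: exp_minus field_simps)
  finally have bad: "bad \<le> 2 / 33 * exp (- real (c * lg n))" by (simp add: mult.commute)
  have "exp (- real (c * lg n)) \<le> 1" by simp
  with bad show "15 * bad \<le> 1" by linarith
  have "exp (- real (c * lg n)) = (exp (- 1)) ^ (c * lg n)" by (simp add: exp_of_nat_mult[symmetric])
  also have "\<dots> \<le> (1 / 2 :: real) ^ (c * lg n)"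
    using exp_ge_add_one_self[of "1 :: real"] by (intro power_mono) (auto simp: exp_minus field_simps)
  finally have "bad \<le> 2 / 33 * (1 / 2) ^ (c * lg n)" using bad by simp
  moreover have "(1 / 2 :: real) ^ K = 1 / 2 * (1 / 2) ^ (c * lg n)" unfolding K_def by simp
  moreover have "(1 / 2 :: real) ^ (c * lg n) \<ge> 0" by simp
  ultimately have "(1 / 2) ^ K + bad \<le> (1 / 2) ^ (c * lg n)" by linarith
  with half show "(1 / 2) ^ K + bad \<le> real n powr (- c')" by simp
qed

end

lemma protocol_correct:
  assumes n: "n \<ge> 1" and graph: "simple_graph {..<n} E" and m: "card E = m"
    and f: "admissible_placement algorithm {..<n} E f"
  shows "respects_memory algorithm (input_config {..<n} E f)"
    and "mpc_clustering algorithm (input_config {..<n} E f)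
      = map_pmf (label_clusters {..<n})
          (finite_graph.cluster_pmf {..<n} (\<lambda>u w. {u, w} \<in> E) (n, 0) K s)"
proof -
  interpret R: cc_run n K s E
    by unfold_locales (use graph in \<open>auto simp: K_def\<close>)
  have two_m: "2 * m \<le> n * n - n"
  proof -
    have "2 * m = (\<Sum>v<n. card (neighbours E v))" using sum_card_neighbours[OF graph] m by simp
    also have "\<dots> \<le> (\<Sum>v<n. n - 1)"
      using card_neighbours_less[OF graph] by (intro sum_mono) fastforce
    finally show ?thesis by (simp add: diff_mult_distrib2)
  qed
  \<comment> \<open>\<open>S\<close> is even, so rounding up costs nothing.\<close>
  have half: "(S + 1) div 2 = D * (n * lg n)" unfolding S_def by simp
  have S2: "S = D * (n * lg n) + D * (n * lg n)" unfolding S_def by simp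
  have small: "a < 2 ^ w" if "a \<le> n * n + n" for a using that word_bounds(2)[OF n] by simp
  interpret C: coordinator_run n M S w R.len 3 "2 ^ lg n" R.draw R.node_reply R.result E f "2 * n + 2 * K * n + s"
  proof
    show "n \<le> 2 ^ lg n" using lg_bounds(2)[OF n] by simp
    show "admissible_placement (coordinator.algorithm n M S w R.len 3 (2 ^ lg n) R.draw R.node_reply R.result) {..<n} E f"
      using f unfolding algorithm_def .
    show "(S + 1) div 2 + R.len + (2 * n + 2 * K * n + s) \<le> S"
      unfolding half using space_le[OF n] S2 by linarith
    show "(S + 1) div 2 + R.len + M \<le> S"
      unfolding half using space_le[OF n] S2 M_le[OF n two_m] by linarith
    show "2 * n \<le> S" using S_ge[OF n] by simp
    show "a < 2 ^ w" if "t < 3" "b \<in> set_pmf (R.messages (Suc t))" "v < n"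
        "a \<in> set (R.node_reply t b v (neighbours E v))" for t b v a
      using R.reply_word[OF that] by (intro small) simp
    show "R.result b (R.answers 3 b) v < 2 ^ w" if "v < n" for b v
      using R.result_less[OF that, of b] by (intro small) (simp add: less_imp_le trans_le_add2)
  qed (use graph word_bounds[OF n] R.length_message R.message_word R.reply_length small in \<open>auto simp: M_def\<close>)
  show "respects_memory algorithm (input_config {..<n} E f)"
    using C.respects_memory_algorithm unfolding algorithm_def .
  show "mpc_clustering algorithm (input_config {..<n} E f)
      = map_pmf (label_clusters {..<n}) (finite_graph.cluster_pmf {..<n} (\<lambda>u w. {u, w} \<in> E) (n, 0) K s)"
    using C.mpc_clustering_algorithm unfolding algorithm_def R.protocol_law[symmetric] pmf.map_comp o_def .
qed

end

lemma cluster_pmf_quality: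
  fixes n :: nat
  assumes n: "n \<ge> 1" and graph: "simple_graph {..<n} E" and c: "c' \<ge> 0" "c' \<le> real c"
  defines "Q \<equiv> map_pmf (label_clusters {..<n})
    (finite_graph.cluster_pmf {..<n} (\<lambda>u w. {u, w} \<in> E) (n, 0) (cc_parameters.K c n) (cc_parameters.s c n))"
  shows "measure_pmf.expectation Q (\<lambda>P. real (cc_cost {..<n} E P)) \<le> 3 * real (cc_opt {..<n} E)"
    and "measure_pmf.prob Q {P. real (cc_cost {..<n} E P) \<le> 3 * real (cc_opt {..<n} E)} \<ge> 1 - real n powr (- c')"
proof -
  let ?K = "cc_parameters.K c n" and ?s = "cc_parameters.s c n"
  let ?adj = "\<lambda>u w. {u, w} \<in> E"
  let ?p = "finite_graph.cluster_pmf {..<n} ?adj (n, 0) ?K ?s"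
  let ?dis = "disagreement ?adj {..<n}"
  let ?bad = "real (card ({..<n} \<rightarrow>\<^sub>E {..<n})) * (2 * exp (- real ?s / 200))"
  interpret finite_graph "{..<n}" ?adj
  proof
    show "\<not> {u, u} \<in> E" for u using graph by (auto simp: simple_graph_def node_pairs_def)
  qed (auto simp: insert_commute)
  have pos: "?K > 0" "?s > 0" by (auto simp: cc_parameters.K_def cc_parameters.s_def)
  obtain h where h: "h \<in> {..<n} \<rightarrow>\<^sub>E {..<n}" "?dis h = 2 * real (cc_opt {..<n} E)"
    using cc_opt_attained[OF graph] .
  have cost: "real (cc_cost {..<n} E (label_clusters {..<n} g)) = ?dis g / 2" for g :: "nat \<Rightarrow> nat"
    using disagreement_eq_cc_cost[OF graph, of g] by simp
  note fail = cc_parameters.failure_bound[OF n c]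
  have "measure_pmf.expectation Q (\<lambda>P. real (cc_cost {..<n} E P)) = measure_pmf.expectation ?p ?dis / 2"
    unfolding Q_def by (simp add: cost)
  also have "measure_pmf.expectation ?p ?dis \<le> (2 + 15 * ?bad) * ?dis h"
    by (rule expectation_cluster_pmf[OF pos(2,1) h(1)])
  also have "\<dots> \<le> 3 * ?dis h"
    using fail(2) by (intro mult_right_mono) (auto simp: h(2))
  finally show "measure_pmf.expectation Q (\<lambda>P. real (cc_cost {..<n} E P)) \<le> 3 * real (cc_opt {..<n} E)"
    using h(2) by simp
  have "measure_pmf.prob Q {P. real (cc_cost {..<n} E P) \<le> 3 * real (cc_opt {..<n} E)}
      = measure_pmf.prob ?p {g. \<not> ?dis g > 3 * ?dis h}"
    unfolding Q_def by (simp add: vimage_def cost h(2) not_less field_simps)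
  also have "\<dots> = 1 - measure_pmf.prob ?p {g. ?dis g > 3 * ?dis h}"
    using measure_pmf.prob_compl[of "{g. ?dis g > 3 * ?dis h}" ?p] by (simp add: Compl_eq_Diff_UNIV[symmetric] Collect_neg_eq)
  also have "\<dots> \<ge> 1 - ((1 / 2) ^ ?K + ?bad)"
    using prob_cluster_pmf[OF pos(2) h(1)] by (intro diff_left_mono)
  finally show "measure_pmf.prob Q {P. real (cc_cost {..<n} E P) \<le> 3 * real (cc_opt {..<n} E)} \<ge> 1 - real n powr (- c')"
    using fail(1) by linarith
qed

theorem theorem4:
  fixes c' \<epsilon>\<^sub>0 :: real
  assumes "c' > 0" and "\<epsilon>\<^sub>0 > 0"
  shows "\<exists>(C :: real) (k :: nat) (R :: nat) (alg :: nat \<Rightarrow> nat \<Rightarrow> real \<Rightarrow> mpc_algorithm).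
    \<forall>(n :: nat) (m :: nat) (\<epsilon> :: real). n \<ge> 1 \<and> 0 < \<epsilon> \<and> \<epsilon> \<le> \<epsilon>\<^sub>0 \<longrightarrow>
      (let A = alg n m \<epsilon>; V = {..<n} in
        rounds A \<le> R \<and>
        real (word_bits A) \<le> C * log 2 (real n + 1) \<and>
        real (local_memory A) \<le> C * (real n / \<epsilon>) * log 2 (real n + 1) ^ k \<and>
        real (machines A * local_memory A) \<le> C * (real m + real n / \<epsilon>) * log 2 (real n + 1) ^ k \<and>
        (\<forall>E. simple_graph V E \<and> card E = m \<longrightarrow>
          (\<exists>f. admissible_placement A V E f) \<and>
          (\<forall>f. admissible_placement A V E f \<longrightarrow>
            (let c0 = input_config V E f; Q = mpc_clustering A c0 in
              respects_memory A c0 \<and>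
              (\<forall>P \<in> set_pmf Q. partition_on V P) \<and>
              measure_pmf.expectation Q (\<lambda>P. real (cc_cost V E P))
                \<le> (3 + \<epsilon>) * real (cc_opt V E) \<and>
              measure_pmf.prob Q {P. real (cc_cost V E P) \<le> (3 + \<epsilon>) * real (cc_opt V E)}
                \<ge> 1 - real n powr (- c')))))"
proof -
  define c where "c = nat \<lceil>c'\<rceil>"
  have c: "c' \<ge> 0" "c' \<le> real c" using assms(1) unfolding c_def by linarith+
  define D where "D = real (cc_parameters.D c)"
  have D: "D \<ge> 0" by (simp add: D_def)
  \<comment> \<open>\<open>2 * (D + 3)\<close> serves the word size, 4 the edges,
    \<open>4 * \<epsilon>\<^sub>0\<close> the nodes and \<open>4 * D * \<epsilon>\<^sub>0\<close>
    the memory of one machine.\<close>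
  define C where "C = 2 * (D + 3) + 4 + 4 * \<epsilon>\<^sub>0 + 4 * D * \<epsilon>\<^sub>0"
  define alg :: "nat \<Rightarrow> nat \<Rightarrow> real \<Rightarrow> mpc_algorithm"
    where "alg = (\<lambda>n m _. cc_parameters.algorithm c n m)"
  \<comment> \<open>Nine rounds are three phases of three rounds, and one logarithmic factor
    suffices.\<close>
  show ?thesis
  proof (rule exI[of _ C], rule exI[of _ 1], rule exI[of _ 9], rule exI[of _ alg], intro allI impI)
    fix n m :: nat and \<epsilon> :: real
    assume asm: "n \<ge> 1 \<and> 0 < \<epsilon> \<and> \<epsilon> \<le> \<epsilon>\<^sub>0"
    then have n: "n \<ge> 1" and e: "0 < \<epsilon>" "\<epsilon> \<le> \<epsilon>\<^sub>0" by auto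
    interpret P: cc_parameters c n m .
    let ?l = "log 2 (real n + 1)"
    have l: "?l \<ge> 1" "real (lg n) \<le> 2 * ?l" using lg_bounds[OF n] by auto
    have A: "alg n m \<epsilon> = P.algorithm" by (simp add: alg_def)
    have simps: "rounds P.algorithm = 9" "word_bits P.algorithm = P.w" "local_memory P.algorithm = P.S"
        "machines P.algorithm = P.M"
      unfolding P.algorithm_def by (simp_all add: coordinator.algorithm_simps)
    \<comment> \<open>The bound \<open>\<epsilon>\<^sub>0\<close> on \<open>\<epsilon>\<close>
      converts space proportional to \<open>n\<close> into space proportional to
      \<open>n / \<epsilon>\<close>, at the price of a constant factor.\<close>
    have ne: "real n \<le> \<epsilon>\<^sub>0 * (real n / \<epsilon>)" using e by (simp add: field_simps mult_right_mono)
    have ne0: "real n / \<epsilon> \<ge> 0" using e by simp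
    have nl: "real n * ?l \<le> \<epsilon>\<^sub>0 * (real n / \<epsilon>) * ?l" using ne l by (intro mult_right_mono) auto
    have w: "real P.w \<le> C * ?l"
    proof -
      have "real P.w = (D + 3) * real (lg n)" by (simp add: P.w_def D_def)
      also have "\<dots> \<le> (D + 3) * (2 * ?l)" using l D by (intro mult_left_mono) auto
      also have "\<dots> = (2 * (D + 3)) * ?l" by simp
      also have "\<dots> \<le> C * ?l" using l D assms by (intro mult_right_mono) (auto simp: C_def)
      finally show ?thesis .
    qed
    have S: "real P.S \<le> 4 * D * \<epsilon>\<^sub>0 * (real n / \<epsilon>) * ?l"
    proof -
      have "real P.S = 2 * D * (real n * real (lg n))" by (simp add: P.S_def D_def)
      also have "\<dots> \<le> 2 * D * (real n * (2 * ?l))" using l D by (intro mult_left_mono) auto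
      also have "\<dots> = 4 * D * (real n * ?l)" by simp
      also have "\<dots> \<le> 4 * D * (\<epsilon>\<^sub>0 * (real n / \<epsilon>) * ?l)" using nl D by (intro mult_left_mono) auto
      finally show ?thesis by (simp add: mult.assoc)
    qed
    have S': "real P.S \<le> C * (real n / \<epsilon>) * ?l"
    proof -
      have "4 * D * \<epsilon>\<^sub>0 * (real n / \<epsilon>) * ?l \<le> C * (real n / \<epsilon>) * ?l"
        using ne0 l D assms by (intro mult_right_mono) (auto simp: C_def)
      with S show ?thesis by linarith
    qed
    have MS: "real (P.M * P.S) \<le> C * (real m + real n / \<epsilon>) * ?l"
    proof -
      have "real (P.M * P.S) \<le> real (4 * m + 4 * n + P.S)"
        using P.total_memory_le[OF n] by (simp only: of_nat_le_iff)
      also have "\<dots> \<le> 4 * real m + 4 * real n + 4 * D * \<epsilon>\<^sub>0 * (real n / \<epsilon>) * ?l" using S by simp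
      also have "\<dots> \<le> 4 * (real m * ?l) + 4 * (\<epsilon>\<^sub>0 * (real n / \<epsilon>) * ?l) + 4 * D * \<epsilon>\<^sub>0 * (real n / \<epsilon>) * ?l"
      proof -
        have "real m * 1 \<le> real m * ?l" "real n * 1 \<le> real n * ?l" using l by (intro mult_left_mono; simp)+
        then show ?thesis using nl by simp
      qed
      also have "\<dots> = 4 * (real m * ?l) + (4 * \<epsilon>\<^sub>0 + 4 * D * \<epsilon>\<^sub>0) * (real n / \<epsilon> * ?l)"
        by (simp add: algebra_simps)
      also have "\<dots> \<le> C * (real m * ?l) + C * (real n / \<epsilon> * ?l)"
      proof -
        have "0 \<le> real m * ?l" "0 \<le> real n / \<epsilon> * ?l"
          using ne0 l by (intro mult_nonneg_nonneg; simp)+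
        moreover have "4 \<le> C" "4 * \<epsilon>\<^sub>0 + 4 * D * \<epsilon>\<^sub>0 \<le> C"
          using D assms by (simp_all add: C_def)
        ultimately show ?thesis by (intro add_mono mult_right_mono)
      qed
      finally show ?thesis by (simp add: algebra_simps)
    qed
    have correct: "(\<exists>f. admissible_placement P.algorithm {..<n} E f) \<and>
          (\<forall>f. admissible_placement P.algorithm {..<n} E f \<longrightarrow>
            (let c0 = input_config {..<n} E f; Q = mpc_clustering P.algorithm c0 in
              respects_memory P.algorithm c0 \<and>
              (\<forall>P \<in> set_pmf Q. partition_on {..<n} P) \<and>
              measure_pmf.expectation Q (\<lambda>P. real (cc_cost {..<n} E P))
                \<le> (3 + \<epsilon>) * real (cc_opt {..<n} E) \<and>
              measure_pmf.prob Q {P. real (cc_cost {..<n} E P) \<le> (3 + \<epsilon>) * real (cc_opt {..<n} E)}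
                \<ge> 1 - real n powr (- c')))"
      if graph: "simple_graph {..<n} E" and m: "card E = m" for E
    proof (intro conjI allI impI)
      show "\<exists>f. admissible_placement P.algorithm {..<n} E f"
        using P.S_ge[OF n]
        by (intro admissible_placement_exists[OF graph, where q="P.S - n - 1"]) (auto simp: simps P.M_def m)
    next
      fix f assume f: "admissible_placement P.algorithm {..<n} E f"
      let ?Q = "map_pmf (label_clusters {..<n})
        (finite_graph.cluster_pmf {..<n} (\<lambda>u w. {u, w} \<in> E) (n, 0) P.K P.s)"
      let ?opt = "real (cc_opt {..<n} E)"
      have opt: "3 * ?opt \<le> (3 + \<epsilon>) * ?opt" using e by (intro mult_right_mono) auto
      have "measure_pmf.prob ?Q {P. real (cc_cost {..<n} E P) \<le> 3 * ?opt}
          \<le> measure_pmf.prob ?Q {P. real (cc_cost {..<n} E P) \<le> (3 + \<epsilon>) * ?opt}"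
        using opt by (intro measure_pmf.finite_measure_mono) auto
      then show "let c0 = input_config {..<n} E f; Q = mpc_clustering P.algorithm c0 in
              respects_memory P.algorithm c0 \<and>
              (\<forall>P \<in> set_pmf Q. partition_on {..<n} P) \<and>
              measure_pmf.expectation Q (\<lambda>P. real (cc_cost {..<n} E P))
                \<le> (3 + \<epsilon>) * real (cc_opt {..<n} E) \<and>
              measure_pmf.prob Q {P. real (cc_cost {..<n} E P) \<le> (3 + \<epsilon>) * real (cc_opt {..<n} E)}
                \<ge> 1 - real n powr (- c')"
        unfolding Let_def P.protocol_correct(2)[OF n graph m f]
        using P.protocol_correct(1)[OF n graph m f] cluster_pmf_quality[OF n graph c] opt
          partition_on_label_clusters by (auto simp del: integral_map_pmf)
    qed
    show "let A = alg n m \<epsilon>; V = {..<n} in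
        rounds A \<le> 9 \<and>
        real (word_bits A) \<le> C * log 2 (real n + 1) \<and>
        real (local_memory A) \<le> C * (real n / \<epsilon>) * log 2 (real n + 1) ^ 1 \<and>
        real (machines A * local_memory A) \<le> C * (real m + real n / \<epsilon>) * log 2 (real n + 1) ^ 1 \<and>
        (\<forall>E. simple_graph V E \<and> card E = m \<longrightarrow>
          (\<exists>f. admissible_placement A V E f) \<and>
          (\<forall>f. admissible_placement A V E f \<longrightarrow>
            (let c0 = input_config V E f; Q = mpc_clustering A c0 in
              respects_memory A c0 \<and>
              (\<forall>P \<in> set_pmf Q. partition_on V P) \<and>
              measure_pmf.expectation Q (\<lambda>P. real (cc_cost V E P))
                \<le> (3 + \<epsilon>) * real (cc_opt V E) \<and>
              measure_pmf.prob Q {P. real (cc_cost V E P) \<le> (3 + \<epsilon>) * real (cc_opt V E)}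
                \<ge> 1 - real n powr (- c'))))"
      unfolding A Let_def[of P.algorithm] Let_def[of "{..<n}"] power_one_right simps
      using w S' MS correct by blast
  qed
qed

end
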